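(* Let $G$ be a maximal finite subgroup of $\mathrm{GL}(L)$. Then $G=\mathrm{Aut}_L(C)$ for some well rounded minimal class $C$ with respect to $L$ (and the fixed weight $\varphi$) such that $C\cap\mathcal{F}(G)$ spans a subspace of $\mathcal{F}(G)$ of dimension $1$.
   Context: Setting: $K$ is a finite-dimensional division algebra over $\mathbb{Q}$, $\mathbb{O}$ a maximal order in $K$, $A=M_n(K)$, $V=K^n$. $K_{\mathbb{R}}=K\otimes_{\mathbb{Q}}\mathbb{R}$ is identified with a direct sum of algebras $M_{d/2}(\mathbb{H})$, $M_d(\mathbb{R})$, $M_d(\mathbb{C})$; $^*$ is transposition composed with the standard conjugation on each summand, and $X^\dagger$ is the transpose of the entrywise $^*$ of a matrix $X$ over $K_{\mathbb{R}}$. $\Sigma=\{F\in M_n(K_{\mathbb{R}})\mid F^\dagger=F\}$ with $\langle F_1,F_2\rangle=\mathrm{trace}(F_1F_2)$ (reduced trace); $\mathcal{P}\subset\Sigma$ is the cone of elements positive definite in every simple summand. $F[x]=\langle F,xx^\dagger\rangle$. $L$ is a right $\mathbb{O}$-lattice in $V$, $\mathrm{GL}(L)=\{a\in A\mid aL=L\}$, and $\varphi$ is a fixed weight: a $\mathrm{GL}(L)$-invariant function on nonzero vectors of $K^n$, constant on right $K^\times$-multiples, with positive real values and maximum $1$. For $F\in\mathcal{P}$, $\min_L(F)=\min_{\ell\in L\setminus\{0\}}\varphi(\ell)F[\ell]$, $S_L(F)$ the set of $\ell\in L\setminus\{0\}$ attaining it, and the minimal class $\mathrm{Cl}_L(F)=\{F'\in\mathcal{P}\mid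 S_L(F')=S_L(F)\}$, with $S_L(C)$ the common minimal vectors of a class $C$. $C$ is well rounded if $S_L(C)$ contains a $K$-basis of $V$. $\mathrm{Aut}_L(C)=\{g\in\mathrm{GL}(L)\mid gS_L(C)=S_L(C)\}$. $\mathcal{F}(G)=\{F\in\Sigma\mid g^\dagger Fg=F\ \forall g\in G\}$. *)

theory Defs
  imports "HOL-Analysis.Analysis" "HOL-Algebra.Group"
begin

section \<open>Hamilton quaternions\<close>

datatype quat = Quat (qre: real) (qi: real) (qj: real) (qk: real)

lemma quat_eq_iff: "x = y \<longleftrightarrow> qre x = qre y \<and> qi x = qi y \<and> qj x = qj y \<and> qk x = qk y"
  by (cases x; cases y) auto

instantiation quat :: real_algebra_1
begin

definition "0 = Quat 0 0 0 0"
definition "1 = Quat 1 0 0 0"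
definition "x + y = Quat (qre x + qre y) (qi x + qi y) (qj x + qj y) (qk x + qk y)"
definition "- x = Quat (- qre x) (- qi x) (- qj x) (- qk x)"
definition "x - y = Quat (qre x - qre y) (qi x - qi y) (qj x - qj y) (qk x - qk y)"
definition "x * y = Quat
  (qre x * qre y - qi x * qi y - qj x * qj y - qk x * qk y)
  (qre x * qi y + qi x * qre y + qj x * qk y - qk x * qj y)
  (qre x * qj y - qi x * qk y + qj x * qre y + qk x * qi y)
  (qre x * qk y + qi x * qj y - qj x * qi y + qk x * qre y)"
definition "scaleR r x = Quat (r * qre x) (r * qi x) (r * qj x) (r * qk x)"

lemmas quat_ops_defs = zero_quat_def one_quat_def plus_quat_def uminus_quat_def
  minus_quat_def times_quat_def scaleR_quat_def

instance
  by standard (simp_all add: quat_ops_defs quat_eq_iff algebra_simps)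

end

section \<open>Standard conjugation on the real, complex and quaternion numbers\<close>

class std_conj = real_algebra_1 +
  fixes std_conj :: "'a \<Rightarrow> 'a"
  assumes std_conj_add: "std_conj (x + y) = std_conj x + std_conj y"
    and std_conj_scaleR: "std_conj (scaleR r x) = scaleR r (std_conj x)"
    and std_conj_mult: "std_conj (x * y) = std_conj y * std_conj x"
    and std_conj_std_conj: "std_conj (std_conj x) = x"
    and std_conj_pos: "x \<noteq> 0 \<Longrightarrow> \<exists>r>0. std_conj x * x = scaleR r 1"

instantiation real :: std_conj
begin
definition "std_conj (x::real) = x"
instance
proof
  fix x :: real assume "x \<noteq> 0"
  then show "\<exists>r>0. std_conj x * x = scaleR r 1"
    by (intro exI[of _ "x * x"]) (auto simp: std_conj_real_def zero_less_mult_iff)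
qed (simp_all add: std_conj_real_def algebra_simps)
end

instantiation complex :: std_conj
begin
definition "std_conj (x::complex) = cnj x"
instance
proof
  fix x :: complex assume "x \<noteq> 0"
  then show "\<exists>r>0. std_conj x * x = scaleR r 1"
    by (intro exI[of _ "(Re x)\<^sup>2 + (Im x)\<^sup>2"])
      (auto simp: std_conj_complex_def complex_eq_iff power2_eq_square sum_power2_gt_zero_iff[unfolded power2_eq_square])
qed (simp_all add: std_conj_complex_def algebra_simps)
end

instantiation quat :: std_conj
begin
definition "std_conj (x::quat) = Quat (qre x) (- qi x) (- qj x) (- qk x)"
instance
proof
  fix x :: quat assume x: "x \<noteq> 0"
  let ?r = "(qre x)\<^sup>2 + (qi x)\<^sup>2 + (qj x)\<^sup>2 + (qk x)\<^sup>2"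
  have "?r > 0"
    using x unfolding quat_eq_iff zero_quat_def quat.sel
    by (smt (verit) zero_less_power2 zero_le_power2)
  moreover have "std_conj x * x = scaleR ?r 1"
    by (simp add: std_conj_quat_def quat_ops_defs power2_eq_square algebra_simps)
  ultimately show "\<exists>r>0. std_conj x * x = scaleR r 1" by blast
qed (simp_all add: std_conj_quat_def quat_ops_defs algebra_simps)
end

definition conj_transpose :: "'a::std_conj^'m^'m \<Rightarrow> 'a^'m^'m" where
  "conj_transpose X = (\<chi> i j. std_conj (X $ j $ i))"

definition pos_def :: "'a::std_conj^'m^'m \<Rightarrow> bool" where
  "pos_def M \<longleftrightarrow> conj_transpose M = M \<and>
    (\<forall>x. x \<noteq> 0 \<longrightarrow> (\<exists>r>0. (\<Sum>i\<in>UNIV. \<Sum>j\<in>UNIV. std_conj (x $ i) * M $ i $ j * x $ j) = of_real r))"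

definition flatten :: "('a^'m^'m)^'n^'n \<Rightarrow> 'a^('n \<times> 'm)^('n \<times> 'm)" where
  "flatten F = (\<chi> p q. F $ fst p $ fst q $ snd p $ snd q)"

definition map_matrix :: "('a \<Rightarrow> 'b) \<Rightarrow> 'a^'n^'m \<Rightarrow> 'b^'n^'m" where
  "map_matrix f X = (\<chi> i j. f (X $ i $ j))"

section \<open>Division algebras over the rationals, orders and lattices\<close>

locale rat_division_algebra = vector_space scaleQ
  for scaleQ :: "rat \<Rightarrow> 'k::division_ring \<Rightarrow> 'k" +
  assumes scaleQ_left: "scaleQ q (x * y) = scaleQ q x * y"
    and scaleQ_right: "scaleQ q (x * y) = x * scaleQ q y"
    and finite_dimensional: "\<exists>B. finite B \<and> module.span scaleQ B = UNIV"

definition Q_basis :: "(rat \<Rightarrow> 'k::division_ring \<Rightarrow> 'k) \<Rightarrow> 'k set \<Rightarrow> bool" where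
  "Q_basis scaleQ B \<longleftrightarrow> \<not> module.dependent scaleQ B \<and> module.span scaleQ B = UNIV"

definition is_order :: "(rat \<Rightarrow> 'k::division_ring \<Rightarrow> 'k) \<Rightarrow> 'k set \<Rightarrow> bool" where
  "is_order scaleQ R \<longleftrightarrow>
     1 \<in> R \<and> (\<forall>x\<in>R. \<forall>y\<in>R. x - y \<in> R \<and> x * y \<in> R) \<and>
     (\<exists>B. finite B \<and> R = {(\<Sum>b\<in>B. of_int (c b) * b) | c. True}) \<and>
     module.span scaleQ R = UNIV"

definition maximal_order :: "(rat \<Rightarrow> 'k::division_ring \<Rightarrow> 'k) \<Rightarrow> 'k set \<Rightarrow> bool" where
  "maximal_order scaleQ R \<longleftrightarrow>
     is_order scaleQ R \<and> (\<forall>R'. is_order scaleQ R' \<and> R \<subseteq> R' \<longrightarrow> R' = R)"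

text \<open>\<open>'k^'n\<close> is regarded as a right \<open>'k\<close>-vector space, on which matrices act from the left.\<close>

definition rscale :: "'k::times^'n \<Rightarrow> 'k \<Rightarrow> 'k^'n" where
  "rscale v a = (\<chi> i. v $ i * a)"

definition right_basis :: "('k::division_ring^'n) set \<Rightarrow> bool" where
  "right_basis B \<longleftrightarrow> finite B \<and>
     (\<forall>v. \<exists>!c. (\<forall>b. b \<notin> B \<longrightarrow> c b = 0) \<and> v = (\<Sum>b\<in>B. rscale b (c b)))"

definition right_lattice :: "'k::division_ring set \<Rightarrow> ('k^'n) set \<Rightarrow> bool" where
  "right_lattice R L \<longleftrightarrow>
     (\<exists>B. finite B \<and> L = {(\<Sum>b\<in>B. rscale b (c b)) | c. \<forall>b\<in>B. c b \<in> R}) \<and>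
     (\<exists>B\<subseteq>L. right_basis B)"

definition GL :: "('k::division_ring^'n) set \<Rightarrow> ('k^'n^'n) monoid" where
  "GL L = \<lparr>carrier = {a. (\<lambda>v. a *v v) ` L = L}, monoid.mult = (**), one = mat 1\<rparr>"

definition maximal_finite_subgroup :: "'g set \<Rightarrow> 'g monoid \<Rightarrow> bool" where
  "maximal_finite_subgroup G \<Gamma> \<longleftrightarrow>
     subgroup G \<Gamma> \<and> finite G \<and> (\<forall>H. subgroup H \<Gamma> \<and> finite H \<and> G \<subseteq> H \<longrightarrow> H = G)"

section \<open>The real algebra obtained by extension of scalars\<close>

text \<open>
  The type \<open>'a\<close> plays the role of the tensor product of \<open>'k\<close> with the real numbers over the
  rational numbers, and \<open>emb\<close> is the map sending \<open>x\<close> to \<open>x \<otimes> 1\<close>.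
  The direct sum decomposition is given by its projections. The index sets \<open>HS\<close>, \<open>RS\<close>, \<open>CS\<close> of
  quaternionic, real and complex simple summands may be empty.
\<close>

record ('k, 'a, 'h, 'd) real_extension =
  emb :: "'k \<Rightarrow> 'a"
  HS :: "nat set"
  RS :: "nat set"
  CS :: "nat set"
  projH :: "nat \<Rightarrow> 'a \<Rightarrow> quat^'h^'h"
  projR :: "nat \<Rightarrow> 'a \<Rightarrow> real^'d^'d"
  projC :: "nat \<Rightarrow> 'a \<Rightarrow> complex^'d^'d"

definition real_algebra_hom :: "('a::real_algebra_1 \<Rightarrow> 'b::real_algebra_1^'m^'m) \<Rightarrow> bool" where
  "real_algebra_hom f \<longleftrightarrow> linear f \<and> f 1 = mat 1 \<and> (\<forall>x y. f (x * y) = f x ** f y)"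

text \<open>
  The third clause says that \<open>'a\<close> is the extension of scalars of \<open>'k\<close> to the reals along \<open>emb\<close>.
  The last two clauses say that the summands are \<open>M\<^bsub>d/2\<^esub>(\<H>)\<close>, \<open>M\<^sub>d(\<real>)\<close>, \<open>M\<^sub>d(\<complex>)\<close> with
  \<open>d = CARD('d)\<close>, and that the projections identify \<open>'a\<close> with their direct sum.
  If there is no quaternionic summand then \<open>'h\<close> is irrelevant.
\<close>

definition is_real_extension ::
  "(rat \<Rightarrow> 'k::division_ring \<Rightarrow> 'k) \<Rightarrow>
   ('k, 'a::real_algebra_1, 'h::finite, 'd::finite) real_extension \<Rightarrow> bool" where
  "is_real_extension scaleQ E \<longleftrightarrow>
     (\<forall>x y. emb E (x + y) = emb E x + emb E y) \<and>
     (emb E 1 = 1 \<and> (\<forall>x y. emb E (x * y) = emb E x * emb E y)) \<and>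
     (\<forall>B. Q_basis scaleQ B \<longrightarrow>
        inj_on (emb E) B \<and> independent (emb E ` B) \<and> span (emb E ` B) = UNIV) \<and>
     finite (HS E) \<and> finite (RS E) \<and> finite (CS E) \<and>
     (\<forall>s\<in>HS E. real_algebra_hom (projH E s)) \<and>
     (\<forall>s\<in>RS E. real_algebra_hom (projR E s)) \<and>
     (\<forall>s\<in>CS E. real_algebra_hom (projC E s)) \<and>
     (HS E \<noteq> {} \<longrightarrow> CARD('d) = 2 * CARD('h)) \<and>
     (\<forall>a b c. \<exists>!x. (\<forall>s\<in>HS E. projH E s x = a s) \<and>
        (\<forall>s\<in>RS E. projR E s x = b s) \<and> (\<forall>s\<in>CS E. projC E s x = c s))"

definition star :: "('k, 'a, 'h::finite, 'd::finite) real_extension \<Rightarrow> 'a \<Rightarrow> 'a" where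
  "star E x = (THE y.
     (\<forall>s\<in>HS E. projH E s y = conj_transpose (projH E s x)) \<and>
     (\<forall>s\<in>RS E. projR E s y = conj_transpose (projR E s x)) \<and>
     (\<forall>s\<in>CS E. projC E s y = conj_transpose (projC E s x)))"

text \<open>
  The reduced trace over the real numbers: on \<open>M\<^sub>m(\<H>)\<close> it is twice the real part of the matrix
  trace (the trace of the image in \<open>M\<^bsub>2m\<^esub>(\<complex>)\<close>); on \<open>M\<^sub>d(\<complex>)\<close> it is the reduced trace to the centre
  \<open>\<complex>\<close> followed by the trace from \<open>\<complex>\<close> to \<open>\<real>\<close>.
\<close>

definition red_trace :: "('k, 'a, 'h::finite, 'd::finite) real_extension \<Rightarrow> 'a \<Rightarrow> real" where
  "red_trace E x =
     (\<Sum>s\<in>HS E. 2 * qre (trace (projH E s x))) + (\<Sum>s\<in>RS E. trace (projR E s x)) +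
     (\<Sum>s\<in>CS E. 2 * Re (trace (projC E s x)))"

definition dagger ::
  "('k, 'a, 'h::finite, 'd::finite) real_extension \<Rightarrow> 'a^'n^'n \<Rightarrow> 'a^'n^'n" where
  "dagger E X = (\<chi> i j. star E (X $ j $ i))"

definition Sym :: "('k, 'a, 'h::finite, 'd::finite) real_extension \<Rightarrow> ('a^'n^'n) set" where
  "Sym E = {F. dagger E F = F}"

text \<open>Reduced trace of \<open>F\<^sub>1 F\<^sub>2\<close>, the reduced trace of a matrix over \<open>'a\<close> being that of the sum
  of its diagonal entries.\<close>

definition form_inner ::
  "('k, 'a::real_algebra_1, 'h::finite, 'd::finite) real_extension \<Rightarrow> 'a^'n^'n \<Rightarrow> 'a^'n^'n \<Rightarrow> real"
  where "form_inner E F1 F2 = red_trace E (trace (F1 ** F2))"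

definition pos_cone :: "('k, 'a, 'h::finite, 'd::finite) real_extension \<Rightarrow> ('a^'n^'n) set" where
  "pos_cone E = {F \<in> Sym E.
     (\<forall>s\<in>HS E. pos_def (flatten (map_matrix (projH E s) F))) \<and>
     (\<forall>s\<in>RS E. pos_def (flatten (map_matrix (projR E s) F))) \<and>
     (\<forall>s\<in>CS E. pos_def (flatten (map_matrix (projC E s) F)))}"

definition form_val ::
  "('k, 'a::real_algebra_1, 'h::finite, 'd::finite) real_extension \<Rightarrow> 'a^'n^'n \<Rightarrow> 'k^'n \<Rightarrow> real"
  where "form_val E F x = form_inner E F (\<chi> i j. emb E (x $ i) * star E (emb E (x $ j)))"

section \<open>Weighted minima and minimal classes\<close>

definition is_weight :: "('k::division_ring^'n) set \<Rightarrow> ('k^'n \<Rightarrow> real) \<Rightarrow> bool" where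
  "is_weight L \<phi> \<longleftrightarrow>
     (\<forall>g\<in>carrier (GL L). \<forall>x. x \<noteq> 0 \<longrightarrow> \<phi> (g *v x) = \<phi> x) \<and>
     (\<forall>x a. x \<noteq> 0 \<and> a \<noteq> 0 \<longrightarrow> \<phi> (rscale x a) = \<phi> x) \<and>
     (\<forall>x. x \<noteq> 0 \<longrightarrow> 0 < \<phi> x \<and> \<phi> x \<le> 1) \<and> (\<exists>x. x \<noteq> 0 \<and> \<phi> x = 1)"

text \<open>The minimum is written as an infimum; if it were not attained, \<open>min_vecs\<close> would be empty.\<close>

definition weighted_min ::
  "('k, 'a::real_algebra_1, 'h::finite, 'd::finite) real_extension \<Rightarrow> ('k::zero^'n) set \<Rightarrow>
   ('k^'n \<Rightarrow> real) \<Rightarrow> 'a^'n^'n \<Rightarrow> real" where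
  "weighted_min E L \<phi> F = (INF l \<in> L - {0}. \<phi> l * form_val E F l)"

definition min_vecs ::
  "('k, 'a::real_algebra_1, 'h::finite, 'd::finite) real_extension \<Rightarrow> ('k::zero^'n) set \<Rightarrow>
   ('k^'n \<Rightarrow> real) \<Rightarrow> 'a^'n^'n \<Rightarrow> ('k^'n) set" where
  "min_vecs E L \<phi> F = {l \<in> L - {0}. \<phi> l * form_val E F l = weighted_min E L \<phi> F}"

definition min_class ::
  "('k, 'a::real_algebra_1, 'h::finite, 'd::finite) real_extension \<Rightarrow> ('k::zero^'n) set \<Rightarrow>
   ('k^'n \<Rightarrow> real) \<Rightarrow> 'a^'n^'n \<Rightarrow> ('a^'n^'n) set" where
  "min_class E L \<phi> F = {F' \<in> pos_cone E. min_vecs E L \<phi> F' = min_vecs E L \<phi> F}"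

definition is_minimal_class ::
  "('k, 'a::real_algebra_1, 'h::finite, 'd::finite) real_extension \<Rightarrow> ('k::zero^'n) set \<Rightarrow>
   ('k^'n \<Rightarrow> real) \<Rightarrow> ('a^'n^'n) set \<Rightarrow> bool" where
  "is_minimal_class E L \<phi> C \<longleftrightarrow> (\<exists>F\<in>pos_cone E. C = min_class E L \<phi> F)"

definition class_min_vecs ::
  "('k, 'a::real_algebra_1, 'h::finite, 'd::finite) real_extension \<Rightarrow> ('k::zero^'n) set \<Rightarrow>
   ('k^'n \<Rightarrow> real) \<Rightarrow> ('a^'n^'n) set \<Rightarrow> ('k^'n) set" where
  "class_min_vecs E L \<phi> C = (\<Inter>F\<in>C. min_vecs E L \<phi> F)"

definition well_rounded ::
  "('k::division_ring, 'a::real_algebra_1, 'h::finite, 'd::finite) real_extension \<Rightarrow>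
   ('k^'n) set \<Rightarrow> ('k^'n \<Rightarrow> real) \<Rightarrow> ('a^'n^'n) set \<Rightarrow> bool" where
  "well_rounded E L \<phi> C \<longleftrightarrow> (\<exists>B\<subseteq>class_min_vecs E L \<phi> C. right_basis B)"

definition Aut_class ::
  "('k::division_ring, 'a::real_algebra_1, 'h::finite, 'd::finite) real_extension \<Rightarrow>
   ('k^'n) set \<Rightarrow> ('k^'n \<Rightarrow> real) \<Rightarrow> ('a^'n^'n) set \<Rightarrow> ('k^'n^'n) set" where
  "Aut_class E L \<phi> C =
     {g \<in> carrier (GL L). (\<lambda>v. g *v v) ` class_min_vecs E L \<phi> C = class_min_vecs E L \<phi> C}"

definition invariant_forms ::
  "('k, 'a::real_algebra_1, 'h::finite, 'd::finite) real_extension \<Rightarrow> ('k^'n^'n) set \<Rightarrow>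
   ('a^'n^'n) set" where
  "invariant_forms E G = {F \<in> Sym E.
     \<forall>g\<in>G. dagger E (map_matrix (emb E) g) ** F ** map_matrix (emb E) g = F}"

end

(* Write F[l] for the value of F at l. On the forms F fixed by G impose the linear inequalities
   phi(l) F[l] >= 1 for all nonzero l in L. By simultaneous Dirichlet approximation every solution is
   positive definite, because phi <= 1; so only finitely many inequalities are nearly tight, and they
   dominate every other form. Walking along a direction H that vanishes on the minimal vectors until a
   new one appears, one reaches a solution F for which no such H is left: C = Cl(F) meets the fixed
   forms in a ray. If the minimal vectors did not span, averaging a^dagger a over G for a functional a
   that vanishes on them would give such an H. Hence Aut(C) permutes a finite spanning set, is finite,
   contains G, and equals G by maximality.

   The inequalities have a solution only if phi is bounded away from 0. This holds because GL(L) has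
   finitely many orbits on lines: by the argument of Jordan and Zassenhaus every line is spanned by
   a member of a K-basis that generates, over the order, a sublattice of L of bounded exponent. *)

theory Submission
  imports Defs
begin

section \<open>Perfect points of families of linear inequalities\<close>

text \<open>Infinitely many inequalities have to survive one step along \<open>H\<close>. Those with
  value at most 2 are finitely many; for the others the change is at most a constant times the value
  itself, so a short step cannot bring them below 1. Both facts rest on one estimate:
  \<open>F[x]\<close> is at least \<open>\<delta>\<close> times the square of the sum of the
  absolute coordinates, for all \<open>x\<close> in \<open>K_R^n\<close>. Positive values on the
  lattice alone would not exclude a real isotropic line; but near a multiple \<open>t x\<close> with
  bounded \<open>t\<close> there is a nonzero lattice point, where \<open>F\<close> is bounded
  below.

  Division with remainder fails in a general order, and the lattice need not have a basis over it.
  The substitute is again approximation: for some \<open>t \<le> T\<close>, with \<open>T\<close>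
  not depending on \<open>x\<close>, the multiple \<open>t x\<close> is close to the order. All
  these \<open>t\<close> divide \<open>T!\<close>, so each coordinate costs one factor
  \<open>T!\<close>, and the exponent \<open>M = T!^n\<close> is the same for every line. Hence only
  finitely many lattices between \<open>O^n\<close> and \<open>O^n / M\<close> have to be
  distinguished, and finitely many weights occur.\<close>

lemma perfect_point_exists:
  fixes f :: "'x \<Rightarrow> 'v::real_vector \<Rightarrow> real"
  assumes lin: "\<And>l. l \<in> X \<Longrightarrow> linear (f l)"
    and sub: "subspace \<Phi>" and fin: "finite B" "span B = (UNIV :: 'v set)"
    and F0: "F0 \<in> \<Phi>" "\<And>l. l \<in> X \<Longrightarrow> 1 \<le> f l F0"
    and discrete: "\<And>F. F \<in> \<Phi> \<Longrightarrow> (\<And>l. l \<in> X \<Longrightarrow> 1 \<le> f l F) \<Longrightarrow> finite {l \<in> X. f l F \<le> 2}"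
    and bounded: "\<And>F H. F \<in> \<Phi> \<Longrightarrow> (\<And>l. l \<in> X \<Longrightarrow> 1 \<le> f l F) \<Longrightarrow> H \<in> \<Phi> \<Longrightarrow>
      \<exists>c>0. \<forall>l\<in>X. \<bar>f l H\<bar> \<le> c * f l F"
    and sep: "\<And>H. H \<in> \<Phi> \<Longrightarrow> (\<And>l. l \<in> X \<Longrightarrow> f l H = 0) \<Longrightarrow> H = 0"
  obtains F where "F \<in> \<Phi>" "\<And>l. l \<in> X \<Longrightarrow> 1 \<le> f l F"
    "\<And>H. H \<in> \<Phi> \<Longrightarrow> (\<And>l. l \<in> X \<Longrightarrow> f l F = 1 \<Longrightarrow> f l H = 0) \<Longrightarrow> H = 0"
proof -
  \<comment> \<open>Only \<open>real_vector\<close> is assumed of the type, so strict monotonicity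
    of \<open>dim\<close> needs a finite basis to interpret the finite-dimensional locale.\<close>
  obtain B' :: "'v set" where B': "independent B'" "span B' = UNIV" "finite B'"
  proof -
    obtain C where C: "C \<subseteq> B" "independent C" "B \<subseteq> span C"
      using maximal_independent_subset[of B] by blast
    have "span B \<subseteq> span C" using C(3) by (simp add: span_minimal)
    then show thesis using that[of C] C fin finite_subset[of C B] by auto
  qed
  interpret fd: finite_dimensional_vector_space "(*\<^sub>R) :: real \<Rightarrow> 'v \<Rightarrow> 'v" B'
    by unfold_locales (use B' in \<open>auto simp: span_raw_def dependent_raw_def\<close>)
  define R where "R = {F \<in> \<Phi>. \<forall>l\<in>X. 1 \<le> f l F}"
  define Ann where "Ann F = {H \<in> \<Phi>. \<forall>l\<in>X. f l F = 1 \<longrightarrow> f l H = 0}" for F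
  have subAnn: "subspace (Ann F)" for F
    using sub lin by (auto simp: Ann_def subspace_def linear_add linear_scale linear_0)
  \<comment> \<open>An extremal choice replaces the iterated walk: at a feasible point whose
    annihilator has least dimension no direction is left, since walking along one would shrink the
    annihilator.\<close>
  have "\<exists>F. F \<in> R \<and> (\<forall>F'. F' \<in> R \<longrightarrow> dim (Ann F) \<le> dim (Ann F'))"
    by (rule ex_has_least_nat[of _ F0]) (use F0 in \<open>auto simp: R_def\<close>)
  then obtain F where F: "F \<in> R" and minF: "\<And>F'. F' \<in> R \<Longrightarrow> dim (Ann F) \<le> dim (Ann F')"
    by blast
  have "H = 0" if H: "H \<in> Ann F" for H
  proof (rule ccontr)
    assume "H \<noteq> 0"
    then obtain l where l: "l \<in> X" "f l H \<noteq> 0" using sep[of H] H \<open>H \<noteq> 0\<close> unfolding Ann_def by blast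
    \<comment> \<open>The sign makes the value at \<open>l\<close> decrease, so feasibility along
      \<open>K\<close> ends at a finite time \<open>s\<close>.\<close>
    define K where "K = (if f l H < 0 then H else - H)"
    have K: "K \<in> Ann F" "f l K < 0"
      using H l subAnn[of F] linear_neg[OF lin[OF l(1)]] by (auto simp: K_def subspace_neg)
    have K\<Phi>: "K \<in> \<Phi>" using K by (simp add: Ann_def)
    have val: "f m (F + t *\<^sub>R K) = f m F + t * f m K" if "m \<in> X" for m t
      using lin[OF that] by (simp add: linear_add linear_scale)
    have in\<Phi>: "F + t *\<^sub>R K \<in> \<Phi>" for t
      using F K\<Phi> sub by (simp add: R_def subspace_add subspace_scale)
    define T where "T = {t. F + t *\<^sub>R K \<in> R}"
    have Tb: "t \<le> (f m F - 1) / (- f m K)" if "t \<in> T" "m \<in> X" "f m K < 0" for t m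
      using that by (simp add: T_def R_def val field_simps)
    have "0 \<in> T" using F by (simp add: T_def)
    have bdd: "bdd_above T" by (rule bdd_aboveI) (rule Tb[OF _ l(1) K(2)])
    define s where "s = Sup T"
    have upper: "t \<le> s" if "t \<in> T" for t using that bdd by (simp add: s_def cSup_upper)
    have s0: "0 \<le> s" using upper \<open>0 \<in> T\<close> .
    have sR: "F + s *\<^sub>R K \<in> R"
    proof -
      have "1 \<le> f m (F + s *\<^sub>R K)" if m: "m \<in> X" for m
      proof (cases "f m K < 0")
        case True
        have "s \<le> (f m F - 1) / (- f m K)"
          unfolding s_def using \<open>0 \<in> T\<close> Tb[OF _ m True] by (intro cSup_least) auto
        then show ?thesis using True by (simp add: val[OF m] field_simps)
      next
        case False
        then have "0 \<le> s * f m K" using s0 by simp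
        moreover have "1 \<le> f m F" using F m by (simp add: R_def)
        ultimately show ?thesis by (simp add: val[OF m])
      qed
      then show ?thesis using in\<Phi> by (simp add: R_def)
    qed
    let ?F = "F + s *\<^sub>R K"
    \<comment> \<open>\<open>K\<close> vanishes on every constraint tight at \<open>F\<close>, so
      these stay tight at \<open>?F\<close>.\<close>
    have subset: "Ann ?F \<subseteq> Ann F"
      using K(1) by (auto simp: Ann_def val)
    \<comment> \<open>Otherwise no newly tight constraint stops \<open>K\<close> at
      \<open>?F\<close>, and a further step \<open>\<epsilon>\<close> stays feasible, against the
      choice of \<open>s\<close> as supremum.\<close>
    have "K \<notin> Ann ?F"
    proof
      assume KA: "K \<in> Ann ?F"
      obtain c where c: "c > 0" "\<And>m. m \<in> X \<Longrightarrow> \<bar>f m K\<bar> \<le> c * f m ?F"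
        using bounded[of ?F K] sR K\<Phi> by (auto simp: R_def)
      define Y where "Y = {m \<in> X. f m ?F \<le> 2 \<and> f m ?F \<noteq> 1}"
      have "finite Y"
      proof (rule finite_subset)
        show "Y \<subseteq> {l \<in> X. f l ?F \<le> 2}" by (auto simp: Y_def)
        show "finite {l \<in> X. f l ?F \<le> 2}" using sR by (intro discrete) (auto simp: R_def)
      qed
      \<comment> \<open>Smallest slack among the nearly tight constraints; the inserted 1 covers an
        empty \<open>Y\<close> and caps \<open>\<mu>\<close> for the constraints with value above
        2.\<close>
      define \<mu> where "\<mu> = Min (insert 1 ((\<lambda>m. f m ?F - 1) ` Y))"
      have \<mu>: "\<mu> \<le> 1" "\<And>m. m \<in> Y \<Longrightarrow> \<mu> \<le> f m ?F - 1"
        using \<open>finite Y\<close> by (auto simp: \<mu>_def)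
      have "\<mu> > 0"
        using \<open>finite Y\<close> sR unfolding \<mu>_def
        by (subst Min_gr_iff) (auto simp: Y_def R_def less_le)
      \<comment> \<open>The change is then at most \<open>\<mu> / 2\<close> times the value
        \<open>x\<close>, and \<open>\<mu> / 2 * x \<le> x - 1\<close> for every \<open>x\<close>
        that is not tight: if \<open>x \<le> 2\<close> the left side is at most
        \<open>\<mu>\<close>, otherwise at most \<open>x / 2\<close>.\<close>
      define \<epsilon> where "\<epsilon> = \<mu> / (2 * c)"
      have \<epsilon>: "\<epsilon> > 0" using \<open>\<mu> > 0\<close> c by (simp add: \<epsilon>_def)
      have "1 \<le> f m ?F + \<epsilon> * f m K" if m: "m \<in> X" for m
      proof (cases "f m ?F = 1")
        case True
        then show ?thesis using KA m by (auto simp: Ann_def)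
      next
        case ne: False
        have ge1: "1 \<le> f m ?F" using sR m by (simp add: R_def)
        have "\<epsilon> * \<bar>f m K\<bar> \<le> \<epsilon> * (c * f m ?F)" using \<epsilon> c(2)[OF m] by simp
        also have "\<dots> = \<mu> / 2 * f m ?F" using c by (simp add: \<epsilon>_def)
        finally have le: "\<epsilon> * \<bar>f m K\<bar> \<le> \<mu> / 2 * f m ?F" .
        have ab: "- (\<epsilon> * \<bar>f m K\<bar>) \<le> \<epsilon> * f m K"
          using \<epsilon> by (simp add: abs_if)
        have "\<mu> / 2 * f m ?F \<le> f m ?F - 1"
        proof (cases "f m ?F \<le> 2")
          case True
          have "\<mu> \<le> f m ?F - 1" using \<mu>(2)[of m] ne True m by (simp add: Y_def)
          moreover have "\<mu> * f m ?F \<le> \<mu> * 2" using True \<open>\<mu> > 0\<close> by simp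
          ultimately show ?thesis by simp
        next
          case False
          have "\<mu> * f m ?F \<le> 1 * f m ?F" using \<mu>(1) ge1 by (intro mult_right_mono) auto
          then show ?thesis using False by linarith
        qed
        then show ?thesis using le ab by linarith
      qed
      then have "s + \<epsilon> \<in> T"
        using in\<Phi>[of "s + \<epsilon>"] by (auto simp: T_def R_def val algebra_simps)
      then show False using upper \<epsilon> by fastforce
    qed
    then have "Ann ?F \<subset> Ann F" using subset K by blast
    then have "dim (Ann ?F) < dim (Ann F)"
      by (intro fd.dim_psubset[folded span_raw_def dim_raw_def])
        (simp only: span_eq_iff[THEN iffD2, OF subAnn])
    then show False using minF[OF sR] by simp
  qed
  then show thesis using that[of F] F by (auto simp: R_def Ann_def)
qed


section \<open>Simultaneous approximation and quadratic forms bounded below on a lattice\<close>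

lemma dirichlet_approx_finite:
  fixes c :: "'i \<Rightarrow> real"
  assumes "finite I" "N > 0"
  obtains q :: nat and z :: "'i \<Rightarrow> int"
  where "0 < q" "q \<le> N ^ card I" "\<And>p. p \<in> I \<Longrightarrow> \<bar>of_nat q * c p - of_int (z p)\<bar> < 1 / N"
proof -
  obtain h where h: "bij_betw h {0..<card I} I"
    using ex_bij_betw_nat_finite[OF assms(1)] by blast
  obtain q w where qw: "0 < q" "q \<le> int (N ^ card I)"
    "\<And>i. i < card I \<Longrightarrow> \<bar>of_int q * (c \<circ> h) i - of_int (w i)\<bar> < 1 / N"
    using Dirichlet_approx_simult[OF assms(2), of "card I" "c \<circ> h"] by blast
  show thesis
  proof (rule that[of "nat q" "\<lambda>p. w (inv_into {0..<card I} h p)"])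
    show "0 < nat q" "nat q \<le> N ^ card I" using qw by linarith+
    fix p assume p: "p \<in> I"
    let ?i = "inv_into {0..<card I} h p"
    have "?i < card I" "h ?i = p"
      using h p bij_betw_inv_into_right[OF h p] inv_into_into[of p h "{0..<card I}"]
      by (auto simp: bij_betw_def)
    then show "\<bar>real (nat q) * c p - of_int (w ?i)\<bar> < 1 / N"
      using qw(3)[of ?i] qw(1) by simp
  qed
qed

lemma bilinear_expand:
  fixes b :: "'v::real_vector \<Rightarrow> 'v \<Rightarrow> real" and e :: "'i \<Rightarrow> 'v"
  assumes lin1: "\<And>y. linear (\<lambda>x. b x y)" and lin2: "\<And>x. linear (b x)"
  shows "b (\<Sum>p\<in>I. c p *\<^sub>R e p) (\<Sum>r\<in>I. d r *\<^sub>R e r) = (\<Sum>p\<in>I. \<Sum>r\<in>I. c p * d r * b (e p) (e r))"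
proof -
  have e1: "b (\<Sum>p\<in>I. c p *\<^sub>R e p) y = (\<Sum>p\<in>I. c p * b (e p) y)" for y
    using linear_sum[OF lin1[of y], of "\<lambda>p. c p *\<^sub>R e p" I] linear_scale[OF lin1[of y]]
    by simp
  have e2: "b x (\<Sum>r\<in>I. d r *\<^sub>R e r) = (\<Sum>r\<in>I. d r * b x (e r))" for x
    using linear_sum[OF lin2[of x], of "\<lambda>p. d p *\<^sub>R e p" I] linear_scale[OF lin2[of x]]
    by simp
  show ?thesis unfolding e1 unfolding e2 by (simp add: sum_distrib_left mult.assoc)
qed

lemma bilinear_coord_bound:
  fixes b :: "'v::real_vector \<Rightarrow> 'v \<Rightarrow> real" and e :: "'i \<Rightarrow> 'v"
  assumes fin: "finite I" and lin1: "\<And>y. linear (\<lambda>x. b x y)" and lin2: "\<And>x. linear (b x)"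
  obtains K where "K > 0" "\<And>c d. \<bar>b (\<Sum>p\<in>I. c p *\<^sub>R e p) (\<Sum>r\<in>I. d r *\<^sub>R e r)\<bar>
    \<le> K * (\<Sum>p\<in>I. \<bar>c p\<bar>) * (\<Sum>p\<in>I. \<bar>d p\<bar>)"
proof
  \<comment> \<open>The 1 keeps the bound positive when all values on the \<open>e p\<close>
    vanish.\<close>
  let ?K = "1 + (\<Sum>p\<in>I. \<Sum>r\<in>I. \<bar>b (e p) (e r)\<bar>)"
  show "?K > 0" by (intro add_pos_nonneg sum_nonneg) auto
  fix c d :: "'i \<Rightarrow> real"
  let ?n = "\<lambda>c :: 'i \<Rightarrow> real. \<Sum>p\<in>I. \<bar>c p\<bar>"
  have n0: "0 \<le> ?n c" for c by (simp add: sum_nonneg)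
  have le: "\<bar>c p\<bar> \<le> ?n c" if "p \<in> I" for c :: "'i \<Rightarrow> real" and p
    by (rule member_le_sum) (use fin that in auto)
  have "\<bar>b (\<Sum>p\<in>I. c p *\<^sub>R e p) (\<Sum>r\<in>I. d r *\<^sub>R e r)\<bar> \<le> (\<Sum>p\<in>I. \<Sum>r\<in>I. \<bar>c p * d r * b (e p) (e r)\<bar>)"
    unfolding bilinear_expand[of b, OF lin1 lin2]
    by (rule order_trans[OF sum_abs], rule sum_mono, rule sum_abs)
  also have "\<dots> \<le> (\<Sum>p\<in>I. \<Sum>r\<in>I. (?n c * ?n d) * \<bar>b (e p) (e r)\<bar>)"
    unfolding abs_mult by (intro sum_mono mult_mono mult_right_mono le n0 mult_nonneg_nonneg) auto
  also have "\<dots> = (?n c * ?n d) * (?K - 1)" by (simp add: sum_distrib_left)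
  also have "\<dots> \<le> (?n c * ?n d) * ?K" using n0 by (intro mult_left_mono mult_nonneg_nonneg) auto
  finally show "\<bar>b (\<Sum>p\<in>I. c p *\<^sub>R e p) (\<Sum>r\<in>I. d r *\<^sub>R e r)\<bar> \<le> ?K * ?n c * ?n d" by (simp add: mult_ac)
qed

text \<open>Nonnegativity follows from the lattice points \<open>\<lfloor>t c\<rfloor>\<close> as \<open>t \<rightarrow> \<infinity>\<close>, the strict bound from a
  lattice point that is Dirichlet-close to a bounded multiple of \<open>c\<close>.\<close>

lemma lattice_positive_bound:
  fixes b :: "'v::real_vector \<Rightarrow> 'v \<Rightarrow> real" and e :: "'i \<Rightarrow> 'v"
  assumes fin: "finite I"
    and lin1: "\<And>y. linear (\<lambda>x. b x y)" and lin2: "\<And>x. linear (b x)" and sym: "\<And>x y. b x y = b y x"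
    and eps: "\<epsilon> > 0" and lat: "\<And>z :: 'i \<Rightarrow> int. \<exists>p\<in>I. z p \<noteq> 0 \<Longrightarrow>
       \<epsilon> \<le> b (\<Sum>p\<in>I. of_int (z p) *\<^sub>R e p) (\<Sum>p\<in>I. of_int (z p) *\<^sub>R e p)"
  shows "\<exists>\<delta>>0. \<forall>c. \<delta> * (\<Sum>p\<in>I. \<bar>c p\<bar>)\<^sup>2 \<le> b (\<Sum>p\<in>I. c p *\<^sub>R e p) (\<Sum>p\<in>I. c p *\<^sub>R e p)"
proof -
  define X where "X c = (\<Sum>p\<in>I. c p *\<^sub>R e p)" for c :: "'i \<Rightarrow> real"
  define n where "n c = (\<Sum>p\<in>I. \<bar>c p\<bar>)" for c :: "'i \<Rightarrow> real"
  define q where "q x = b x x" for x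
  define m where "m = card I"
  have q_scale: "q (t *\<^sub>R x) = t\<^sup>2 * q x" for t x
    using linear_scale[OF lin1] linear_scale[OF lin2] by (simp add: q_def power2_eq_square)
  have q_add: "q (x + y) = q x + 2 * b x y + q y" for x y
    using linear_add[OF lin1] linear_add[OF lin2] sym[of x y] by (simp add: q_def)
  have q_diff: "q (x - y) = q x - 2 * b x y + q y" for x y
    using linear_diff[OF lin1] linear_diff[OF lin2] sym[of x y] by (simp add: q_def)
  have q0: "q 0 = 0" using q_scale[of 0 0] by simp
  obtain K where K: "K > 0" "\<And>c d. \<bar>b (X c) (X d)\<bar> \<le> K * n c * n d"
    using bilinear_coord_bound[OF fin lin1 lin2, of e] unfolding X_def n_def by blast
  have n0: "0 \<le> n c" for c by (simp add: n_def sum_nonneg)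
  have X_diff: "X (\<lambda>p. c p - d p) = X c - X d" for c d
    by (simp add: X_def scaleR_left_diff_distrib sum_subtractf)
  have X_scale: "X (\<lambda>p. t * c p) = t *\<^sub>R X c" for t c
    by (simp add: X_def scaleR_sum_right)
  have qX0: "q (X c) = 0" if "\<forall>p\<in>I. c p = 0" for c
    using that q0 by (simp add: X_def)
  have lat': "\<epsilon> \<le> q (X (\<lambda>p. of_int (z p)))" if "\<exists>p\<in>I. z p \<noteq> 0" for z
    using lat[OF that] by (simp add: X_def q_def)
  have n_le: "n y \<le> s * real m" if "\<And>p. p \<in> I \<Longrightarrow> \<bar>y p\<bar> \<le> s" for y s
    using sum_bounded_above[of I "\<lambda>p. \<bar>y p\<bar>" s] that by (simp add: n_def m_def mult.commute)
  have nonneg: "0 \<le> q (X c)" for c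
  proof (rule ccontr)
    assume neg: "\<not> 0 \<le> q (X c)"
    \<comment> \<open>\<open>D\<close> bounds the two error terms of rounding \<open>t c\<close>,
      divided by \<open>t\<close>. The error grows only linearly in \<open>t\<close>, so
      \<open>t * - q (X c)\<close> stays bounded, which is impossible for a negative
      \<open>q (X c)\<close>.\<close>
    define D where "D = 2 * (K * n c * real m) + K * real m * real m"
    have bound: "real t * - q (X c) \<le> D" if "t > 0" for t :: nat
    proof -
      define z where "z p = \<lfloor>real t * c p\<rfloor>" for p
      define y where "y p = real t * c p - of_int (z p)" for p
      have y: "n y \<le> real m"
      proof -
        have "\<bar>y p\<bar> \<le> 1" for p unfolding y_def z_def by linarith
        then show ?thesis using n_le[of y 1] by simp
      qed
      have "0 \<le> q (X (\<lambda>p. of_int (z p)))"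
        using lat'[of z] eps qX0[of "\<lambda>p. of_int (z p)"] by (cases "\<exists>p\<in>I. z p \<noteq> 0") auto
      also have "(\<lambda>p. of_int (z p)) = (\<lambda>p. real t * c p - y p)" by (auto simp: y_def)
      also have "q (X \<dots>) = (real t)\<^sup>2 * q (X c) - 2 * real t * b (X c) (X y) + q (X y)"
        unfolding X_diff X_scale q_diff q_scale using linear_scale[OF lin1] by simp
      finally have eq: "0 \<le> (real t)\<^sup>2 * q (X c) - 2 * real t * b (X c) (X y) + q (X y)" .
      have qy: "q (X y) \<le> K * real m * real m"
        using K(2)[of y y] y n0[of y] K(1) mult_mono[OF y y]
        by (smt (verit, ccfv_SIG) mult.assoc mult_left_mono of_nat_0_le_iff q_def)
      have byy: "- (2 * real t * b (X c) (X y)) \<le> 2 * real t * (K * n c * real m)"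
      proof -
        have "- b (X c) (X y) \<le> K * n c * n y" using K(2)[of c y] by linarith
        also have "\<dots> \<le> K * n c * real m" using y K(1) n0 by (intro mult_left_mono) auto
        finally have "- b (X c) (X y) \<le> K * n c * real m" .
        then have "2 * real t * - b (X c) (X y) \<le> 2 * real t * (K * n c * real m)"
          by (intro mult_left_mono) auto
        then show ?thesis by (simp only: mult_minus_right)
      qed
      have "0 \<le> (real t)\<^sup>2 * q (X c) + 2 * real t * (K * n c * real m) + K * real m * real m"
        using eq qy byy by linarith
      also have "K * real m * real m \<le> real t * (K * real m * real m)"
        using that K(1) mult_right_mono[of 1 "real t" "K * real m * real m"] by simp
      finally have "0 \<le> real t * (real t * q (X c) + D)"
        by (simp add: D_def power2_eq_square algebra_simps)
      then show ?thesis using that by (simp add: zero_le_mult_iff)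
    qed
    obtain t :: nat where "D < real t * - q (X c)"
      using reals_Archimedean3[of "- q (X c)"] neg by auto
    moreover have "0 \<le> D" using K(1) n0 by (simp add: D_def)
    ultimately show False using bound[of t] by (cases "t = 0") auto
  qed
  \<comment> \<open>Uses nonnegativity of \<open>q\<close> at the sum of \<open>c\<close> and
    \<open>d\<close>, which is why nonnegativity is settled first.\<close>
  have parallelogram: "q (X u) \<le> 2 * q (X c) + 2 * q (X d)" if "u = (\<lambda>p. c p - d p)" for u c d
  proof -
    have "0 \<le> q (X (\<lambda>p. c p - (- 1) * d p))" by (rule nonneg)
    then have "0 \<le> q (X c) + 2 * b (X c) (X d) + q (X d)"
      unfolding X_diff X_scale by (simp add: q_add)
    then show ?thesis by (simp add: that X_diff q_diff)
  qed
  \<comment> \<open>Makes the form at most \<open>\<epsilon> / 4\<close> on a rounding error of size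
    \<open>1 / N\<close> per coordinate; from \<open>\<epsilon> \<le> 2 * q (t c) + 2 * q y\<close>
    there remains \<open>\<epsilon> / 4 \<le> q (t c)\<close>.\<close>
  obtain N0 :: nat where N0: "4 * K * (real m)\<^sup>2 / \<epsilon> < real N0"
    using reals_Archimedean2 by blast
  define N where "N = Suc N0"
  have N: "K * (real m / real N) * (real m / real N) \<le> \<epsilon> / 4"
  proof -
    have "4 * K * (real m)\<^sup>2 < \<epsilon> * real N0" using N0 eps by (simp add: field_simps)
    also have "\<dots> \<le> \<epsilon> * (real N * real N)" using eps unfolding N_def
      by (intro mult_left_mono) (auto simp: algebra_simps)
    finally have "K * (real m)\<^sup>2 / (real N * real N) \<le> \<epsilon> / 4" by (simp add: N_def divide_le_eq)
    then show ?thesis by (simp add: power2_eq_square mult.assoc)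
  qed
  \<comment> \<open>The square of \<open>N ^ m\<close> undoes the scaling by
    \<open>t \<le> N ^ m\<close>, a bound uniform in \<open>c\<close>.\<close>
  define \<delta> where "\<delta> = \<epsilon> / (4 * (real (N ^ m))\<^sup>2)"
  have \<delta>: "\<delta> > 0" using eps by (simp add: \<delta>_def N_def)
  have large: "\<delta> \<le> q (X c)" if p: "p \<in> I" "1 \<le> \<bar>c p\<bar>" for c p
  proof -
    obtain t z where t: "0 < t" "t \<le> N ^ m"
      and z: "\<And>p. p \<in> I \<Longrightarrow> \<bar>real t * c p - of_int (z p)\<bar> < 1 / N"
      using dirichlet_approx_finite[OF fin, of N c] by (auto simp: N_def m_def)
    define y where "y p = real t * c p - of_int (z p)" for p
    \<comment> \<open>A coordinate of size at least 1 ensures that the approximating lattice point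
      is not 0, so the lower bound on lattice points applies.\<close>
    have "z p \<noteq> 0"
    proof
      assume "z p = 0"
      then have "real t * \<bar>c p\<bar> < 1 / N" using z[OF p(1)] by (simp add: abs_mult)
      also have "\<dots> \<le> 1" by (simp add: N_def)
      finally show False using mult_mono[of 1 "real t" 1 "\<bar>c p\<bar>"] t p by simp
    qed
    then have "\<epsilon> \<le> q (X (\<lambda>p. of_int (z p)))" using lat' p by blast
    also have "\<dots> \<le> 2 * q (X (\<lambda>p. real t * c p)) + 2 * q (X y)"
      by (rule parallelogram) (auto simp: y_def)
    also have "q (X y) \<le> \<epsilon> / 4"
    proof -
      have "n y \<le> real m / N" using n_le[of y "1 / N"] z by (force simp: y_def)
      then have "K * n y * n y \<le> K * (real m / N) * (real m / N)"
        using K(1) n0 by (intro mult_mono mult_left_mono mult_nonneg_nonneg) auto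
      then show ?thesis using K(2)[of y y] N unfolding q_def by linarith
    qed
    finally have "\<epsilon> / 4 \<le> (real t)\<^sup>2 * q (X c)" by (simp add: X_scale q_scale)
    also have "\<dots> \<le> (real (N ^ m))\<^sup>2 * q (X c)"
      using t nonneg by (intro mult_right_mono power_mono) auto
    finally show ?thesis by (simp add: \<delta>_def N_def field_simps)
  qed
  have "\<delta> / (real m)\<^sup>2 * (n c)\<^sup>2 \<le> q (X c)" for c
  proof (cases "n c = 0")
    case True
    then show ?thesis using nonneg by simp
  next
    case False
    then have "n c > 0" using n0[of c] by simp
    then have "m > 0" using fin by (auto simp: m_def n_def card_gt_0_iff)
    \<comment> \<open>Mean absolute coefficient. Some coefficient reaches it, so
      \<open>c / s\<close> falls under \<open>large\<close>, and homogeneity gives the bound for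
      \<open>c\<close>.\<close>
    define s where "s = n c / real m"
    have s: "s > 0" using \<open>n c > 0\<close> \<open>m > 0\<close> by (simp add: s_def)
    have "\<exists>p\<in>I. s \<le> \<bar>c p\<bar>"
    proof (rule ccontr)
      assume "\<not> ?thesis"
      then have "n c < (\<Sum>p\<in>I. s)"
        unfolding n_def using fin \<open>m > 0\<close> by (intro sum_strict_mono) (auto simp: m_def card_gt_0_iff not_le)
      then show False using \<open>m > 0\<close> by (simp add: s_def m_def)
    qed
    then obtain p where "p \<in> I" "s \<le> \<bar>c p\<bar>" by blast
    then have "\<delta> \<le> q (X (\<lambda>p. (1 / s) * c p))"
      using s by (intro large[of p]) (auto simp: abs_mult)
    then have "\<delta> * s\<^sup>2 \<le> q (X c)"
      unfolding X_scale q_scale using s by (simp add: field_simps)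
    then show ?thesis by (simp add: s_def power_divide)
  qed
  moreover have "\<delta> / (real m)\<^sup>2 > 0" if "m > 0" using that \<delta> by simp
  moreover have "n c = 0" if "m = 0" for c using that fin by (simp add: m_def n_def)
  ultimately show ?thesis
  proof (cases "m = 0")
    case True
    then show ?thesis using fin q0 by (intro exI[of _ 1]) (simp add: m_def q_def)
  qed (auto simp: X_def n_def q_def intro!: exI[of _ "\<delta> / (real m)\<^sup>2"])
qed

section \<open>Matrices with standard conjugation\<close>

lemma std_conj_0 [simp]: "std_conj 0 = (0 :: 'a::std_conj)"
  using std_conj_scaleR[of 0 "0 :: 'a"] by simp

lemma std_conj_1 [simp]: "std_conj 1 = (1 :: 'a::std_conj)"
  using std_conj_mult[of "std_conj 1 :: 'a" 1] by (simp add: std_conj_std_conj)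

lemma std_conj_of_real [simp]: "std_conj (of_real r) = (of_real r :: 'a::std_conj)"
  by (simp add: of_real_def std_conj_scaleR)

lemma std_conj_sum: "std_conj (sum f A) = (\<Sum>x\<in>A. std_conj (f x :: 'a::std_conj))"
  by (induction A rule: infinite_finite_induct) (auto simp: std_conj_add)

text \<open>The real part, recovered from the class axioms alone as half of the trace. One
  development then serves real, complex and quaternionic summands.\<close>

definition std_re :: "'a::std_conj \<Rightarrow> real" where
  "std_re x = (THE r. x + std_conj x = of_real (2 * r))"

lemma std_re_eqI: "x + std_conj x = of_real (2 * r) \<Longrightarrow> std_re x = r"
  unfolding std_re_def by (rule the_equality) (auto simp: of_real_eq_iff simp del: of_real_mult)

text \<open>The trace of \<open>x\<close> is real because \<open>x\<close> and \<open>x + 1\<close> both have real norms.\<close>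

lemma std_re: "x + std_conj x = of_real (2 * std_re x)" for x :: "'a::std_conj"
proof -
  have norm: "\<exists>r. std_conj y * y = of_real r" for y :: 'a
    using std_conj_pos[of y] by (cases "y = 0") (auto simp: of_real_def intro: exI[of _ 0])
  obtain r s where rs: "std_conj x * x = of_real r" "std_conj (x + 1) * (x + 1) = of_real s"
    using norm by metis
  then have "x + std_conj x = of_real (s - r - 1)"
    by (simp add: std_conj_add algebra_simps)
  moreover have "s - r - 1 = 2 * ((s - r - 1) / 2)" by simp
  ultimately have "x + std_conj x = of_real (2 * ((s - r - 1) / 2))" by (simp only:)
  then show ?thesis by (simp only: std_re_eqI)
qed

lemma std_conj_eq: "std_conj x = of_real (2 * std_re x) - x" for x :: "'a::std_conj"
  using std_re[of x] by (simp add: algebra_simps)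

lemma std_re_add: "std_re (x + y) = std_re x + std_re (y :: 'a::std_conj)"
  by (rule std_re_eqI) (use std_re[of x] std_re[of y] in \<open>simp add: std_conj_add algebra_simps\<close>)

lemma std_re_scaleR: "std_re (c *\<^sub>R x) = c * std_re (x :: 'a::std_conj)"
proof (rule std_re_eqI)
  have "c *\<^sub>R x + std_conj (c *\<^sub>R x) = c *\<^sub>R (x + std_conj x)"
    by (simp add: std_conj_scaleR scaleR_add_right)
  then show "c *\<^sub>R x + std_conj (c *\<^sub>R x) = of_real (2 * (c * std_re x))"
    by (simp add: std_re of_real_def)
qed

lemma linear_std_re: "linear (std_re :: 'a::std_conj \<Rightarrow> real)"
  by (rule linearI) (auto simp: std_re_add std_re_scaleR)

lemma std_re_conj [simp]: "std_re (std_conj x) = std_re (x :: 'a::std_conj)"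
  by (rule std_re_eqI) (use std_re[of x] in \<open>simp add: std_conj_std_conj add.commute\<close>)

text \<open>Replacing \<open>std_conj z\<close> by \<open>2 * std_re z - z\<close> makes
  \<open>x * y + std_conj (x * y)\<close> symmetric in \<open>x\<close> and \<open>y\<close>.
  Quaternions do not commute, and this is what makes \<open>std_tr\<close> cyclic.\<close>

lemma std_re_commute: "std_re (x * y) = std_re (y * x :: 'a::std_conj)"
proof (rule std_re_eqI)
  have conj: "std_conj z = (2 * std_re z) *\<^sub>R 1 - z" for z :: 'a
    by (simp only: std_conj_eq of_real_def)
  have "x * y + std_conj (x * y) = y * x + std_conj (y * x)"
    unfolding std_conj_mult conj[of x] conj[of y]
    by (simp add: left_diff_distrib right_diff_distrib scaleR_diff_right mult.left_commute)
  then show "x * y + std_conj (x * y) = of_real (2 * std_re (y * x))" by (simp only: std_re)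
qed

lemma self_conj_real: "std_conj v = v \<Longrightarrow> v = of_real (std_re (v :: 'a::std_conj))"
proof -
  assume "std_conj v = v"
  then have "v + v = of_real (2 * std_re v)" using std_re[of v] by (simp only:)
  also have "\<dots> = 2 *\<^sub>R of_real (std_re v)" by (simp only: of_real_def scaleR_scaleR)
  finally have "2 *\<^sub>R v = 2 *\<^sub>R of_real (std_re v)" by (simp only: scaleR_2)
  then show ?thesis by simp
qed

lemma std_re_of_real: "std_re (of_real r :: 'a::std_conj) = r"
  by (rule std_re_eqI) (simp flip: of_real_add)

lemma std_re_norm: "0 \<le> std_re (x * std_conj x)" "std_re (x * std_conj x) = 0 \<longleftrightarrow> x = 0"
  for x :: "'a::std_conj"
proof -
  have "0 < std_re (x * std_conj x)" if "x \<noteq> 0"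
    using std_conj_pos[of "std_conj x"] that std_conj_std_conj[of x] std_re_of_real[where 'a='a]
    by (metis of_real_def std_conj_0)
  then show "0 \<le> std_re (x * std_conj x)" "std_re (x * std_conj x) = 0 \<longleftrightarrow> x = 0"
    using linear_0[OF linear_std_re[where 'a='a]] by (cases "x = 0"; force)+
qed

lemma std_re_real: "std_re x = (x :: real)"
  by (rule std_re_eqI) (simp add: std_conj_real_def)

lemma std_re_complex: "std_re x = Re x"
  by (rule std_re_eqI) (simp add: std_conj_complex_def complex_eq_iff)

lemma std_re_quat: "std_re x = qre x"
  by (rule std_re_eqI) (simp add: std_conj_quat_def quat_ops_defs of_real_def quat_eq_iff)

definition std_tr :: "'a::std_conj^'m^'m \<Rightarrow> real" where "std_tr M = std_re (trace M)"

lemma std_tr_alt: "std_tr M = (\<Sum>i\<in>UNIV. std_re (M $ i $ i))"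
  by (simp add: std_tr_def trace_def linear_sum[OF linear_std_re])

lemma linear_std_tr: "linear std_tr"
  by (rule linearI) (auto simp: std_tr_alt std_re_add std_re_scaleR sum.distrib sum_distrib_left)

lemma std_tr_mult: "std_tr (A ** B) = (\<Sum>i\<in>UNIV. \<Sum>j\<in>UNIV. std_re (A $ i $ j * B $ j $ i))"
  by (simp add: std_tr_alt matrix_matrix_mult_def linear_sum[OF linear_std_re])

lemma std_tr_commute: "std_tr (A ** B) = std_tr (B ** A)"
  unfolding std_tr_mult by (subst sum.swap) (simp add: std_re_commute)

lemma std_tr_conj_transpose: "std_tr (conj_transpose M) = std_tr M"
  by (simp add: std_tr_alt conj_transpose_def)

lemma std_tr_norm: "0 \<le> std_tr (M ** conj_transpose M)"
  "std_tr (M ** conj_transpose M) = 0 \<longleftrightarrow> M = 0"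
proof -
  have eq: "std_tr (M ** conj_transpose M) = (\<Sum>i\<in>UNIV. \<Sum>j\<in>UNIV. std_re (M $ i $ j * std_conj (M $ i $ j)))"
    by (simp add: std_tr_mult conj_transpose_def)
  show "0 \<le> std_tr (M ** conj_transpose M)" unfolding eq by (intro sum_nonneg std_re_norm)
  show "std_tr (M ** conj_transpose M) = 0 \<longleftrightarrow> M = 0"
    unfolding eq by (simp add: sum_nonneg_eq_0_iff sum_nonneg std_re_norm vec_eq_iff)
qed

lemma conj_transpose_add: "conj_transpose (A + B) = conj_transpose A + conj_transpose B"
  by (simp add: conj_transpose_def vec_eq_iff std_conj_add)

lemma conj_transpose_scaleR: "conj_transpose (c *\<^sub>R A) = c *\<^sub>R conj_transpose A"
  by (simp add: conj_transpose_def vec_eq_iff std_conj_scaleR)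

lemma conj_transpose_mult: "conj_transpose (A ** B) = conj_transpose B ** conj_transpose A"
  by (simp add: conj_transpose_def vec_eq_iff matrix_matrix_mult_def std_conj_sum std_conj_mult)

lemma conj_transpose_conj_transpose [simp]: "conj_transpose (conj_transpose A) = A"
  by (simp add: conj_transpose_def vec_eq_iff std_conj_std_conj)

text \<open>\<open>pos_def\<close> asks for a value that is a positive real scalar. Hermitian
  symmetry makes the double sum self-conjugate, hence real by \<open>self_conj_real\<close>, so only
  the sign of its real part is left to check.\<close>

lemma pos_defI:
  fixes M :: "'a::std_conj^'m^'m"
  assumes "conj_transpose M = M"
    and pos: "\<And>x. x \<noteq> 0 \<Longrightarrow>
      0 < std_re (\<Sum>i\<in>UNIV. \<Sum>j\<in>UNIV. std_conj (x $ i) * M $ i $ j * x $ j)"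
  shows "pos_def M"
proof -
  have M: "std_conj (M $ j $ i) = M $ i $ j" for i j
    using assms(1) by (auto simp: conj_transpose_def vec_eq_iff)
  have "std_conj (\<Sum>i\<in>UNIV. \<Sum>j\<in>UNIV. std_conj (x $ i) * M $ i $ j * x $ j) =
      (\<Sum>i\<in>UNIV. \<Sum>j\<in>UNIV. std_conj (x $ i) * M $ i $ j * x $ j)" for x
    unfolding std_conj_sum by (subst sum.swap) (simp add: std_conj_mult std_conj_std_conj M mult.assoc)
  then show ?thesis using assms(1) pos self_conj_real unfolding pos_def_def by blast
qed

text \<open>A vector is realised as a single column of a family of matrices.\<close>

lemma flatten_form:
  fixes p :: "'b \<Rightarrow> 'a::std_conj^'m^'m" and F :: "'b^'n^'n" and X :: "'n \<Rightarrow> 'a^'m^'m"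
  assumes X: "\<And>i. X i = (\<chi> a k. if k = k0 then x $ (i, a) else 0)"
  shows "std_re (\<Sum>i\<in>UNIV. \<Sum>j\<in>UNIV. std_conj (x $ i) * flatten (map_matrix p F) $ i $ j * x $ j)
    = (\<Sum>i\<in>UNIV. \<Sum>j\<in>UNIV. std_tr (p (F $ i $ j) ** X j ** conj_transpose (X i)))"
proof -
  have XX: "(X j ** conj_transpose (X i)) $ b $ a = x $ (j, b) * std_conj (x $ (i, a))" for i j a b
  proof -
    have "(X j ** conj_transpose (X i)) $ b $ a = (\<Sum>k\<in>UNIV. X j $ b $ k * conj_transpose (X i) $ k $ a)"
      by (simp add: matrix_matrix_mult_def)
    also have "\<dots> = (\<Sum>k\<in>UNIV. if k = k0 then x $ (j, b) * std_conj (x $ (i, a)) else 0)"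
      by (rule sum.cong) (auto simp: X conj_transpose_def)
    finally show ?thesis by simp
  qed
  have "std_tr (p (F $ i $ j) ** X j ** conj_transpose (X i)) =
    (\<Sum>a\<in>UNIV. \<Sum>b\<in>UNIV. std_re (std_conj (x $ (i, a)) * p (F $ i $ j) $ a $ b * x $ (j, b)))" for i j
    unfolding matrix_mul_assoc[symmetric] std_tr_mult XX
    by (intro sum.cong refl) (metis mult.assoc std_re_commute)
  then show ?thesis
    unfolding UNIV_Times_UNIV[symmetric] sum.cartesian_product'
    by (simp add: linear_sum[OF linear_std_re] flatten_def map_matrix_def)
      (rule sum.cong[OF refl sum.swap])
qed

section \<open>Hermitian forms over the real extension\<close>

lemma sum_swap4: "(\<Sum>i\<in>A. \<Sum>j\<in>B. \<Sum>l\<in>C. \<Sum>k\<in>D. f i j l k) = (\<Sum>k\<in>D. \<Sum>l\<in>C. \<Sum>i\<in>A. \<Sum>j\<in>B. f i j l k)"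
proof -
  have "(\<Sum>i\<in>A. \<Sum>j\<in>B. \<Sum>l\<in>C. \<Sum>k\<in>D. f i j l k) = (\<Sum>i\<in>A. \<Sum>l\<in>C. \<Sum>k\<in>D. \<Sum>j\<in>B. f i j l k)"
    by (rule sum.cong[OF refl], rule trans[OF sum.swap], rule sum.cong[OF refl], rule sum.swap)
  also have "\<dots> = (\<Sum>l\<in>C. \<Sum>k\<in>D. \<Sum>i\<in>A. \<Sum>j\<in>B. f i j l k)"
    by (rule trans[OF sum.swap], rule sum.cong[OF refl], rule sum.swap)
  also have "\<dots> = (\<Sum>k\<in>D. \<Sum>l\<in>C. \<Sum>i\<in>A. \<Sum>j\<in>B. f i j l k)" by (rule sum.swap)
  finally show ?thesis .
qed

lemma std_tr_0: "std_tr 0 = 0"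
  by (rule linear_0[OF linear_std_tr])

text \<open>Evaluates the reduced trace of \<open>y * x * z\<close> for an \<open>x\<close> whose
  components vanish in all summands but one.\<close>

lemma std_tr_sandwich:
  "std_tr (A ** 0 ** B) = 0"
  "std_tr (A ** (if P then M else 0) ** B) = (if P then std_tr (A ** M ** B) else 0)"
  by (simp_all add: std_tr_0 matrix_matrix_mult_def vec_eq_iff zero_vec_def[symmetric])

locale real_ext =
  fixes scaleQ :: "rat \<Rightarrow> 'k::division_ring \<Rightarrow> 'k"
    and E :: "('k, 'a::real_algebra_1, 'h::finite, 'd::finite) real_extension"
  assumes K: "rat_division_algebra scaleQ" and ext: "is_real_extension scaleQ E"
begin

lemmas ext_conj = ext[unfolded is_real_extension_def real_algebra_hom_def]

lemma emb_add: "emb E (x + y) = emb E x + emb E y"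
  using ext_conj[THEN conjunct1] by blast

lemma emb_1: "emb E 1 = 1" and emb_mult: "emb E (x * y) = emb E x * emb E y"
  using ext_conj[THEN conjunct2, THEN conjunct1] by blast+

lemma emb_basis: "Q_basis scaleQ B \<Longrightarrow>
    inj_on (emb E) B \<and> independent (emb E ` B) \<and> span (emb E ` B) = UNIV"
  using ext_conj[THEN conjunct2, THEN conjunct2, THEN conjunct1] by blast

lemma finite_summands: "finite (HS E)" "finite (RS E)" "finite (CS E)"
  using ext_conj by - (elim conjE, assumption)+

lemma proj_hom:
  "\<forall>s\<in>HS E. linear (projH E s) \<and> projH E s 1 = mat 1 \<and> (\<forall>x y. projH E s (x * y) = projH E s x ** projH E s y)"
  "\<forall>s\<in>RS E. linear (projR E s) \<and> projR E s 1 = mat 1 \<and> (\<forall>x y. projR E s (x * y) = projR E s x ** projR E s y)"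
  "\<forall>s\<in>CS E. linear (projC E s) \<and> projC E s 1 = mat 1 \<and> (\<forall>x y. projC E s (x * y) = projC E s x ** projC E s y)"
  using ext_conj by - (elim conjE, assumption)+

lemma proj_ex1:
  "\<exists>!x. (\<forall>s\<in>HS E. projH E s x = a s) \<and> (\<forall>s\<in>RS E. projR E s x = b s) \<and> (\<forall>s\<in>CS E. projC E s x = c s)"
  using ext_conj by (elim conjE allE)

lemma proj_linear:
  "s \<in> HS E \<Longrightarrow> linear (projH E s)" "s \<in> RS E \<Longrightarrow> linear (projR E s)" "s \<in> CS E \<Longrightarrow> linear (projC E s)"
  using proj_hom by simp_all

lemmas proj_add = proj_linear[THEN linear_add]
lemmas proj_scaleR = proj_linear[THEN linear_scale]
lemmas proj_0 = proj_linear[THEN linear_0]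

lemma proj_mult:
  "s \<in> HS E \<Longrightarrow> projH E s (x * y) = projH E s x ** projH E s y"
  "s \<in> RS E \<Longrightarrow> projR E s (x * y) = projR E s x ** projR E s y"
  "s \<in> CS E \<Longrightarrow> projC E s (x * y) = projC E s x ** projC E s y"
  using proj_hom by simp_all

lemma proj_eqI:
  assumes "\<And>s. s \<in> HS E \<Longrightarrow> projH E s x = projH E s y"
    "\<And>s. s \<in> RS E \<Longrightarrow> projR E s x = projR E s y"
    "\<And>s. s \<in> CS E \<Longrightarrow> projC E s x = projC E s y"
  shows "x = y"
  by (rule ex1E[OF proj_ex1[of "\<lambda>s. projH E s y" "\<lambda>s. projR E s y" "\<lambda>s. projC E s y"]])
    (metis assms)

lemma proj_star:
  "s \<in> HS E \<Longrightarrow> projH E s (star E x) = conj_transpose (projH E s x)"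
  "s \<in> RS E \<Longrightarrow> projR E s (star E x) = conj_transpose (projR E s x)"
  "s \<in> CS E \<Longrightarrow> projC E s (star E x) = conj_transpose (projC E s x)"
  using theI'[OF proj_ex1[of "\<lambda>s. conj_transpose (projH E s x)"
      "\<lambda>s. conj_transpose (projR E s x)" "\<lambda>s. conj_transpose (projC E s x)"]]
  unfolding star_def by simp_all

lemma star_add: "star E (x + y) = star E x + star E y"
  by (rule proj_eqI) (simp_all add: proj_star proj_add conj_transpose_add)

lemma star_scaleR: "star E (c *\<^sub>R x) = c *\<^sub>R star E x"
  by (rule proj_eqI) (simp_all add: proj_star proj_scaleR conj_transpose_scaleR)

lemma star_mult: "star E (x * y) = star E y * star E x"
  by (rule proj_eqI) (simp_all add: proj_star proj_mult conj_transpose_mult)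

lemma star_star [simp]: "star E (star E x) = x"
  by (rule proj_eqI) (simp_all add: proj_star)

lemma linear_star: "linear (star E)"
  by (rule linearI) (auto simp: star_add star_scaleR)

lemmas star_sum = linear_sum[OF linear_star]

lemma red_trace_alt:
  "red_trace E x = (\<Sum>s\<in>HS E. 2 * std_tr (projH E s x)) + (\<Sum>s\<in>RS E. std_tr (projR E s x)) +
     (\<Sum>s\<in>CS E. 2 * std_tr (projC E s x))"
  by (simp add: red_trace_def std_tr_def std_re_real std_re_complex std_re_quat)

lemma linear_red_trace: "linear (red_trace E)"
  by (rule linearI)
    (simp_all add: red_trace_alt proj_add proj_scaleR linear_add[OF linear_std_tr]
      linear_scale[OF linear_std_tr] sum.distrib sum_distrib_left distrib_left mult.left_commute)

lemmas red_trace_add = linear_add[OF linear_red_trace]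
lemmas red_trace_scaleR = linear_scale[OF linear_red_trace]
lemmas red_trace_sum = linear_sum[OF linear_red_trace]

lemma red_trace_commute: "red_trace E (x * y) = red_trace E (y * x)"
  by (simp add: red_trace_alt proj_mult std_tr_commute[of "projH E s x" "projH E s y" for s]
      std_tr_commute[of "projR E s x" "projR E s y" for s] std_tr_commute[of "projC E s x" "projC E s y" for s])

lemma red_trace_star [simp]: "red_trace E (star E x) = red_trace E x"
  by (simp add: red_trace_alt proj_star std_tr_conj_transpose)

text \<open>Each summand contributes a sum of squares with a positive weight, and the projections
  jointly separate points. So the trace form twisted by \<open>star\<close> is positive
  definite.\<close>

lemma red_trace_norm:
  "0 \<le> red_trace E (x * star E x)" "red_trace E (x * star E x) = 0 \<Longrightarrow> x = 0"
proof -
  have eq: "red_trace E (x * star E x) =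
      (\<Sum>s\<in>HS E. 2 * std_tr (projH E s x ** conj_transpose (projH E s x))) +
      (\<Sum>s\<in>RS E. std_tr (projR E s x ** conj_transpose (projR E s x))) +
      (\<Sum>s\<in>CS E. 2 * std_tr (projC E s x ** conj_transpose (projC E s x)))"
    by (simp add: red_trace_alt proj_mult proj_star)
  have nn: "0 \<le> (\<Sum>s\<in>HS E. 2 * std_tr (projH E s x ** conj_transpose (projH E s x)))"
    "0 \<le> (\<Sum>s\<in>RS E. std_tr (projR E s x ** conj_transpose (projR E s x)))"
    "0 \<le> (\<Sum>s\<in>CS E. 2 * std_tr (projC E s x ** conj_transpose (projC E s x)))"
    by (auto intro!: sum_nonneg std_tr_norm)
  then show "0 \<le> red_trace E (x * star E x)" unfolding eq by linarith
  assume "red_trace E (x * star E x) = 0"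
  then have "(\<Sum>s\<in>HS E. 2 * std_tr (projH E s x ** conj_transpose (projH E s x))) = 0"
    "(\<Sum>s\<in>RS E. std_tr (projR E s x ** conj_transpose (projR E s x))) = 0"
    "(\<Sum>s\<in>CS E. 2 * std_tr (projC E s x ** conj_transpose (projC E s x))) = 0"
    using nn unfolding eq by linarith+
  then show "x = 0"
    by (intro proj_eqI)
      (simp_all add: sum_nonneg_eq_0_iff finite_summands std_tr_norm proj_0)
qed

text \<open>The pairing of \<open>F\<close> with \<open>x\<close> times the dagger of
  \<open>y\<close>: for \<open>F\<close> in \<open>Sym E\<close> the polarisation of
  \<open>F[x]\<close>, extended from \<open>K^n\<close> to vectors over \<open>K_R\<close>, where
  positivity has to be proved.\<close>

definition bform :: "'a^'n^'n \<Rightarrow> 'a^'n \<Rightarrow> 'a^'n \<Rightarrow> real" where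
  "bform F x y = red_trace E (\<Sum>i\<in>UNIV. \<Sum>j\<in>UNIV. F $ i $ j * x $ j * star E (y $ i))"

definition emb_vec :: "'k^'n \<Rightarrow> 'a^'n" where "emb_vec v = (\<chi> i. emb E (v $ i))"

lemma form_val_eq: "form_val E F v = bform F (emb_vec v) (emb_vec v)"
  by (simp add: form_val_def form_inner_def bform_def emb_vec_def trace_def matrix_matrix_mult_def mult.assoc)

lemma linear_bform_left: "linear (\<lambda>x. bform F x y)"
  by (rule linearI) (simp_all add: bform_def distrib_left distrib_right sum.distrib red_trace_add
      red_trace_scaleR flip: scaleR_sum_right)

lemma linear_bform_right: "linear (bform F x)"
  by (rule linearI) (simp_all add: bform_def star_add star_scaleR distrib_left sum.distrib red_trace_add
      red_trace_scaleR flip: scaleR_sum_right)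

lemma linear_bform_form: "linear (\<lambda>F. bform F x y)"
  by (rule linearI) (simp_all add: bform_def distrib_left distrib_right sum.distrib red_trace_add
      red_trace_scaleR flip: scaleR_sum_right)

lemma linear_form_val: "linear (\<lambda>F. form_val E F v)"
  unfolding form_val_eq by (rule linear_bform_form)

lemma bform_sym:
  assumes "F \<in> Sym E"
  shows "bform F x y = bform F y x"
proof -
  have F: "star E (F $ j $ i) = F $ i $ j" for i j
    using assms by (auto simp: Sym_def dagger_def vec_eq_iff)
  have "red_trace E (F $ i $ j * x $ j * star E (y $ i)) = red_trace E (F $ j $ i * y $ i * star E (x $ j))" for i j
  proof -
    have "red_trace E (F $ i $ j * x $ j * star E (y $ i)) = red_trace E (star E (F $ i $ j * x $ j * star E (y $ i)))"
      by simp
    also have "\<dots> = red_trace E ((y $ i * star E (x $ j)) * F $ j $ i)"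
      by (simp only: star_mult star_star F mult.assoc)
    also have "\<dots> = red_trace E (F $ j $ i * (y $ i * star E (x $ j)))" by (rule red_trace_commute)
    finally show ?thesis by (simp add: mult.assoc)
  qed
  then show ?thesis
    unfolding bform_def red_trace_sum by (subst sum.swap) simp
qed

text \<open>Cyclicity of the trace carries the factor \<open>star E (A $ k $ i)\<close> to the
  right, where it joins \<open>star E (y $ i)\<close> to form the conjugate of
  \<open>A $ k $ i * y $ i\<close>.\<close>

lemma bform_congruence: "bform (dagger E A ** F ** A) x y = bform F (A *v x) (A *v y)"
proof -
  have cyc: "red_trace E (star E a * u * w) = red_trace E (u * (w * star E a))" for a u w
    using red_trace_commute[of "star E a" "u * w"] by (simp add: mult.assoc)
  have "bform (dagger E A ** F ** A) x y =
    (\<Sum>i\<in>UNIV. \<Sum>j\<in>UNIV. \<Sum>l\<in>UNIV. \<Sum>k\<in>UNIV.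
      red_trace E (star E (A $ k $ i) * (F $ k $ l * (A $ l $ j * x $ j)) * star E (y $ i)))"
    by (simp add: bform_def matrix_matrix_mult_def dagger_def red_trace_sum sum_distrib_right mult.assoc)
  also have "\<dots> = (\<Sum>i\<in>UNIV. \<Sum>j\<in>UNIV. \<Sum>l\<in>UNIV. \<Sum>k\<in>UNIV.
      red_trace E (F $ k $ l * (A $ l $ j * x $ j) * star E (A $ k $ i * y $ i)))"
    by (intro sum.cong refl, unfold cyc) (simp only: star_mult mult.assoc)
  also have "\<dots> = (\<Sum>k\<in>UNIV. \<Sum>l\<in>UNIV. \<Sum>i\<in>UNIV. \<Sum>j\<in>UNIV.
      red_trace E (F $ k $ l * (A $ l $ j * x $ j) * star E (A $ k $ i * y $ i)))"
    by (rule sum_swap4)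
  also have "\<dots> = bform F (A *v x) (A *v y)"
  proof -
    have "(\<Sum>i\<in>UNIV. \<Sum>j\<in>UNIV. red_trace E (F $ k $ l * (A $ l $ j * x $ j) * star E (A $ k $ i * y $ i)))
      = red_trace E (F $ k $ l * (A *v x) $ l * star E ((A *v y) $ k))" for k l
    proof -
      have "F $ k $ l * (A *v x) $ l = (\<Sum>j\<in>UNIV. F $ k $ l * (A $ l $ j * x $ j))"
        by (simp add: matrix_vector_mult_def sum_distrib_left)
      moreover have "star E ((A *v y) $ k) = (\<Sum>i\<in>UNIV. star E (A $ k $ i * y $ i))"
        by (simp add: matrix_vector_mult_def star_sum)
      ultimately have "F $ k $ l * (A *v x) $ l * star E ((A *v y) $ k) =
        (\<Sum>j\<in>UNIV. \<Sum>i\<in>UNIV. F $ k $ l * (A $ l $ j * x $ j) * star E (A $ k $ i * y $ i))"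
        by (simp only: sum_product)
      then show ?thesis unfolding red_trace_sum[symmetric] by (subst sum.swap) simp
    qed
    then show ?thesis by (simp add: bform_def red_trace_sum)
  qed
  finally show ?thesis .
qed

text \<open>Pairing \<open>axis j 1\<close> with \<open>axis i (H $ i $ j)\<close> isolates the
  trace norm of the entry \<open>H $ i $ j\<close>.\<close>

lemma bform_zeroD:
  assumes "\<And>x y. bform H x y = 0"
  shows "H = 0"
proof -
  have "H $ i $ j = 0" for i j
  proof -
    have "bform H (axis j 1) (axis i (H $ i $ j)) = red_trace E (H $ i $ j * star E (H $ i $ j))"
    proof -
      have "(\<Sum>l\<in>UNIV. H $ k $ l * axis j 1 $ l * star E (axis i (H $ i $ j) $ k)) =
        (if k = i then H $ i $ j * star E (H $ i $ j) else 0)" for k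
      proof -
        have "H $ k $ l * axis j 1 $ l * star E (axis i (H $ i $ j) $ k) =
          (if l = j then H $ k $ l * star E (axis i (H $ i $ j) $ k) else 0)" for l
          by (simp add: axis_def)
        then show ?thesis by (simp add: axis_def linear_0[OF linear_star])
      qed
      then show ?thesis by (simp add: bform_def)
    qed
    then show ?thesis using assms red_trace_norm(2) by metis
  qed
  then show ?thesis by (simp add: vec_eq_iff)
qed

text \<open>A vector over one simple summand becomes a column of matrices and, through
  \<open>lift\<close>, a vector over \<open>K_R\<close> to which the other summands contribute
  nothing. On it \<open>bform F\<close> is \<open>c\<close> times the hermitian form of the
  flattened matrix.\<close>

lemma pos_def_flatten:
  fixes p :: "'a \<Rightarrow> 'b::std_conj^'m^'m" and F :: "'a^'n^'n"
  assumes F: "F \<in> Sym E" and pos: "\<And>x. x \<noteq> 0 \<Longrightarrow> 0 < bform F x x"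
    and p0: "p 0 = 0" and p_mult: "\<And>x y. p (x * y) = p x ** p y"
    and p_star: "\<And>x. p (star E x) = conj_transpose (p x)"
    and lift: "\<And>M. \<exists>x. p x = M \<and> (\<forall>y z. red_trace E (y * x * z) = c * std_tr (p (y * x * z)))"
    and c: "c > 0"
  shows "pos_def (flatten (map_matrix p F))"
proof (rule pos_defI)
  have "star E (F $ j $ i) = F $ i $ j" for i j
    using F by (auto simp: Sym_def dagger_def vec_eq_iff)
  then have "conj_transpose (p (F $ j $ i)) = p (F $ i $ j)" for i j
    by (metis p_star)
  then show "conj_transpose (flatten (map_matrix p F)) = flatten (map_matrix p F)"
    by (auto simp: conj_transpose_def flatten_def map_matrix_def vec_eq_iff)
next
  fix x :: "'b^('n \<times> 'm)"
  assume "x \<noteq> 0"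
  then obtain i a where ia: "x $ (i, a) \<noteq> 0" by (auto simp: vec_eq_iff)
  define M where "M i = (\<chi> b k. if k = a then x $ (i, b) else 0)" for i
  obtain X where X: "\<And>i. p (X i) = M i"
    "\<And>i y z. red_trace E (y * X i * z) = c * std_tr (p (y * X i * z))"
    using lift[of "M _"] by metis
  define v where "v = (\<chi> i. X i)"
  have "v \<noteq> 0"
  proof
    assume "v = 0"
    then have "M i = 0" using X(1)[of i] p0 by (simp add: v_def vec_eq_iff)
    then have "M i $ a $ a = 0" by simp
    then show False using ia by (simp add: M_def)
  qed
  then have "0 < bform F v v" by (rule pos)
  also have "bform F v v = c * (\<Sum>i\<in>UNIV. \<Sum>j\<in>UNIV. std_tr (p (F $ i $ j) ** M j ** conj_transpose (M i)))"
    by (simp add: bform_def red_trace_sum v_def X p_mult p_star sum_distrib_left)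
  finally show "0 < std_re (\<Sum>i\<in>UNIV. \<Sum>j\<in>UNIV. std_conj (x $ i) * flatten (map_matrix p F) $ i $ j * x $ j)"
    unfolding flatten_form[of M a x p F, OF M_def] using c by (simp add: zero_less_mult_iff)
qed

text \<open>The three cases differ only in \<open>c\<close>, the weight 2, 1 or 2 of the summand in
  \<open>red_trace\<close>. The element lifting \<open>M\<close> has component 0 in every other
  summand.\<close>

lemma pos_coneI:
  assumes F: "F \<in> Sym E" and pos: "\<And>x. x \<noteq> 0 \<Longrightarrow> 0 < bform F x x"
  shows "F \<in> pos_cone E"
proof -
  have "pos_def (flatten (map_matrix (projH E s) F))" if s: "s \<in> HS E" for s
  proof (rule pos_def_flatten[OF F pos, where c = 2])
    fix M
    obtain x where "\<forall>t\<in>HS E. projH E t x = (if t = s then M else 0)" "\<forall>t\<in>RS E. projR E t x = 0"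
      "\<forall>t\<in>CS E. projC E t x = 0"
      using proj_ex1[of "\<lambda>t. if t = s then M else 0" "\<lambda>_. 0" "\<lambda>_. 0"] by blast
    then show "\<exists>x. projH E s x = M \<and> (\<forall>y z. red_trace E (y * x * z) = 2 * std_tr (projH E s (y * x * z)))"
      using s by (intro exI[of _ x])
        (simp add: red_trace_alt proj_mult std_tr_sandwich std_tr_0 finite_summands flip: sum_distrib_left)
  qed (use s in \<open>auto simp: proj_0 proj_mult proj_star\<close>)
  moreover have "pos_def (flatten (map_matrix (projR E s) F))" if s: "s \<in> RS E" for s
  proof (rule pos_def_flatten[OF F pos, where c = 1])
    fix M
    obtain x where "\<forall>t\<in>HS E. projH E t x = 0" "\<forall>t\<in>RS E. projR E t x = (if t = s then M else 0)"
      "\<forall>t\<in>CS E. projC E t x = 0"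
      using proj_ex1[of "\<lambda>_. 0" "\<lambda>t. if t = s then M else 0" "\<lambda>_. 0"] by blast
    then show "\<exists>x. projR E s x = M \<and> (\<forall>y z. red_trace E (y * x * z) = 1 * std_tr (projR E s (y * x * z)))"
      using s by (intro exI[of _ x])
        (simp add: red_trace_alt proj_mult std_tr_sandwich std_tr_0 finite_summands flip: sum_distrib_left)
  qed (use s in \<open>auto simp: proj_0 proj_mult proj_star\<close>)
  moreover have "pos_def (flatten (map_matrix (projC E s) F))" if s: "s \<in> CS E" for s
  proof (rule pos_def_flatten[OF F pos, where c = 2])
    fix M
    obtain x where "\<forall>t\<in>HS E. projH E t x = 0" "\<forall>t\<in>RS E. projR E t x = 0"
      "\<forall>t\<in>CS E. projC E t x = (if t = s then M else 0)"
      using proj_ex1[of "\<lambda>_. 0" "\<lambda>_. 0" "\<lambda>t. if t = s then M else 0"] by blast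
    then show "\<exists>x. projC E s x = M \<and> (\<forall>y z. red_trace E (y * x * z) = 2 * std_tr (projC E s (y * x * z)))"
      using s by (intro exI[of _ x])
        (simp add: red_trace_alt proj_mult std_tr_sandwich std_tr_0 finite_summands flip: sum_distrib_left)
  qed (use s in \<open>auto simp: proj_0 proj_mult proj_star\<close>)
  ultimately show ?thesis using F by (auto simp: pos_cone_def)
qed

end

section \<open>Orders in rational division algebras\<close>

lemma common_multiple_exists:
  fixes P :: "'i \<Rightarrow> nat \<Rightarrow> bool"
  assumes "finite A" and ex: "\<And>a. a \<in> A \<Longrightarrow> \<exists>m>0. P a m"
    and mult: "\<And>a m n. P a m \<Longrightarrow> P a (m * n)"
  shows "\<exists>m>0. \<forall>a\<in>A. P a m"
  using assms(1) ex
proof (induction A rule: finite_induct)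
  case empty
  show ?case by auto
next
  case (insert a A)
  then obtain m n where "m > 0" "\<forall>a\<in>A. P a m" "n > 0" "P a n" by blast
  then show ?case using mult[of a n m] mult[of _ m n]
    by (intro exI[of _ "m * n"]) (auto simp: mult.commute[of n m])
qed

lemma rat_denominator: "\<exists>m::nat>0. of_nat m * (q :: rat) \<in> \<int>"
proof -
  obtain a b where q: "quotient_of q = (a, b)" by (cases "quotient_of q")
  have "b > 0" using quotient_of_denom_pos[OF q] .
  moreover have "of_nat (nat b) * q = of_int a" using quotient_of_div[OF q] \<open>b > 0\<close> by simp
  ultimately show ?thesis by (intro exI[of _ "nat b"]) auto
qed

lemma rat_common_denominator:
  fixes f :: "'i \<Rightarrow> rat"
  assumes "finite A"
  shows "\<exists>m::nat>0. \<forall>a\<in>A. of_nat m * f a \<in> \<int>"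
proof (rule common_multiple_exists[OF assms rat_denominator])
  fix a and m n :: nat
  assume "of_nat m * f a \<in> \<int>"
  then have "of_nat n * (of_nat m * f a) \<in> \<int>" by (rule Ints_mult[OF Ints_of_nat])
  then show "of_nat (m * n) * f a \<in> \<int>" by (simp add: mult_ac)
qed

locale rat_algebra_basis = rat_division_algebra scaleQ
  for scaleQ :: "rat \<Rightarrow> 'k::division_ring \<Rightarrow> 'k" +
  fixes B :: "'k set"
  assumes finB: "finite B" and indB: "independent B" and spanB: "span B = UNIV"
begin

definition co :: "'k \<Rightarrow> 'k \<Rightarrow> rat" where "co x b = representation B x b"

text \<open>An l1 norm with rational values, so that the lattice reduction takes place inside
  \<open>K\<close> and never meets the real extension.\<close>

definition nrm :: "'k \<Rightarrow> rat" where "nrm x = (\<Sum>b\<in>B. \<bar>co x b\<bar>)"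

lemma scaleQ_of_int: "scaleQ (of_int n) x = of_int n * x"
proof -
  have pos: "scaleQ (of_nat n) x = of_nat n * x" for n
    by (induction n) (auto simp: scale_left_distrib algebra_simps)
  show ?thesis
  proof (cases "n \<ge> 0")
    case True
    then show ?thesis using pos[of "nat n"] by simp
  next
    case False
    then show ?thesis using pos[of "nat (- n)"] by (simp add: scale_minus_left)
  qed
qed

lemma scaleQ_of_nat: "scaleQ (of_nat n) x = of_nat n * x"
  using scaleQ_of_int[of "int n" x] by simp

text \<open>A division ring may have positive characteristic; the rational scalars rule it
  out.\<close>

lemma of_nat_nonzero: "n > 0 \<Longrightarrow> (of_nat n :: 'k) \<noteq> 0"
  by (simp add: scaleQ_of_nat[of n 1, symmetric, simplified])

lemma co_expand: "(\<Sum>b\<in>B. scaleQ (co x b) b) = x"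
  unfolding co_def using sum_representation_eq[OF indB, of x B] finB spanB by simp

lemma co_add: "co (x + y) b = co x b + co y b"
  unfolding co_def using representation_add[OF indB] spanB by auto

lemma co_scale: "co (scaleQ q x) b = q * co x b"
  unfolding co_def using representation_scale[OF indB] spanB by auto

lemma co_0: "co 0 b = 0"
  using co_scale[of 0 0 b] by simp

lemma co_int: "co (of_int n * x) b = of_int n * co x b"
  using co_scale[of "of_int n" x b] by (simp add: scaleQ_of_int)

lemma co_sum: "co (sum f A) b = (\<Sum>a\<in>A. co (f a) b)"
  by (induction A rule: infinite_finite_induct) (auto simp: co_0 co_add)

lemma co_eqI: "(\<And>b. b \<in> B \<Longrightarrow> co x b = co y b) \<Longrightarrow> x = y"
  using co_expand[of x] co_expand[of y] by (metis (no_types, lifting) sum.cong)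

lemma co_basis_sum:
  assumes "b \<in> B"
  shows "co (\<Sum>a\<in>B. scaleQ (u a) a) b = u b"
proof -
  have "co (\<Sum>a\<in>B. scaleQ (u a) a) b = (\<Sum>a\<in>B. if a = b then u a else 0)"
    unfolding co_sum co_scale unfolding co_def
    by (intro sum.cong refl) (auto simp: representation_basis[OF indB])
  then show ?thesis using assms finB by simp
qed

lemma nrm_nonneg: "0 \<le> nrm x"
  by (simp add: nrm_def sum_nonneg)

lemma nrm_pos: "x \<noteq> 0 \<Longrightarrow> 0 < nrm x"
  using co_eqI[of x 0] finB nrm_nonneg[of x]
  by (fastforce simp: nrm_def co_0 sum_nonneg_eq_0_iff less_le)

lemma nrm_0 [simp]: "nrm 0 = 0"
  by (simp add: nrm_def co_0)

lemma nrm_add: "nrm (x + y) \<le> nrm x + nrm y"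
  unfolding nrm_def co_add sum.distrib[symmetric] by (intro sum_mono abs_triangle_ineq)

lemma nrm_sum: "nrm (sum f A) \<le> (\<Sum>a\<in>A. nrm (f a))"
proof (induction A rule: infinite_finite_induct)
  case (insert a A)
  then show ?case using nrm_add[of "f a" "sum f A"] by simp
qed auto

lemma nrm_scale: "nrm (scaleQ q x) = \<bar>q\<bar> * nrm x"
  by (simp add: nrm_def co_scale abs_mult sum_distrib_left)

lemma co_le_nrm: "b \<in> B \<Longrightarrow> \<bar>co x b\<bar> \<le> nrm x"
  unfolding nrm_def using finB by (intro member_le_sum) auto

lemma nrm_mult: obtains C where "C > 0" "\<And>x y. nrm (x * y) \<le> C * nrm x * nrm y"
proof
  let ?C = "1 + (\<Sum>a\<in>B. \<Sum>b\<in>B. nrm (a * b))"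
  show "?C > 0" by (intro add_pos_nonneg sum_nonneg nrm_nonneg) simp
  fix x y
  have "x * y = (\<Sum>a\<in>B. scaleQ (co x a) a) * (\<Sum>b\<in>B. scaleQ (co y b) b)"
    by (simp only: co_expand)
  then have xy: "x * y = (\<Sum>a\<in>B. \<Sum>b\<in>B. scaleQ (co x a * co y b) (a * b))"
    unfolding sum_product by (simp add: scaleQ_left[symmetric] scaleQ_right[symmetric] mult.commute)
  have "nrm (x * y) \<le> (\<Sum>a\<in>B. \<Sum>b\<in>B. nrm (scaleQ (co x a * co y b) (a * b)))"
    unfolding xy by (intro order_trans[OF nrm_sum] sum_mono nrm_sum)
  also have "\<dots> \<le> (\<Sum>a\<in>B. \<Sum>b\<in>B. (nrm x * nrm y) * nrm (a * b))"
    unfolding nrm_scale abs_mult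
    by (intro sum_mono mult_right_mono mult_mono co_le_nrm nrm_nonneg) auto
  also have "\<dots> = (nrm x * nrm y) * (?C - 1)" by (simp add: sum_distrib_left)
  also have "\<dots> \<le> (nrm x * nrm y) * ?C" using nrm_nonneg by (intro mult_left_mono) auto
  finally show "nrm (x * y) \<le> ?C * nrm x * nrm y" by (simp add: mult_ac)
qed

text \<open>Containment in the lattice generated over the integers by the \<open>b / D\<close>;
  discreteness of orders and lattices is derived from it.\<close>

definition bounded_denoms :: "'k set \<Rightarrow> bool" where
  "bounded_denoms X \<longleftrightarrow> (\<exists>D>0. \<forall>x\<in>X. \<forall>b\<in>B. of_nat D * co x b \<in> \<int>)"

lemma bounded_denoms_discrete:
  assumes "bounded_denoms X"
  shows "finite {x \<in> X. nrm x \<le> c}"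
proof -
  obtain D where D: "D > 0" "\<And>x b. x \<in> X \<Longrightarrow> b \<in> B \<Longrightarrow> of_nat D * co x b \<in> \<int>"
    using assms by (auto simp: bounded_denoms_def)
  define N where "N = \<lceil>of_nat D * c\<rceil>"
  define f where "f x = (\<lambda>b\<in>B. of_nat D * co x b)" for x
  have "finite (B \<rightarrow>\<^sub>E (of_int ` {-N..N} :: rat set))" using finB by (intro finite_PiE) auto
  moreover have "f ` {x \<in> X. nrm x \<le> c} \<subseteq> B \<rightarrow>\<^sub>E of_int ` {-N..N}"
  proof (clarify)
    fix x assume x: "x \<in> X" "nrm x \<le> c"
    have "of_nat D * co x b \<in> of_int ` {-N..N}" if b: "b \<in> B" for b
    proof -
      obtain m where m: "of_nat D * co x b = of_int m" using D(2)[OF x(1) b] by (auto elim: Ints_cases)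
      have "\<bar>of_int m :: rat\<bar> \<le> of_nat D * c"
        using co_le_nrm[OF b, of x] x(2) unfolding m[symmetric] abs_mult by (auto intro: mult_left_mono order_trans)
      also have "\<dots> \<le> of_int N" by (simp add: N_def)
      finally have "\<bar>m\<bar> \<le> N" by linarith
      then show ?thesis unfolding m by (auto simp: abs_le_iff)
    qed
    then show "f x \<in> B \<rightarrow>\<^sub>E of_int ` {-N..N}" by (auto simp: f_def)
  qed
  moreover have "inj_on f {x \<in> X. nrm x \<le> c}"
  proof (rule inj_onI, rule co_eqI)
    fix x y b assume "f x = f y" and b: "b \<in> B"
    then have "f x b = f y b" by simp
    then show "co x b = co y b" using b D(1) by (simp add: f_def)
  qed
  ultimately show ?thesis using inj_on_finite by blast
qed

end

locale order_basis = rat_algebra_basis scaleQ B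
  for scaleQ :: "rat \<Rightarrow> 'k::division_ring \<Rightarrow> 'k" and B +
  fixes R assumes order: "is_order scaleQ R"
begin

lemma one_R: "1 \<in> R" and diff_R: "x \<in> R \<Longrightarrow> y \<in> R \<Longrightarrow> x - y \<in> R"
  and mult_R: "x \<in> R \<Longrightarrow> y \<in> R \<Longrightarrow> x * y \<in> R"
  and span_R: "span R = UNIV"
  using order by (auto simp: is_order_def)

lemma zero_R: "0 \<in> R" using diff_R[OF one_R one_R] by simp

lemma minus_R: "x \<in> R \<Longrightarrow> - x \<in> R" using diff_R[OF zero_R] by simp

lemma add_R: "x \<in> R \<Longrightarrow> y \<in> R \<Longrightarrow> x + y \<in> R" using diff_R[OF _ minus_R] by simp

lemma of_nat_R: "of_nat n \<in> R" by (induction n) (auto simp: zero_R one_R add_R)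

lemma order_gens:
  obtains S where "finite S" "R = {(\<Sum>b\<in>S. of_int (c b) * b) | c. True}" "span S = UNIV"
proof -
  obtain S where S: "finite S" "R = {(\<Sum>b\<in>S. of_int (c b) * b) | c. True}"
    using order by (auto simp: is_order_def)
  have "R \<subseteq> span S"
    unfolding S(2) scaleQ_of_int[symmetric] by (auto intro: span_sum span_scale span_base)
  then have "span S = UNIV" using span_R span_minimal[OF _ subspace_span] by blast
  then show thesis using that S by blast
qed

lemma multiple_in_order: "\<exists>m>0. x * of_nat m \<in> R"
proof -
  obtain S where S: "finite S" "R = {(\<Sum>b\<in>S. of_int (c b) * b) | c. True}" "span S = UNIV"
    by (rule order_gens)
  obtain u where u: "x = (\<Sum>b\<in>S. scaleQ (u b) b)"
    using S(3) span_finite[OF S(1)] by auto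
  have "\<exists>m::nat>0. \<forall>b\<in>S. of_nat m * u b \<in> \<int>"
    by (rule rat_common_denominator[OF S(1)])
  then obtain m :: nat where m: "m > 0" "\<And>b. b \<in> S \<Longrightarrow> of_nat m * u b \<in> \<int>" by blast
  then have "\<forall>b\<in>S. \<exists>z. of_nat m * u b = of_int z" by (auto elim: Ints_cases)
  then obtain z where z: "\<forall>b\<in>S. of_nat m * u b = of_int (z b)" by (rule bchoice[THEN exE])
  have "of_nat m * scaleQ (u b) b = of_int (z b) * b" if "b \<in> S" for b
    unfolding scaleQ_of_int[symmetric] scaleQ_of_nat[symmetric] scale_scale using z that by simp
  then have "x * of_nat m = (\<Sum>b\<in>S. of_int (z b) * b)"
    unfolding u mult_of_nat_commute[symmetric] sum_distrib_left by (rule sum.cong[OF refl])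
  then show ?thesis using m(1) S(2) by auto
qed

text \<open>Stands in for division with remainder: \<open>K\<close> need not be Euclidean with
  respect to the order, but a bounded multiple of any \<open>x\<close> comes close to it, with
  \<open>T\<close> uniform in \<open>x\<close>.\<close>

lemma dirichlet_order:
  assumes "\<epsilon> > 0"
  obtains T where "\<And>x. \<exists>t\<in>{1..T}. \<exists>q\<in>R. nrm (of_nat t * x - q) < \<epsilon>"
proof -
  obtain S where S: "finite S" "R = {(\<Sum>b\<in>S. of_int (c b) * b) | c. True}" "span S = UNIV"
    by (rule order_gens)
  \<comment> \<open>An error of at most \<open>1 / N\<close> in each coefficient costs at most
    \<open>(s - 1) / N\<close> in \<open>nrm\<close>; the 1 keeps \<open>s\<close> positive.\<close>
  define s where "s = 1 + (\<Sum>b\<in>S. nrm b)"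
  have s: "s > 0" unfolding s_def by (intro add_pos_nonneg sum_nonneg nrm_nonneg) simp
  obtain N :: nat where N0: "s / \<epsilon> < of_nat N" using reals_Archimedean2 by blast
  moreover have "0 < s / \<epsilon>" using s assms by simp
  ultimately have "(0::rat) < of_nat N" by linarith
  then have N: "N > 0" "s / of_nat N < \<epsilon>"
    using N0 assms by (simp_all add: divide_less_eq mult.commute)
  show thesis
  proof (rule that[of "N ^ card S"])
    fix x
    obtain u where u: "x = (\<Sum>b\<in>S. scaleQ (u b) b)"
      using S(3) span_finite[OF S(1)] by auto
    obtain t z where t: "0 < t" "t \<le> N ^ card S"
      and z: "\<And>b. b \<in> S \<Longrightarrow> \<bar>real t * of_rat (u b) - of_int (z b)\<bar> < 1 / real N"
      using dirichlet_approx_finite[OF S(1) N(1), of "\<lambda>b. of_rat (u b)"] by blast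
    have z': "\<bar>of_nat t * u b - of_int (z b)\<bar> \<le> 1 / of_nat N" if "b \<in> S" for b
    proof -
      have "real_of_rat \<bar>of_nat t * u b - of_int (z b)\<bar> < of_rat (1 / of_nat N)"
        using z[OF that] by (simp add: abs_of_rat[symmetric] of_rat_diff of_rat_mult of_rat_divide)
      then show ?thesis by (simp only: of_rat_less less_imp_le)
    qed
    define q where "q = (\<Sum>b\<in>S. of_int (z b) * b)"
    have "q \<in> R" unfolding q_def S(2) by blast
    have tx: "of_nat t * x - q = (\<Sum>b\<in>S. scaleQ (of_nat t * u b - of_int (z b)) b)"
      unfolding q_def u sum_distrib_left sum_subtractf[symmetric]
      by (intro sum.cong refl) (simp add: scale_left_diff_distrib scaleQ_of_int flip: scaleQ_of_nat)
    have "nrm (of_nat t * x - q) \<le> (\<Sum>b\<in>S. nrm (scaleQ (of_nat t * u b - of_int (z b)) b))"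
      unfolding tx by (rule nrm_sum)
    also have "\<dots> \<le> (\<Sum>b\<in>S. 1 / of_nat N * nrm b)"
      unfolding nrm_scale by (intro sum_mono mult_right_mono z' nrm_nonneg)
    also have "\<dots> = (s - 1) / of_nat N" by (simp add: s_def sum_divide_distrib)
    also have "\<dots> \<le> s / of_nat N" by (intro divide_right_mono) auto
    also have "\<dots> < \<epsilon>" by (rule N)
    finally show "\<exists>t\<in>{1..N ^ card S}. \<exists>q\<in>R. nrm (of_nat t * x - q) < \<epsilon>"
      using t \<open>q \<in> R\<close> by (intro bexI[of _ t] bexI[of _ q]) auto
  qed
qed

text \<open>The elements are integer combinations of the finitely many products
  \<open>u s * g\<close>, with \<open>g\<close> a generator of the order, so one common denominator
  of their coordinates suffices.\<close>

lemma bounded_denoms_module: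
  assumes "finite S"
  shows "bounded_denoms {(\<Sum>s\<in>S. u s * c s) | c. \<forall>s\<in>S. c s \<in> R}"
proof -
  obtain G where G: "finite G" "R = {(\<Sum>b\<in>G. of_int (c b) * b) | c. True}" "span G = UNIV"
    by (rule order_gens)
  have "\<exists>m::nat>0. \<forall>(s, g, b) \<in> S \<times> G \<times> B. of_nat m * co (u s * g) b \<in> \<int>"
    using rat_common_denominator[of "S \<times> G \<times> B" "\<lambda>(s, g, b). co (u s * g) b"] assms G(1) finB
    by (simp add: case_prod_beta' split_def)
  then obtain m :: nat where m: "m > 0"
    "\<And>s g b. s \<in> S \<Longrightarrow> g \<in> G \<Longrightarrow> b \<in> B \<Longrightarrow> of_nat m * co (u s * g) b \<in> \<int>" by blast
  have "of_nat m * co (\<Sum>s\<in>S. u s * c s) b \<in> \<int>" if c: "\<forall>s\<in>S. c s \<in> R" and b: "b \<in> B" for c b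
  proof -
    have "of_nat m * co (u s * c s) b \<in> \<int>" if s: "s \<in> S" for s
    proof -
      obtain z where z: "c s = (\<Sum>g\<in>G. of_int (z g) * g)" using c s G(2) by blast
      have "u s * c s = (\<Sum>g\<in>G. of_int (z g) * (u s * g))"
        unfolding z sum_distrib_left by (intro sum.cong refl) (metis mult.assoc mult_of_int_commute)
      then have "of_nat m * co (u s * c s) b = (\<Sum>g\<in>G. of_int (z g) * (of_nat m * co (u s * g) b))"
        by (simp add: co_sum co_int sum_distrib_left mult.left_commute)
      also have "\<dots> \<in> \<int>" using m(2)[OF s _ b] by (intro Ints_sum Ints_mult[OF Ints_of_int])
      finally show ?thesis .
    qed
    then show ?thesis by (simp add: co_sum sum_distrib_left Ints_sum)
  qed
  then show ?thesis using m(1) unfolding bounded_denoms_def by (intro exI[of _ m]) auto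
qed

end

section \<open>Pivoting over a division ring\<close>

lemma rscale_nth [simp]: "rscale v a $ i = v $ i * a"
  by (simp add: rscale_def)

lemma rscale_rscale: "rscale (rscale v a) b = rscale (v :: 'k::semiring_1^'n) (a * b)"
  by (simp add: vec_eq_iff mult.assoc)

lemma rscale_1 [simp]: "rscale v 1 = (v :: 'k::semiring_1^'n)"
  by (simp add: vec_eq_iff)

lemma rscale_add: "rscale (v + w) a = rscale v a + rscale (w :: 'k::semiring_1^'n) a"
  by (simp add: vec_eq_iff distrib_right)

lemma rscale_diff_right: "rscale v (a - b) = rscale v a - rscale (v :: 'k::ring_1^'n) b"
  by (simp add: vec_eq_iff right_diff_distrib)

lemma rscale_sum: "rscale (sum f A) a = (\<Sum>x\<in>A. rscale (f x :: 'k::semiring_1^'n) a)"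
  by (simp add: vec_eq_iff sum_distrib_right)

lemma mult_rscale: "A *v rscale x c = rscale (A *v x) (c :: 'k::semiring_1)"
  by (simp add: vec_eq_iff matrix_vector_mult_def sum_distrib_right mult.assoc)

lemma mult_vec_sum: "A *v (\<Sum>b\<in>S. f b) = (\<Sum>b\<in>S. A *v f b :: 'k::semiring_1^'n)"
  by (induction S rule: infinite_finite_induct) (auto simp: matrix_vector_right_distrib)

lemma axis_decomp: "x = (\<Sum>j\<in>UNIV. rscale (axis j 1) (x $ j :: 'k::semiring_1))"
proof -
  have "axis j 1 $ i * x $ j = (if j = i then x $ j else 0)" for i j by (simp add: axis_def)
  then show ?thesis by (simp add: vec_eq_iff)
qed

lemma mult_axis_nth: "(A *v axis j 1) $ i = (A $ i $ j :: 'k::semiring_1)"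
proof -
  have "A $ i $ k * axis j 1 $ k = (if k = j then A $ i $ k else 0)" for k by (simp add: axis_def)
  then show ?thesis by (simp add: matrix_vector_mult_def)
qed

lemma matrix_eqI_axis:
  "(\<And>j. A *v axis j 1 = B *v axis j (1 :: 'k::semiring_1)) \<Longrightarrow> A = B"
  by (simp add: vec_eq_iff mult_axis_nth)

lemma column_replacement:
  "(\<chi> i j. if j = k then w i else if i = j then 1 else 0) *v x =
    (\<chi> i. w i * x $ k + (if i = k then 0 else x $ i :: 'k::semiring_1))"
proof -
  have "(\<Sum>j\<in>UNIV - {k}. (if j = k then w i else if i = j then 1 else 0) * x $ j) =
    (\<Sum>j\<in>UNIV - {k}. if i = j then x $ j else 0)" for i
    by (rule sum.cong) auto
  then have "(\<Sum>j\<in>UNIV. (if j = k then w i else if i = j then 1 else 0) * x $ j) =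
    w i * x $ k + (\<Sum>j\<in>UNIV - {k}. if i = j then x $ j else 0)" for i
    by (subst sum.remove[of _ k]) simp_all
  then show ?thesis by (auto simp: matrix_vector_mult_def vec_eq_iff)
qed

text \<open>Gaussian elimination in one column: \<open>Q\<close> is the identity with column
  \<open>k\<close> replaced by \<open>v\<close>, and \<open>P\<close> is its inverse. As the other
  axes stay fixed, vectors already moved onto them are not disturbed.\<close>

lemma pivot:
  fixes v :: "'k::division_ring^'n"
  assumes "v $ k \<noteq> 0"
  obtains P Q where "P ** Q = mat 1" "Q ** P = mat 1" "P *v v = axis k 1"
    "\<And>j. j \<noteq> k \<Longrightarrow> P *v axis j 1 = axis j 1"
proof
  let ?w = "\<lambda>i. if i = k then inverse (v $ k) else - v $ i * inverse (v $ k)"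
  let ?P = "\<chi> i j. if j = k then ?w i else if i = j then 1 else 0"
  let ?Q = "\<chi> i j. if j = k then v $ i else if i = j then 1 else 0"
  have P: "?P *v x = (\<chi> i. ?w i * x $ k + (if i = k then 0 else x $ i))" for x
    by (rule column_replacement)
  have Q: "?Q *v x = (\<chi> i. v $ i * x $ k + (if i = k then 0 else x $ i))" for x
    by (rule column_replacement)
  have inv: "v $ k * (inverse (v $ k) * y) = y" "inverse (v $ k) * (v $ k * y) = y" for y
    using assms by (simp_all flip: mult.assoc)
  show "?P ** ?Q = mat 1" "?Q ** ?P = mat 1"
    unfolding matrix_eq matrix_vector_mul_assoc[symmetric] P Q
    by (auto simp: vec_eq_iff mult.assoc inv algebra_simps)
  show "?P *v v = axis k 1" unfolding P using assms
    by (auto simp: vec_eq_iff axis_def mult.assoc)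
  show "?P *v axis j 1 = axis j 1" if "j \<noteq> k" for j
    unfolding P using that by (auto simp: vec_eq_iff axis_def)
qed

text \<open>Either a right basis can be extracted from \<open>S\<close> by successive pivoting, or a row of the
  pivoting matrix is a functional that vanishes on \<open>S\<close>.\<close>

lemma right_basis_or_functional:
  fixes S :: "('k::division_ring^'n) set"
  obtains B where "B \<subseteq> S" "right_basis B"
  | A :: "'k^'n^'n" where "A \<noteq> 0" "\<And>s. s \<in> S \<Longrightarrow> A *v s = 0"
proof -
  \<comment> \<open>\<open>J\<close> is good if one invertible matrix moves vectors of
    \<open>S\<close> onto all the axes of \<open>J\<close>. A largest such \<open>J\<close> decides
    the alternative: all axes give a basis, a missing axis gives a functional.\<close>
  define good where "good J \<longleftrightarrow> (\<exists>P Q u. P ** Q = mat 1 \<and> Q ** P = mat 1 \<and>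
    (\<forall>j\<in>J. u j \<in> S \<and> P *v u j = axis j (1 :: 'k)))" for J :: "'n set"
  have "good {}" unfolding good_def by (intro exI[of _ "mat 1"]) simp
  then have "\<exists>J. good J \<and> (\<forall>J'. good J' \<longrightarrow> card J' \<le> card J)"
    by (intro ex_has_greatest_nat[of _ _ _ "Suc CARD('n)"]) (auto simp: less_Suc_eq_le card_mono)
  then obtain J where J: "good J" "\<And>J'. good J' \<Longrightarrow> card J' \<le> card J" by blast
  then obtain P Q u where PQ: "P ** Q = mat 1" "Q ** P = mat 1"
    and u: "\<And>j. j \<in> J \<Longrightarrow> u j \<in> S" "\<And>j. j \<in> J \<Longrightarrow> P *v u j = axis j 1"
    unfolding good_def by blast
  show thesis
  proof (cases "J = UNIV")
    case True
    have Pu: "P *v u j = axis j 1" for j using u True by simp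
    have "inj u"
    proof (rule injI)
      fix i j assume "u i = u j"
      then have "axis i (1 :: 'k) = axis j 1" by (metis Pu)
      then show "i = j" by (simp add: axis_eq_axis)
    qed
    have "right_basis (range u)"
      unfolding right_basis_def
    proof (intro conjI allI)
      fix v :: "'k^'n"
      have eq: "v = (\<Sum>b\<in>range u. rscale b (c b)) \<longleftrightarrow> (\<forall>j. c (u j) = (P *v v) $ j)" for c
      proof -
        have "v = (\<Sum>b\<in>range u. rscale b (c b)) \<longleftrightarrow> P *v v = P *v (\<Sum>b\<in>range u. rscale b (c b))"
          by (metis PQ(2) matrix_vector_mul_assoc matrix_vector_mul_lid)
        also have "P *v (\<Sum>b\<in>range u. rscale b (c b)) = (\<Sum>j\<in>UNIV. rscale (axis j 1) (c (u j)))"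
          by (simp add: sum.reindex[OF \<open>inj u\<close>] mult_vec_sum mult_rscale Pu)
        also have "\<dots> = (\<chi> j. c (u j))" using axis_decomp[of "\<chi> j. c (u j)"] by simp
        finally show ?thesis by (auto simp: vec_eq_iff)
      qed
      show "\<exists>!c. (\<forall>b. b \<notin> range u \<longrightarrow> c b = 0) \<and> v = (\<Sum>b\<in>range u. rscale b (c b))"
        unfolding eq
      proof (rule ex1I[of _ "\<lambda>b. if b \<in> range u then (P *v v) $ inv_into UNIV u b else 0"])
        show "(\<forall>b. b \<notin> range u \<longrightarrow> (if b \<in> range u then (P *v v) $ inv_into UNIV u b else 0) = 0) \<and>
          (\<forall>j. (if u j \<in> range u then (P *v v) $ inv_into UNIV u (u j) else 0) = (P *v v) $ j)"
          using \<open>inj u\<close> by simp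
        show "c = (\<lambda>b. if b \<in> range u then (P *v v) $ inv_into UNIV u b else 0)"
          if "(\<forall>b. b \<notin> range u \<longrightarrow> c b = 0) \<and> (\<forall>j. c (u j) = (P *v v) $ j)" for c
          using that \<open>inj u\<close> by (auto simp: fun_eq_iff)
      qed
    qed simp
    then show ?thesis using that(1)[of "range u"] u True by blast
  next
    case False
    then obtain k where k: "k \<notin> J" by blast
    have zero: "(P *v s) $ k = 0" if "s \<in> S" for s
    proof (rule ccontr)
      assume "(P *v s) $ k \<noteq> 0"
      then obtain P' Q' where P': "P' ** Q' = mat 1" "Q' ** P' = mat 1" "P' *v (P *v s) = axis k 1"
        "\<And>j. j \<noteq> k \<Longrightarrow> P' *v axis j 1 = axis j (1 :: 'k)" by (rule pivot) blast
      have "(P' ** P) ** (Q ** Q') = mat 1" "(Q ** Q') ** (P' ** P) = mat 1"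
        by (metis PQ P'(1,2) matrix_mul_assoc matrix_mul_rid)+
      moreover have "\<forall>j\<in>insert k J. (u(k := s)) j \<in> S \<and> (P' ** P) *v (u(k := s)) j = axis j 1"
        using u P' that k by (auto simp flip: matrix_vector_mul_assoc)
      ultimately have "good (insert k J)" unfolding good_def by blast
      then show False using J(2)[of "insert k J"] k by simp
    qed
    \<comment> \<open>The functional is stored as a square matrix with equal rows, the shape in
      which it enters \<open>averaged_form\<close>.\<close>
    define A :: "'k^'n^'n" where "A = (\<chi> i j. P $ k $ j)"
    have As: "A *v s = (\<chi> i. (P *v s) $ k)" for s
      by (simp add: A_def matrix_vector_mult_def vec_eq_iff)
    have "(A *v (Q *v axis k 1)) $ k = 1"
      unfolding As by (simp add: PQ matrix_vector_mul_assoc axis_def)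
    then have "A \<noteq> 0" by auto
    moreover have "A *v s = 0" if "s \<in> S" for s using zero[OF that] by (simp add: As vec_eq_iff)
    ultimately show ?thesis using that(2)[of A] by blast
  qed
qed

section \<open>Lattices and adapted bases\<close>

context order_basis
begin

text \<open>A basis, up to exponent \<open>M\<close>, of the vectors of \<open>L\<close> supported
  on \<open>J\<close>. An exact basis need not exist over an order with nonprincipal ideals, so the
  exponent is bounded instead.\<close>

definition flag_basis :: "('k^'n) set \<Rightarrow> 'n set \<Rightarrow> ('n \<Rightarrow> 'k^'n) \<Rightarrow> nat \<Rightarrow> bool" where
  "flag_basis L J e M \<longleftrightarrow>
     (\<forall>j\<in>J. e j \<in> L \<and> (\<forall>i. i \<notin> J \<longrightarrow> e j $ i = 0)) \<and>
     (\<forall>l\<in>L. (\<forall>i. i \<notin> J \<longrightarrow> l $ i = 0) \<longrightarrow>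
        (\<exists>c. (\<forall>j. c j \<in> R) \<and> rscale l (of_nat M) = (\<Sum>j\<in>J. rscale (e j) (c j)))) \<and>
     (\<forall>c. (\<Sum>j\<in>J. rscale (e j) (c j)) = 0 \<longrightarrow> (\<forall>j\<in>J. c j = 0))"

text \<open>The new vector has a \<open>k\<close>-th coordinate of minimal size among those that do not vanish. Dirichlet
  approximation reduces a small multiple of any \<open>l\<close> modulo it to a smaller, hence zero, \<open>k\<close>-th coordinate.\<close>

lemma flag_basis_insert:
  fixes L :: "('k^'n) set"
  assumes diff: "\<And>x y. x \<in> L \<Longrightarrow> y \<in> L \<Longrightarrow> x - y \<in> L"
    and scale: "\<And>x r. x \<in> L \<Longrightarrow> r \<in> R \<Longrightarrow> rscale x r \<in> L"
    and discrete: "\<And>k a. finite {y \<in> (\<lambda>x. x $ k) ` L. nrm y \<le> a}"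
    and axes: "\<And>k. \<exists>m>0. axis k (of_nat m) \<in> L"
    and C: "C > 0" "\<And>x y. nrm (x * y) \<le> C * nrm x * nrm y"
    and T: "\<And>x. \<exists>t\<in>{1..T}. \<exists>q\<in>R. nrm (of_nat t * x - q) < 1 / C"
    and e: "flag_basis L J e M" and k: "k \<notin> J"
  shows "\<exists>v. flag_basis L (insert k J) (e(k := v)) (M * fact T)"
proof -
  define X where "X = {x \<in> L. (\<forall>i. i \<notin> insert k J \<longrightarrow> x $ i = 0) \<and> x $ k \<noteq> 0}"
  obtain m where "m > 0" "axis k (of_nat m) \<in> L" using axes by blast
  then have x0: "axis k (of_nat m) \<in> X"
    using of_nat_nonzero by (auto simp: X_def axis_def)
  \<comment> \<open>Discreteness yields finiteness only below a norm bound. The bound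
    \<open>nrm (of_nat m)\<close> is attained in \<open>X\<close>, so the least element of
    \<open>Y\<close> is least overall.\<close>
  define Y where "Y = {y \<in> (\<lambda>x. x $ k) ` X. nrm y \<le> nrm (of_nat m)}"
  have "Y \<subseteq> {y \<in> (\<lambda>x. x $ k) ` L. nrm y \<le> nrm (of_nat m)}" by (auto simp: Y_def X_def)
  then have "finite Y" using discrete finite_subset by blast
  moreover have "of_nat m \<in> Y"
    using imageI[OF x0, of "\<lambda>x. x $ k"] by (simp add: Y_def axis_def)
  ultimately obtain y where y: "y \<in> Y" "\<And>y'. y' \<in> Y \<Longrightarrow> nrm y \<le> nrm y'"
    using arg_min_if_finite[of Y nrm] by (metis all_not_in_conv not_le)
  then obtain v where v: "v \<in> X" "v $ k = y" "nrm y \<le> nrm (of_nat m)" by (auto simp: Y_def)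
  have min: "nrm (v $ k) \<le> nrm (x $ k)" if "x \<in> X" for x
    using that y(2)[of "x $ k"] v by (cases "nrm (x $ k) \<le> nrm (of_nat m)") (auto simp: Y_def)
  have vL: "v \<in> L" "\<And>i. i \<notin> insert k J \<Longrightarrow> v $ i = 0" "v $ k \<noteq> 0" using v(1) by (auto simp: X_def)
  have eL: "\<And>j. j \<in> J \<Longrightarrow> e j \<in> L" "\<And>j i. j \<in> J \<Longrightarrow> i \<notin> J \<Longrightarrow> e j $ i = 0"
    using e by (auto simp: flag_basis_def)
  have gen: "\<forall>l\<in>L. (\<forall>i. i \<notin> J \<longrightarrow> l $ i = 0) \<longrightarrow>
      (\<exists>c. (\<forall>j. c j \<in> R) \<and> rscale l (of_nat M) = (\<Sum>j\<in>J. rscale (e j) (c j)))"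
    and indep: "\<forall>c. (\<Sum>j\<in>J. rscale (e j) (c j)) = 0 \<longrightarrow> (\<forall>j\<in>J. c j = 0)"
    using e unfolding flag_basis_def by simp_all
  have sum: "(\<Sum>j\<in>insert k J. rscale ((e(k := v)) j) (c j)) = rscale v (c k) + (\<Sum>j\<in>J. rscale (e j) (c j))" for c
    using k by (simp add: sum.insert[of J k]) (intro arg_cong2[of _ _ _ _ "(+)"] sum.cong; auto)
  have "flag_basis L (insert k J) (e(k := v)) (M * fact T)"
    unfolding flag_basis_def
  proof (intro conjI ballI allI impI)
    fix j i assume "j \<in> insert k J"
    then show "(e(k := v)) j \<in> L" using vL eL by auto
    assume "i \<notin> insert k J"
    then show "(e(k := v)) j $ i = 0" using \<open>j \<in> insert k J\<close> vL eL by auto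
  next
    fix l assume l: "l \<in> L" and supp: "\<forall>i. i \<notin> insert k J \<longrightarrow> l $ i = 0"
    define x where "x = inverse (v $ k) * l $ k"
    obtain t q where t: "t \<in> {1..T}" and q: "q \<in> R" and tq: "nrm (of_nat t * x - q) < 1 / C"
      using T by blast
    define z where "z = rscale l (of_nat t) - rscale v q"
    have zL: "z \<in> L" unfolding z_def by (intro diff scale l vL q of_nat_R)
    have z_supp: "z $ i = 0" if "i \<notin> insert k J" for i
      using that supp vL by (simp add: z_def)
    have lk: "l $ k = v $ k * x" using vL by (simp add: x_def flip: mult.assoc)
    have "z $ k = v $ k * (of_nat t * x - q)"
      by (simp add: z_def lk right_diff_distrib mult.assoc mult_of_nat_commute)
    then have "nrm (z $ k) \<le> C * nrm (v $ k) * nrm (of_nat t * x - q)" using C(2) by simp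
    also have "\<dots> < C * nrm (v $ k) * (1 / C)"
      using C(1) nrm_pos[OF vL(3)] tq by (intro mult_strict_left_mono) auto
    finally have "nrm (z $ k) < nrm (v $ k)" using C(1) by simp
    then have "z \<notin> X" using min[of z] by auto
    then have "z $ k = 0" using zL z_supp by (auto simp: X_def)
    then have "\<forall>i. i \<notin> J \<longrightarrow> z $ i = 0" using z_supp by (metis insert_iff)
    then obtain c where c: "\<And>j. c j \<in> R" "rscale z (of_nat M) = (\<Sum>j\<in>J. rscale (e j) (c j))"
      using gen zL by blast
    \<comment> \<open>\<open>t\<close> varies with \<open>l\<close>; the factorial is a common
      multiple of all values up to \<open>T\<close>, hence the exponent
      \<open>M * fact T\<close>.\<close>
    obtain u where u: "fact T = t * u" using t dvd_fact[of t T] by (auto simp: dvd_def)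
    have "rscale l (of_nat (M * fact T)) = rscale (rscale l (of_nat t)) (of_nat M * of_nat u)"
      unfolding rscale_rscale u by (simp add: mult_ac flip: of_nat_mult)
    also have "rscale l (of_nat t) = z + rscale v q" by (simp add: z_def)
    also have "rscale \<dots> (of_nat M * of_nat u) =
        rscale (rscale z (of_nat M)) (of_nat u) + rscale v (q * (of_nat M * of_nat u))"
      by (simp add: rscale_add rscale_rscale)
    also have "\<dots> = rscale v (q * (of_nat M * of_nat u)) + (\<Sum>j\<in>J. rscale (e j) (c j * of_nat u))"
      unfolding c rscale_sum rscale_rscale by simp
    also have "\<dots> = (\<Sum>j\<in>insert k J. rscale ((e(k := v)) j)
        (if j = k then q * (of_nat M * of_nat u) else c j * of_nat u))"
      unfolding sum using k by (auto intro!: sum.cong)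
    finally show "\<exists>c. (\<forall>j. c j \<in> R) \<and> rscale l (of_nat (M * fact T)) =
        (\<Sum>j\<in>insert k J. rscale ((e(k := v)) j) (c j))"
      using c(1) q mult_R of_nat_R by (intro exI[of _ "\<lambda>j. if j = k then q * (of_nat M * of_nat u) else c j * of_nat u"]) auto
  next
    fix c j assume 0: "(\<Sum>j\<in>insert k J. rscale ((e(k := v)) j) (c j)) = 0" and j: "j \<in> insert k J"
    \<comment> \<open>At coordinate \<open>k\<close> every \<open>e j\<close> with
      \<open>j \<in> J\<close> vanishes, which isolates \<open>c k\<close>.\<close>
    have "v $ k * c k + (\<Sum>j\<in>J. e j $ k * c j) = 0"
      using arg_cong[OF 0[unfolded sum], of "\<lambda>x. x $ k"] by simp
    then have ck: "c k = 0" using eL(2) k vL(3) by simp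
    then have "(\<Sum>j\<in>J. rscale (e j) (c j)) = 0" using 0[unfolded sum] by (simp add: vec_eq_iff)
    then have "\<forall>j\<in>J. c j = 0" using indep by blast
    then show "c j = 0" using ck j by auto
  qed
  then show ?thesis by blast
qed

text \<open>Inserting \<open>p\<close> first forces \<open>e p\<close> to be supported on the axis
  \<open>p\<close>, and later insertions do not change it. Each index contributes one factor
  \<open>fact T\<close>, whatever \<open>L\<close> is.\<close>

lemma flag_basis_exists:
  fixes L :: "('k^'n) set"
  assumes diff: "\<And>x y. x \<in> L \<Longrightarrow> y \<in> L \<Longrightarrow> x - y \<in> L"
    and scale: "\<And>x r. x \<in> L \<Longrightarrow> r \<in> R \<Longrightarrow> rscale x r \<in> L"
    and discrete: "\<And>k a. finite {y \<in> (\<lambda>x. x $ k) ` L. nrm y \<le> a}"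
    and axes: "\<And>k. \<exists>m>0. axis k (of_nat m) \<in> L"
    and C: "C > 0" "\<And>x y. nrm (x * y) \<le> C * nrm x * nrm y"
    and T: "\<And>x. \<exists>t\<in>{1..T}. \<exists>q\<in>R. nrm (of_nat t * x - q) < 1 / C"
  shows "\<exists>e. flag_basis L UNIV e (fact T ^ CARD('n)) \<and> (\<forall>i. i \<noteq> p \<longrightarrow> e p $ i = 0)"
proof -
  have step: "\<exists>v. flag_basis L (insert k J) (e(k := v)) (M * fact T)"
    if "flag_basis L J e M" "k \<notin> J" for k J e M
    by (rule flag_basis_insert[where C = C and T = T]) (assumption | rule assms that)+
  have zero: "l = 0" if "\<forall>i. l $ i = 0" for l :: "'k^'n" using that by (simp add: vec_eq_iff)
  have "flag_basis L {} (\<lambda>_. 0) 1"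
    by (auto simp: flag_basis_def zero_R intro!: exI[of _ "\<lambda>_. 0"] dest: zero)
  from step[OF this, of p] obtain e0 where e0: "flag_basis L {p} e0 (fact T)" by auto
  have "\<exists>e. flag_basis L (insert p J) e (fact T ^ card (insert p J)) \<and> (\<forall>i. i \<noteq> p \<longrightarrow> e p $ i = 0)"
    if "finite J" "p \<notin> J" for J
    using that
  proof (induction J rule: finite_induct)
    case empty
    have "\<forall>i. i \<noteq> p \<longrightarrow> e0 p $ i = 0" using e0 by (auto simp: flag_basis_def)
    then show ?case using e0 by auto
  next
    case (insert k J)
    then obtain e where e: "flag_basis L (insert p J) e (fact T ^ card (insert p J))" "\<forall>i. i \<noteq> p \<longrightarrow> e p $ i = 0"
      by auto
    have "k \<notin> insert p J" using insert by auto
    from step[OF e(1) this] obtain w where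
      "flag_basis L (insert k (insert p J)) (e(k := w)) (fact T ^ card (insert p J) * fact T)" by blast
    moreover have "insert k (insert p J) = insert p (insert k J)" by auto
    moreover have "card (insert p (insert k J)) = Suc (card (insert p J))"
      using insert by (subst insert_commute, intro card_insert_disjoint) auto
    ultimately have "flag_basis L (insert p (insert k J)) (e(k := w)) (fact T ^ card (insert p (insert k J)))"
      by (simp only: power_Suc mult.commute)
    moreover have "\<forall>i. i \<noteq> p \<longrightarrow> (e(k := w)) p $ i = 0" using e(2) insert by auto
    ultimately show ?case by blast
  qed
  from this[of "UNIV - {p}"] show ?thesis by (simp add: insert_UNIV insert_Diff_if)
qed

end

locale lattice_basis = order_basis scaleQ B R
  for scaleQ :: "rat \<Rightarrow> 'k::division_ring \<Rightarrow> 'k" and B R +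
  fixes L :: "('k^'n) set" assumes lattice: "right_lattice R L"
begin

lemma lattice_gens: obtains S where "finite S" "L = {(\<Sum>b\<in>S. rscale b (c b)) | c. \<forall>b\<in>S. c b \<in> R}"
  using lattice by (auto simp: right_lattice_def)

lemma lattice_right_basis: obtains S where "S \<subseteq> L" "right_basis S"
  using lattice by (auto simp: right_lattice_def)

lemma diff_L: assumes "x \<in> L" "y \<in> L" shows "x - y \<in> L"
proof -
  obtain S where S: "L = {(\<Sum>b\<in>S. rscale b (c b)) | c. \<forall>b\<in>S. c b \<in> R}" by (rule lattice_gens)
  obtain c d where "x = (\<Sum>b\<in>S. rscale b (c b))" "y = (\<Sum>b\<in>S. rscale b (d b))"
    "\<forall>b\<in>S. c b \<in> R" "\<forall>b\<in>S. d b \<in> R" using assms unfolding S by blast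
  then show ?thesis unfolding S using diff_R
    by (intro CollectI exI[of _ "\<lambda>b. c b - d b"]) (auto simp: rscale_diff_right sum_subtractf)
qed

lemma scale_L: assumes "x \<in> L" "r \<in> R" shows "rscale x r \<in> L"
proof -
  obtain S where S: "L = {(\<Sum>b\<in>S. rscale b (c b)) | c. \<forall>b\<in>S. c b \<in> R}" by (rule lattice_gens)
  obtain c where "x = (\<Sum>b\<in>S. rscale b (c b))" "\<forall>b\<in>S. c b \<in> R" using assms unfolding S by blast
  then show ?thesis unfolding S using mult_R assms(2)
    by (intro CollectI exI[of _ "\<lambda>b. c b * r"]) (auto simp: rscale_sum rscale_rscale)
qed

lemma nonempty_L: "L \<noteq> {}"
proof -
  obtain S where "L = {(\<Sum>b\<in>S. rscale b (c b)) | c. \<forall>b\<in>S. c b \<in> R}" by (rule lattice_gens)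
  then have "(\<Sum>b\<in>S. rscale b 0) \<in> L" using zero_R by auto
  then show ?thesis by auto
qed

lemma zero_L: "0 \<in> L"
  using nonempty_L diff_L by fastforce

lemma add_L: "x \<in> L \<Longrightarrow> y \<in> L \<Longrightarrow> x + y \<in> L"
  using diff_L[of x "0 - y"] diff_L[OF zero_L] by simp

lemma sum_L: "(\<And>a. a \<in> A \<Longrightarrow> f a \<in> L) \<Longrightarrow> sum f A \<in> L"
  by (induction A rule: infinite_finite_induct) (auto simp: zero_L add_L)

lemma multiple_in_L: "\<exists>m>0. rscale v (of_nat m) \<in> L"
proof -
  obtain S where S: "S \<subseteq> L" "right_basis S" by (rule lattice_right_basis)
  obtain c where v: "v = (\<Sum>b\<in>S. rscale b (c b))" using S(2) unfolding right_basis_def by blast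
  have "finite S" using S(2) by (simp add: right_basis_def)
  have "\<exists>m>0. \<forall>b\<in>S. c b * of_nat m \<in> R"
    using multiple_in_order mult_R of_nat_R
    by (intro common_multiple_exists[OF \<open>finite S\<close>]) (auto simp flip: mult.assoc)
  then obtain m where "m > 0" "\<forall>b\<in>S. c b * of_nat m \<in> R" by blast
  then show ?thesis using S(1) scale_L unfolding v rscale_sum rscale_rscale
    by (intro exI[of _ m] conjI sum_L scale_L) auto
qed

text \<open>The coordinates are sums of \<open>(A *v b) $ k * c b\<close> over the generators, a set
  with bounded denominators. The matrix \<open>A\<close> allows for pivoted copies of
  \<open>L\<close>.\<close>

lemma coordinate_discrete: "finite {y \<in> (\<lambda>x. (A *v x) $ k) ` L. nrm y \<le> a}"
proof -
  obtain S where S: "finite S" "L = {(\<Sum>b\<in>S. rscale b (c b)) | c. \<forall>b\<in>S. c b \<in> R}" by (rule lattice_gens)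
  have "(\<lambda>x. (A *v x) $ k) ` L \<subseteq> {(\<Sum>b\<in>S. (A *v b) $ k * c b) | c. \<forall>b\<in>S. c b \<in> R}"
    unfolding S by (auto simp: mult_vec_sum mult_rscale)
  then have "{y \<in> (\<lambda>x. (A *v x) $ k) ` L. nrm y \<le> a} \<subseteq>
    {y \<in> {(\<Sum>b\<in>S. (A *v b) $ k * c b) | c. \<forall>b\<in>S. c b \<in> R}. nrm y \<le> a}" by blast
  then show ?thesis
    by (rule finite_subset) (rule bounded_denoms_discrete[OF bounded_denoms_module[OF S(1)]])
qed

end

lemma finite_vectors:
  assumes "finite A"
  shows "finite {x :: 'b^'n. \<forall>i. x $ i \<in> A}"
proof (rule finite_subset)
  show "{x :: 'b^'n. \<forall>i. x $ i \<in> A} \<subseteq> vec_lambda ` (UNIV \<rightarrow>\<^sub>E A)"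
  proof
    fix x :: "'b^'n" assume "x \<in> {x. \<forall>i. x $ i \<in> A}"
    then show "x \<in> vec_lambda ` (UNIV \<rightarrow>\<^sub>E A)" by (intro image_eqI[of _ _ "vec_nth x"]) auto
  qed
  show "finite (vec_lambda ` (UNIV \<rightarrow>\<^sub>E A) :: ('b^'n) set)" using assms by (intro finite_imageI finite_PiE) auto
qed

lemma finite_image_factor:
  assumes "finite (g ` X)" "\<And>x y. x \<in> X \<Longrightarrow> y \<in> X \<Longrightarrow> g x = g y \<Longrightarrow> f x = f y"
  shows "finite (f ` X)"
proof (rule finite_subset)
  show "f ` X \<subseteq> (\<lambda>k. f (inv_into X g k)) ` (g ` X)"
  proof
    fix y assume "y \<in> f ` X"
    then obtain x where x: "x \<in> X" "y = f x" by blast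
    then have "inv_into X g (g x) \<in> X" "g (inv_into X g (g x)) = g x"
      by (auto intro: inv_into_into f_inv_into_f)
    then have "y = f (inv_into X g (g x))" using assms(2) x by metis
    then show "y \<in> (\<lambda>k. f (inv_into X g k)) ` (g ` X)" using x by blast
  qed
qed (use assms(1) in simp)

section \<open>Finitely many intermediate lattices and finitely many weights\<close>

context order_basis
begin

text \<open>These are subgroups between \<open>R^n\<close> and \<open>R^n / M\<close>. Each is
  determined by which of finitely many representatives of the quotient it contains.\<close>

lemma finite_overlattices:
  assumes M: "M > 0"
  shows "finite {\<Lambda> :: ('k^'n) set. (\<forall>c. (\<forall>i. c $ i \<in> R) \<longrightarrow> c \<in> \<Lambda>) \<and>
    (\<forall>x\<in>\<Lambda>. \<forall>y\<in>\<Lambda>. x - y \<in> \<Lambda>) \<and> (\<forall>c\<in>\<Lambda>. \<forall>i. c $ i * of_nat M \<in> R)}" (is "finite ?X")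
proof -
  obtain G where G: "finite G" "R = {(\<Sum>b\<in>G. of_int (c b) * b) | c. True}" by (rule order_gens)
  \<comment> \<open>Residues modulo \<open>M\<close> of the integer coefficients. The generators may
    be dependent, so a class can have several representatives, which does no harm.\<close>
  define Rep where "Rep = (\<lambda>z. \<Sum>b\<in>G. of_int (z b) * b) ` (G \<rightarrow>\<^sub>E {0..<int M})"
  have "finite Rep" unfolding Rep_def using G(1) by (intro finite_imageI finite_PiE) auto
  define f where "f \<Lambda> = {x :: 'k^'n. (\<forall>i. x $ i \<in> Rep) \<and> rscale x (inverse (of_nat M)) \<in> \<Lambda>}" for \<Lambda>
  have rep: "\<exists>\<rho>\<in>Rep. \<exists>d\<in>R. r = \<rho> + d * of_nat M" if "r \<in> R" for r
  proof -
    obtain z where z: "r = (\<Sum>b\<in>G. of_int (z b) * b)" using \<open>r \<in> R\<close> G(2) by blast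
    define w where "w = (\<lambda>b\<in>G. z b mod int M)"
    define d where "d = (\<Sum>b\<in>G. of_int (z b div int M) * b)"
    have "w \<in> G \<rightarrow>\<^sub>E {0..<int M}" using M by (auto simp: w_def)
    then have "(\<Sum>b\<in>G. of_int (w b) * b) \<in> Rep" unfolding Rep_def by blast
    moreover have "d \<in> R" unfolding d_def G(2) by (intro CollectI exI[of _ "\<lambda>b. z b div int M"]) simp
    moreover have "r = (\<Sum>b\<in>G. of_int (w b) * b) + d * of_nat M"
    proof -
      have "of_int (z b) * b = of_int (z b mod int M) * b + of_nat M * (of_int (z b div int M) * b)" for b
      proof -
        have "of_int (z b) = (of_int (z b mod int M) + of_nat M * of_int (z b div int M) :: 'k)"
          by (metis mult_div_mod_eq add.commute of_int_add of_int_mult of_int_of_nat_eq)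
        then show ?thesis by (simp add: distrib_right mult.assoc)
      qed
      then have "r = (\<Sum>b\<in>G. of_int (z b mod int M) * b) + of_nat M * d"
        unfolding z d_def sum_distrib_left by (simp add: sum.distrib)
      then show ?thesis by (simp add: w_def mult_of_nat_commute)
    qed
    ultimately show ?thesis by blast
  qed
  have sub: "\<Lambda> \<subseteq> \<Lambda>'" if \<Lambda>: "\<Lambda> \<in> ?X" "\<Lambda>' \<in> ?X" "f \<Lambda> = f \<Lambda>'" for \<Lambda> \<Lambda>'
  proof
    fix c assume c: "c \<in> \<Lambda>"
    then have "\<forall>i. c $ i * of_nat M \<in> R" using \<Lambda>(1) by blast
    then have "\<forall>i. \<exists>\<rho> d. \<rho> \<in> Rep \<and> d \<in> R \<and> c $ i * of_nat M = \<rho> + d * of_nat M" using rep by blast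
    then obtain \<rho> d where \<rho>: "\<And>i. \<rho> i \<in> Rep" and d: "\<And>i. d i \<in> R"
      and eq: "\<And>i. c $ i * of_nat M = \<rho> i + d i * of_nat M" by metis
    define x where "x = (\<chi> i. \<rho> i)"
    define y where "y = (\<chi> i. d i)"
    have yy: "\<forall>i. y $ i \<in> R" "\<forall>i. (- y) $ i \<in> R" using d minus_R by (auto simp: y_def)
    have xc: "rscale x (inverse (of_nat M)) = c - y"
    proof -
      have "\<rho> i = (c $ i - d i) * of_nat M" for i using eq[of i] by (simp add: left_diff_distrib)
      then show ?thesis using of_nat_nonzero[OF M] by (simp add: vec_eq_iff x_def y_def mult.assoc)
    qed
    have "c - y \<in> \<Lambda>" using \<Lambda>(1) c yy by blast
    then have "x \<in> f \<Lambda>" using \<rho> xc by (simp add: f_def) (simp add: x_def)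
    then have "x \<in> f \<Lambda>'" by (simp only: \<Lambda>(3))
    then have "c - y \<in> \<Lambda>'" by (simp add: f_def xc)
    moreover have "- y \<in> \<Lambda>'" using \<Lambda>(2) yy by blast
    ultimately have "(c - y) - (- y) \<in> \<Lambda>'" using \<Lambda>(2) by blast
    then show "c \<in> \<Lambda>'" by simp
  qed
  have "inj_on f ?X" using sub by (intro inj_onI) (metis (no_types, lifting) subset_antisym)
  moreover have "f ` ?X \<subseteq> Pow {x. \<forall>i. x $ i \<in> Rep}" by (auto simp: f_def)
  moreover have "finite (Pow {x :: 'k^'n. \<forall>i. x $ i \<in> Rep})" using finite_vectors[OF \<open>finite Rep\<close>] by simp
  ultimately show ?thesis by (rule inj_on_finite)
qed

end

context lattice_basis
begin

text \<open>The columns of \<open>A\<close> form a \<open>K\<close>-basis with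
  \<open>A R^n \<subseteq> L \<subseteq> A (R^n / M)\<close>. Column \<open>p\<close> equals
  \<open>v\<close> only up to the scalar \<open>s\<close>, since the line of \<open>v\<close> is all
  that the weight sees.\<close>

definition adapted :: "nat \<Rightarrow> 'k^'n \<Rightarrow> 'n \<Rightarrow> 'k^'n^'n \<Rightarrow> 'k^'n^'n \<Rightarrow> 'k \<Rightarrow> bool" where
  "adapted M v p A A' s \<longleftrightarrow> A ** A' = mat 1 \<and> A' ** A = mat 1 \<and> s \<noteq> 0 \<and> A *v axis p 1 = rscale v s \<and>
    (\<forall>c. (\<forall>i. c $ i \<in> R) \<longrightarrow> A *v c \<in> L) \<and> (\<forall>l\<in>L. \<forall>i. (A' *v l) $ i * of_nat M \<in> R)"

text \<open>Pivoting turns the line of \<open>v\<close> into a coordinate axis, where a flag basis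
  started at \<open>p\<close> applies to the transformed lattice. \<open>C\<close> and
  \<open>T\<close> come from the order and \<open>B\<close>, so \<open>M\<close> is fixed before
  \<open>v\<close>.\<close>

lemma adapted_exists:
  obtains M where "M > 0" "\<And>v. v \<noteq> 0 \<Longrightarrow> \<exists>p A A' s. adapted M v p A A' s"
proof -
  obtain C where C: "C > 0" "\<And>x y. nrm (x * y) \<le> C * nrm x * nrm y" using nrm_mult by blast
  obtain T where T: "\<And>x. \<exists>t\<in>{1..T}. \<exists>q\<in>R. nrm (of_nat t * x - q) < 1 / C"
    using dirichlet_order[of "1 / C"] C by auto
  define M :: nat where "M = fact T ^ CARD('n)"
  have M: "M > 0" by (simp add: M_def)
  show thesis
  proof (rule that[OF M])
    fix v :: "'k^'n" assume "v \<noteq> 0"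
    then obtain p where "v $ p \<noteq> 0" by (auto simp: vec_eq_iff)
    then obtain P Q where PQ: "P ** Q = mat 1" "Q ** P = mat 1" "P *v v = axis p 1" by (rule pivot)
    have QP: "Q *v (P *v x) = x" "P *v (Q *v x) = x" for x by (simp_all add: matrix_vector_mul_assoc PQ)
    define L' where "L' = {y. Q *v y \<in> L}"
    have disc: "finite {y \<in> (\<lambda>x. x $ k) ` L'. nrm y \<le> a}" for k a
    proof (rule finite_subset[OF _ coordinate_discrete[of P k a]])
      have "x $ k = (P *v (Q *v x)) $ k" for x by (simp add: QP)
      then show "{y \<in> (\<lambda>x. x $ k) ` L'. nrm y \<le> a} \<subseteq> {y \<in> (\<lambda>x. (P *v x) $ k) ` L. nrm y \<le> a}"
        unfolding L'_def by blast
    qed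
    have axes: "\<exists>m>0. axis k (of_nat m) \<in> L'" for k
    proof -
      have "axis k (of_nat m) = rscale (axis k 1) (of_nat m)" for m by (simp add: vec_eq_iff axis_def)
      moreover obtain m where "m > 0" "rscale (Q *v axis k 1) (of_nat m) \<in> L"
        using multiple_in_L by blast
      ultimately show ?thesis unfolding L'_def by (metis mem_Collect_eq mult_rscale)
    qed
    have "\<exists>e. flag_basis L' UNIV e (fact T ^ CARD('n)) \<and> (\<forall>i. i \<noteq> p \<longrightarrow> e p $ i = 0)"
    proof (rule flag_basis_exists[where C = C and T = T])
      show "x - y \<in> L'" if "x \<in> L'" "y \<in> L'" for x y
        using that diff_L by (simp add: L'_def matrix_vector_mult_diff_distrib)
      show "rscale x r \<in> L'" if "x \<in> L'" "r \<in> R" for x r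
        using that scale_L by (simp add: L'_def mult_rscale)
    qed (rule disc axes C T)+
    then obtain e where e: "flag_basis L' UNIV e M" "\<And>i. i \<noteq> p \<Longrightarrow> e p $ i = 0"
      unfolding M_def by blast
    have eL: "\<And>j. e j \<in> L'" and
      gen: "\<And>l. l \<in> L' \<Longrightarrow> \<exists>c. (\<forall>j. c j \<in> R) \<and> rscale l (of_nat M) = (\<Sum>j\<in>UNIV. rscale (e j) (c j))" and
      indep: "\<And>c. (\<Sum>j\<in>UNIV. rscale (e j) (c j)) = 0 \<Longrightarrow> \<forall>j. c j = 0"
      using e(1) unfolding flag_basis_def by simp_all
    define W where "W = (\<chi> i j. e j $ i)"
    have W: "W *v c = (\<Sum>j\<in>UNIV. rscale (e j) (c $ j))" for c
      by (simp add: W_def matrix_vector_mult_def vec_eq_iff)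
    have inj: "c = 0" if "W *v c = 0" for c
      using indep[of "\<lambda>j. c $ j"] that by (simp add: W vec_eq_iff)
    \<comment> \<open>Some multiple of the axis vector lies in \<open>L'\<close>, and
      \<open>M\<close> times it is a combination of the columns of \<open>W\<close>. Dividing gives
      a right inverse of \<open>W\<close>, which injectivity makes two-sided.\<close>
    have "\<exists>x. W *v x = axis k 1" for k
    proof -
      obtain m where m: "m > 0" "axis k (of_nat m) \<in> L'" using axes by blast
      obtain c where "rscale (axis k (of_nat m)) (of_nat M) = W *v (\<chi> j. c j)"
        using gen[OF m(2)] by (auto simp: W)
      then have "W *v rscale (\<chi> j. c j) (inverse (of_nat m * of_nat M)) =
          rscale (rscale (axis k (of_nat m)) (of_nat M)) (inverse (of_nat m * of_nat M))"
        by (simp add: mult_rscale)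
      also have "\<dots> = axis k 1"
      proof -
        have "of_nat m * of_nat M * inverse (of_nat m * of_nat M) = (1 :: 'k)"
          using of_nat_nonzero[OF m(1)] of_nat_nonzero[OF M] by (intro right_inverse) simp
        then show ?thesis by (simp add: vec_eq_iff axis_def)
      qed
      finally show ?thesis by blast
    qed
    then obtain y where y: "\<And>k. W *v y k = axis k 1" by metis
    define W' where "W' = (\<chi> i j. y j $ i)"
    have "W' *v axis k 1 = y k" for k by (simp add: vec_eq_iff mult_axis_nth W'_def)
    then have WW': "W ** W' = mat 1"
      by (intro matrix_eqI_axis) (simp add: y flip: matrix_vector_mul_assoc)
    have W'W: "W' ** W = mat 1"
    proof -
      have "W *v (W' *v (W *v x) - x) = 0" for x
        by (simp add: matrix_vector_mult_diff_distrib matrix_vector_mul_assoc matrix_mul_assoc WW')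
      then have "W' *v (W *v x) = x" for x using inj by (metis eq_iff_diff_eq_0)
      then show ?thesis by (simp add: matrix_eq flip: matrix_vector_mul_assoc)
    qed
    define A where "A = Q ** W"
    define A' where "A' = W' ** P"
    have "A ** A' = mat 1" "A' ** A = mat 1"
      unfolding A_def A'_def by (metis PQ WW' W'W matrix_mul_assoc matrix_mul_rid)+
    moreover have "e p $ p \<noteq> 0" "A *v axis p 1 = rscale v (e p $ p)"
    proof -
      have Wp: "W *v axis p 1 = e p" by (simp add: vec_eq_iff mult_axis_nth W_def)
      have ep: "e p = rscale (axis p 1) (e p $ p)" using e(2) by (auto simp: vec_eq_iff axis_def)
      show "e p $ p \<noteq> 0"
      proof
        assume "e p $ p = 0"
        then have "e p = 0" using e(2) by (metis vec_eq_iff zero_index)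
        then have "axis p (1 :: 'k) = 0" using inj Wp by metis
        then show False by (simp add: axis_eq_0_iff)
      qed
      have "A *v axis p 1 = Q *v rscale (axis p 1) (e p $ p)"
        by (metis A_def Wp ep matrix_vector_mul_assoc)
      also have "\<dots> = rscale v (e p $ p)" by (metis PQ(3) QP(1) mult_rscale)
      finally show "A *v axis p 1 = rscale v (e p $ p)" .
    qed
    moreover have "A *v c \<in> L" if c: "\<forall>i. c $ i \<in> R" for c
    proof -
      have "A *v c = (\<Sum>j\<in>UNIV. rscale (Q *v e j) (c $ j))"
        by (simp add: A_def W mult_vec_sum mult_rscale flip: matrix_vector_mul_assoc)
      then show ?thesis using eL c by (auto simp: L'_def intro!: sum_L scale_L)
    qed
    moreover have "(A' *v l) $ i * of_nat M \<in> R" if "l \<in> L" for l i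
    proof -
      have "P *v l \<in> L'" using that by (simp add: L'_def QP)
      then obtain c where c: "\<forall>j. c j \<in> R" "rscale (P *v l) (of_nat M) = W *v (\<chi> j. c j)"
        using gen by (auto simp: W)
      have "rscale (A' *v l) (of_nat M) = W' *v (W *v (\<chi> j. c j))"
        by (simp add: A'_def c(2)[symmetric] mult_rscale flip: matrix_vector_mul_assoc)
      also have "\<dots> = (\<chi> j. c j)" by (simp add: matrix_vector_mul_assoc W'W)
      finally have "rscale (A' *v l) (of_nat M) $ i = c i" by simp
      then show ?thesis using c(1) by simp
    qed
    ultimately have "adapted M v p A A' (e p $ p)" unfolding adapted_def by blast
    then show "\<exists>p A A' s. adapted M v p A A' s" by blast
  qed
qed

text \<open>Two lines whose adapted matrices \<open>A\<close> have the same preimage of \<open>L\<close> are exchanged by \<open>GL(L)\<close>,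
  and there are finitely many such preimages (Jordan--Zassenhaus).\<close>

lemma weight_finite:
  assumes w: "is_weight L \<phi>"
  shows "finite (\<phi> ` (- {0}))"
proof -
  obtain M where M: "M > 0" and ad: "\<And>v. v \<noteq> 0 \<Longrightarrow> \<exists>p A A' s. adapted M v p A A' s"
    by (rule adapted_exists) blast
  then obtain p A A' s where t: "\<And>v. v \<noteq> 0 \<Longrightarrow> adapted M v (p v) (A v) (A' v) (s v)"
    by metis
  have inv: "A v ** A' v = mat 1" "A' v ** A v = mat 1"
    and s: "s v \<noteq> 0" "A v *v axis (p v) 1 = rscale v (s v)"
    and AL: "\<forall>c. (\<forall>i. c $ i \<in> R) \<longrightarrow> A v *v c \<in> L"
    and A'L: "\<forall>l\<in>L. \<forall>i. (A' v *v l) $ i * of_nat M \<in> R" if "v \<noteq> 0" for v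
    using t[OF that] unfolding adapted_def by simp_all
  have AA': "A v *v (A' v *v x) = x" "A' v *v (A v *v x) = x" if "v \<noteq> 0" for v x
    using inv that by (simp_all add: matrix_vector_mul_assoc)
  define Lam where "Lam v = {c. A v *v c \<in> L}" for v
  \<comment> \<open>The index \<open>p v\<close> is recorded too, since the matrix exchanging two
    lines must match their distinguished columns.\<close>
  define g where "g v = (p v, Lam v)" for v
  let ?X = "{\<Lambda> :: ('k^'n) set. (\<forall>c. (\<forall>i. c $ i \<in> R) \<longrightarrow> c \<in> \<Lambda>) \<and>
    (\<forall>x\<in>\<Lambda>. \<forall>y\<in>\<Lambda>. x - y \<in> \<Lambda>) \<and> (\<forall>c\<in>\<Lambda>. \<forall>i. c $ i * of_nat M \<in> R)}"
  have "Lam v \<in> ?X" if v: "v \<noteq> 0" for v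
  proof -
    have "c $ i * of_nat M \<in> R" if c: "A v *v c \<in> L" for c i
    proof -
      have "(A' v *v (A v *v c)) $ i * of_nat M \<in> R" using A'L[OF v] c by blast
      then show ?thesis by (simp add: AA'(2)[OF v])
    qed
    then show ?thesis using AL[OF v] diff_L by (auto simp: Lam_def matrix_vector_mult_diff_distrib)
  qed
  then have "g ` (- {0}) \<subseteq> (UNIV :: 'n set) \<times> ?X" by (auto simp: g_def)
  moreover have "finite ((UNIV :: 'n set) \<times> ?X)"
    by (intro finite_cartesian_product finite_overlattices[OF M]) simp
  ultimately have fin: "finite (g ` (- {0}))" by (rule finite_subset)
  show ?thesis
  proof (rule finite_image_factor[OF fin])
    fix v v' assume "v \<in> - {0}" "v' \<in> - {0}" and geq: "g v = g v'"
    then have v: "v \<noteq> 0" "v' \<noteq> 0" by auto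
    have eq: "p v = p v'" "Lam v = Lam v'" using geq by (auto simp: g_def)
    define h where "h = A v' ** A' v"
    have h: "h *v x = A v' *v (A' v *v x)" for x by (simp add: h_def matrix_vector_mul_assoc)
    have "(\<lambda>x. h *v x) ` L = L"
    proof
      show "(\<lambda>x. h *v x) ` L \<subseteq> L"
      proof
        fix y assume "y \<in> (\<lambda>x. h *v x) ` L"
        then obtain x where x: "x \<in> L" "y = h *v x" by blast
        then have "A' v *v x \<in> Lam v" using v by (simp add: Lam_def AA')
        then show "y \<in> L" unfolding eq x h by (simp add: Lam_def)
      qed
      show "L \<subseteq> (\<lambda>x. h *v x) ` L"
      proof
        fix y assume "y \<in> L"
        then have "A' v' *v y \<in> Lam v'" using v by (simp add: Lam_def AA')
        then have "A v *v (A' v' *v y) \<in> L" unfolding eq(2)[symmetric] by (simp add: Lam_def)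
        moreover have "y = h *v (A v *v (A' v' *v y))" using v by (simp add: h AA')
        ultimately show "y \<in> (\<lambda>x. h *v x) ` L" by blast
      qed
    qed
    then have hGL: "h \<in> carrier (GL L)" by (simp add: GL_def)
    \<comment> \<open>\<open>h\<close> sends column \<open>p v\<close> of \<open>A v\<close> to the
      same column of \<open>A v'\<close>; invariance of the weight under scalars then removes
      \<open>s v\<close> and \<open>s v'\<close>.\<close>
    have "h *v rscale v (s v) = rscale v' (s v')" using s v eq by (metis AA'(2) h)
    moreover have "\<phi> (rscale v (s v)) = \<phi> v" "\<phi> (rscale v' (s v')) = \<phi> v'"
      using w s v by (auto simp: is_weight_def)
    moreover have "rscale v (s v) \<noteq> 0" using s(1)[OF v(1)] v(1) by (auto simp: vec_eq_iff)
    moreover have "\<phi> (h *v x) = \<phi> x" if "x \<noteq> 0" for x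
      using w hGL that by (auto simp: is_weight_def)
    ultimately show "\<phi> v = \<phi> v'" by metis
  qed
qed

end

section \<open>Averaged forms and coordinates\<close>

lemma linear_axis: "linear (axis i)"
  by (rule linearI) (auto simp: axis_def vec_eq_iff)

lemma finite_span_vec:
  fixes C :: "'b::real_vector set"
  assumes "finite C" "span C = UNIV"
  obtains D :: "('b^'n) set" where "finite D" "span D = UNIV"
proof
  let ?D = "\<Union>i\<in>UNIV. axis i ` C :: ('b^'n) set"
  show "finite ?D" using assms(1) by simp
  have "x \<in> span ?D" for x :: "'b^'n"
  proof -
    have "axis i (x $ i) \<in> span ?D" for i
    proof -
      have "axis i (x $ i) \<in> axis i ` span C" using assms(2) by simp
      also have "\<dots> = span (axis i ` C)" by (rule linear_span_image[OF linear_axis, symmetric])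
      also have "\<dots> \<subseteq> span ?D" by (rule span_mono) auto
      finally show ?thesis .
    qed
    then have "(\<Sum>i\<in>UNIV. axis i (x $ i)) \<in> span ?D" by (rule span_sum)
    moreover have "(\<Sum>i\<in>UNIV. axis i (x $ i)) = x" by (simp add: vec_eq_iff axis_def)
    ultimately show ?thesis by simp
  qed
  then show "span ?D = UNIV" by auto
qed

context real_ext
begin

lemma emb_0: "emb E 0 = 0"
  using emb_add[of 0 0] by simp

lemma emb_minus: "emb E (- x) = - emb E x"
  using emb_add[of x "- x"] emb_0 by (simp add: eq_neg_iff_add_eq_0 add.commute)

lemma emb_sum: "emb E (sum f A) = (\<Sum>a\<in>A. emb E (f a))"
  by (induction A rule: infinite_finite_induct) (auto simp: emb_0 emb_add)

lemma emb_of_nat: "emb E (of_nat n * x) = real n *\<^sub>R emb E x"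
  by (induction n) (auto simp: emb_0 emb_add distrib_right scaleR_add_left)

lemma emb_of_int: "emb E (of_int n * x) = real_of_int n *\<^sub>R emb E x"
proof (cases "n \<ge> 0")
  case True
  then show ?thesis using emb_of_nat[of "nat n" x] by simp
next
  case False
  then show ?thesis using emb_of_nat[of "nat (- n)" x] emb_minus[of "of_int n * x"] by simp
qed

lemma emb_of_nat_right: "emb E (x * of_nat n) = real n *\<^sub>R emb E x"
  using emb_of_nat[of n x] by (simp add: mult_of_nat_commute)

lemma emb_vec_rscale_nat: "emb_vec (rscale v (of_nat n)) = real n *\<^sub>R emb_vec v"
  by (simp add: emb_vec_def vec_eq_iff emb_of_nat_right)

lemma emb_vec_0 [simp]: "emb_vec 0 = 0"
  by (simp add: emb_vec_def vec_eq_iff emb_0)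

lemma form_val_rscale_nat: "form_val E F (rscale v (of_nat n)) = (real n)\<^sup>2 * form_val E F v"
  by (simp add: form_val_eq emb_vec_rscale_nat linear_scale[OF linear_bform_left]
      linear_scale[OF linear_bform_right] power2_eq_square)

lemma form_val_0 [simp]: "form_val E F 0 = 0"
  unfolding form_val_eq emb_vec_0 by (rule linear_0[OF linear_bform_right])

definition emb_mat :: "'k^'n^'n \<Rightarrow> 'a^'n^'n" where "emb_mat = map_matrix (emb E)"

lemma emb_mat_mult: "emb_mat (A ** B) = emb_mat A ** emb_mat B"
  by (simp add: emb_mat_def map_matrix_def matrix_matrix_mult_def vec_eq_iff emb_sum emb_mult)

lemma emb_mat_vec: "emb_mat A *v emb_vec v = emb_vec (A *v v)"
  by (simp add: emb_mat_def emb_vec_def map_matrix_def matrix_vector_mult_def vec_eq_iff emb_sum emb_mult)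

lemma dagger_mult: "dagger E (X ** Y) = dagger E Y ** dagger E X"
  by (simp add: dagger_def matrix_matrix_mult_def vec_eq_iff star_sum star_mult)

lemma dagger_dagger [simp]: "dagger E (dagger E X) = X"
  by (simp add: dagger_def vec_eq_iff)

lemma linear_dagger: "linear (dagger E)"
  by (rule linearI) (auto simp: dagger_def vec_eq_iff star_add star_scaleR)

lemma linear_sandwich: "linear (\<lambda>F :: 'a^'n^'n. X ** F ** Y)"
proof (rule linearI)
  fix F F' :: "'a^'n^'n" and c :: real
  have "(A + B) ** Y = A ** Y + B ** Y" for A B
    by (simp add: matrix_matrix_mult_def vec_eq_iff distrib_right sum.distrib)
  then show "X ** (F + F') ** Y = X ** F ** Y + X ** F' ** Y" by (simp add: matrix_add_ldistrib)
  show "X ** (c *\<^sub>R F) ** Y = c *\<^sub>R (X ** F ** Y)"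
    by (simp add: matrix_matrix_mult_def vec_eq_iff flip: scaleR_sum_right)
qed

lemma invariant_forms_alt: "F \<in> invariant_forms E G \<longleftrightarrow>
    dagger E F = F \<and> (\<forall>g\<in>G. dagger E (emb_mat g) ** F ** emb_mat g = F)"
  by (simp add: invariant_forms_def Sym_def emb_mat_def)

lemma subspace_invariant_forms: "subspace (invariant_forms E G)"
  by (simp add: subspace_def invariant_forms_alt linear_0[OF linear_dagger] linear_add[OF linear_dagger]
      linear_scale[OF linear_dagger] linear_0[OF linear_sandwich] linear_add[OF linear_sandwich]
      linear_scale[OF linear_sandwich])

lemma invariant_form_val:
  assumes "F \<in> invariant_forms E G" "g \<in> G"
  shows "form_val E F (g *v v) = form_val E F v"
  using bform_congruence[of "emb_mat g" F "emb_vec v" "emb_vec v"] assms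
  by (simp add: invariant_forms_alt form_val_eq emb_mat_vec)

definition sqnorm :: "'a^'n \<Rightarrow> real" where
  "sqnorm x = (\<Sum>i\<in>UNIV. red_trace E (x $ i * star E (x $ i)))"

lemma sqnorm_nonneg: "0 \<le> sqnorm x"
  unfolding sqnorm_def by (intro sum_nonneg red_trace_norm)

lemma sqnorm_0D: "sqnorm x = 0 \<Longrightarrow> x = 0"
  unfolding sqnorm_def
  by (subst (asm) sum_nonneg_eq_0_iff) (auto simp: vec_eq_iff red_trace_norm dest: red_trace_norm(2))

lemma bform_dagger_mult: "bform (dagger E M ** M) x x = sqnorm (M *v x)"
proof -
  have "bform (mat 1) y y = sqnorm y" for y
  proof -
    have "(\<Sum>j\<in>UNIV. mat 1 $ i $ j * y $ j * star E (y $ i)) = y $ i * star E (y $ i)" for i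
    proof -
      have "mat 1 $ i $ j * y $ j * star E (y $ i) = (if j = i then y $ j * star E (y $ i) else 0)" for j
        by (simp add: mat_def)
      then show ?thesis by simp
    qed
    then show ?thesis by (simp add: bform_def sqnorm_def red_trace_sum)
  qed
  then show ?thesis using bform_congruence[of M "mat 1" x x] by simp
qed

text \<open>Used twice: \<open>A = mat 1\<close> gives a positive invariant form to start from, and
  a functional \<open>A\<close> vanishing on the minimal vectors gives a direction that perfection
  forbids.\<close>

definition averaged_form :: "('k^'n^'n) set \<Rightarrow> 'k^'n^'n \<Rightarrow> 'a^'n^'n" where
  "averaged_form G A = (\<Sum>g\<in>G. dagger E (emb_mat (A ** g)) ** emb_mat (A ** g))"

lemma averaged_form_invariant:
  assumes "\<And>g. g \<in> G \<Longrightarrow> bij_betw (\<lambda>h. h ** g) G G"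
  shows "averaged_form G A \<in> invariant_forms E G"
  unfolding invariant_forms_alt
proof (intro conjI ballI)
  show "dagger E (averaged_form G A) = averaged_form G A"
    by (simp add: averaged_form_def linear_sum[OF linear_dagger] dagger_mult)
  fix g assume g: "g \<in> G"
  have "dagger E (emb_mat g) ** averaged_form G A ** emb_mat g =
    (\<Sum>h\<in>G. dagger E (emb_mat (A ** (h ** g))) ** emb_mat (A ** (h ** g)))"
    unfolding averaged_form_def linear_sum[OF linear_sandwich]
    by (simp add: emb_mat_mult dagger_mult matrix_mul_assoc)
  also have "\<dots> = averaged_form G A"
    unfolding averaged_form_def by (rule sum.reindex_bij_betw[OF assms[OF g]])
  finally show "dagger E (emb_mat g) ** averaged_form G A ** emb_mat g = averaged_form G A" .
qed

lemma averaged_form_val: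
  "form_val E (averaged_form G A) v = (\<Sum>g\<in>G. sqnorm (emb_vec (A *v (g *v v))))"
proof -
  have "bform (averaged_form G A) x x = (\<Sum>g\<in>G. sqnorm (emb_mat (A ** g) *v x))" for x
    by (simp add: averaged_form_def linear_sum[OF linear_bform_form] bform_dagger_mult)
  then show ?thesis by (simp add: form_val_eq emb_mat_vec matrix_vector_mul_assoc)
qed

lemma emb_inj: assumes "emb E x = 0" shows "x = 0"
proof (rule ccontr)
  assume "x \<noteq> 0"
  then have "emb E (inverse x * x) = emb E 1" by simp
  then show False using assms by (simp add: emb_mult emb_1)
qed

lemma emb_vec_inj: "emb_vec v = 0 \<Longrightarrow> v = 0"
  using emb_inj by (auto simp: emb_vec_def vec_eq_iff)

lemma red_trace_Cauchy_Schwarz: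
  "(red_trace E (x * star E y))\<^sup>2 \<le> red_trace E (x * star E x) * red_trace E (y * star E y)"
proof (cases "y = 0")
  case True
  then show ?thesis by (simp add: linear_0[OF linear_star] linear_0[OF linear_red_trace])
next
  case False
  define a where "a = red_trace E (y * star E y)"
  have a: "a > 0" using red_trace_norm[of y] False by (auto simp: a_def less_le)
  define t where "t = red_trace E (x * star E y) / a"
  have yx: "red_trace E (y * star E x) = red_trace E (x * star E y)"
    using red_trace_star[of "y * star E x"] by (simp add: star_mult)
  have "0 \<le> red_trace E ((x - t *\<^sub>R y) * star E (x - t *\<^sub>R y))" by (rule red_trace_norm)
  also have "\<dots> = red_trace E (x * star E x) - 2 * t * red_trace E (x * star E y) + t * t * a"
    by (simp add: linear_diff[OF linear_star] star_scaleR left_diff_distrib right_diff_distrib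
      linear_diff[OF linear_red_trace] red_trace_scaleR yx a_def)
  also have "\<dots> = red_trace E (x * star E x) - (red_trace E (x * star E y))\<^sup>2 / a"
    using a by (simp add: t_def power2_eq_square)
  finally show ?thesis using a by (simp add: a_def[symmetric] field_simps)
qed

text \<open>The coordinate functionals are represented by the elements of the dual basis for the trace form.\<close>

lemma coordinate_bound:
  assumes B: "Q_basis scaleQ B" "finite B" and b0: "b0 \<in> B"
  shows "\<exists>K>0. \<forall>c. (c b0)\<^sup>2 \<le> K * red_trace E ((\<Sum>b\<in>B. c b *\<^sub>R emb E b) * star E (\<Sum>b\<in>B. c b *\<^sub>R emb E b))"
proof -
  have inj: "inj_on (emb E) B" and ind: "independent (emb E ` B)" and sp: "span (emb E ` B) = UNIV"
    using emb_basis[OF B(1)] by auto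
  interpret fd: finite_dimensional_vector_space "(*\<^sub>R) :: real \<Rightarrow> 'a \<Rightarrow> 'a" "emb E ` B"
    by unfold_locales (use ind sp B(2) in \<open>auto simp: span_raw_def dependent_raw_def\<close>)
  have coeff: "\<forall>b\<in>B. c b = 0" if "(\<Sum>b\<in>B. c b *\<^sub>R emb E b) = 0" for c
  proof -
    have "(\<Sum>x\<in>emb E ` B. c (the_inv_into B (emb E) x) *\<^sub>R x) = 0"
      using that by (simp add: sum.reindex[OF inj] the_inv_into_f_f[OF inj])
    then have "\<forall>x\<in>emb E ` B. c (the_inv_into B (emb E) x) = 0"
      using ind B(2) independentD[of "emb E ` B" "emb E ` B" "\<lambda>x. c (the_inv_into B (emb E) x)"] by blast
    then show ?thesis by (simp add: the_inv_into_f_f[OF inj])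
  qed
  \<comment> \<open>\<open>A\<close> sends \<open>y\<close> to the vector whose coordinates are its
    trace pairings with the basis. It is injective as the trace form is nondegenerate, hence onto,
    and a preimage of \<open>emb E b0\<close> is the dual basis element.\<close>
  define A where "A y = (\<Sum>b\<in>B. red_trace E (y * star E (emb E b)) *\<^sub>R emb E b)" for y
  have "linear A"
    by (rule linearI) (simp_all add: A_def distrib_right red_trace_add red_trace_scaleR scaleR_add_left
        sum.distrib scaleR_sum_right)
  moreover have "inj A"
    unfolding linear_injective_0[OF \<open>linear A\<close>]
  proof (intro allI impI)
    fix y assume "A y = 0"
    then have 0: "\<forall>b\<in>B. red_trace E (y * star E (emb E b)) = 0" unfolding A_def by (rule coeff)
    have "linear (\<lambda>x. red_trace E (y * star E x))"
      by (rule linearI) (simp_all add: star_add star_scaleR distrib_left red_trace_add red_trace_scaleR)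
    then have "red_trace E (y * star E x) = 0" for x
      using linear_eq_0_on_span[of _ "emb E ` B" x] 0 sp by auto
    then show "y = 0" by (rule red_trace_norm(2))
  qed
  ultimately have "surj A" by (intro fd.linear_inj_imp_surj[folded linear_def])
  then obtain y where y: "A y = emb E b0" by (metis surjD)
  have "red_trace E (y * star E (emb E b)) = (if b = b0 then 1 else 0)" if "b \<in> B" for b
  proof -
    have "(\<Sum>b\<in>B. (red_trace E (y * star E (emb E b)) - (if b = b0 then 1 else 0)) *\<^sub>R emb E b) = 0"
      using y b0 B(2) by (simp add: A_def scaleR_left_diff_distrib sum_subtractf if_distrib[of "\<lambda>t. t *\<^sub>R _"] cong: if_cong)
    from coeff[OF this] that show ?thesis by auto
  qed
  then have dual: "red_trace E (y * star E (\<Sum>b\<in>B. c b *\<^sub>R emb E b)) = c b0" for c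
    using b0 B(2) by (simp add: star_sum star_scaleR sum_distrib_left red_trace_sum red_trace_scaleR
      if_distrib[of "\<lambda>t. _ * t"] cong: if_cong)
  show ?thesis
  proof (intro exI conjI allI)
    show "1 + red_trace E (y * star E y) > 0" using red_trace_norm(1)[of y] by linarith
    fix c
    let ?x = "\<Sum>b\<in>B. c b *\<^sub>R emb E b"
    have "(c b0)\<^sup>2 \<le> red_trace E (y * star E y) * red_trace E (?x * star E ?x)"
      using red_trace_Cauchy_Schwarz[of y ?x] by (simp only: dual)
    also have "\<dots> \<le> (1 + red_trace E (y * star E y)) * red_trace E (?x * star E ?x)"
      using red_trace_norm(1)[of ?x] by (intro mult_right_mono) auto
    finally show "(c b0)\<^sup>2 \<le> (1 + red_trace E (y * star E y)) * red_trace E (?x * star E ?x)" .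
  qed
qed

lemma real_coordinates:
  assumes B: "Q_basis scaleQ B" "finite B"
  obtains c where "x = (\<Sum>p\<in>UNIV \<times> B. c p *\<^sub>R axis (fst p) (emb E (snd p)))"
proof -
  have inj: "inj_on (emb E) B" and sp: "span (emb E ` B) = UNIV"
    using emb_basis[OF B(1)] by auto
  have "\<exists>u. x $ i = (\<Sum>b\<in>B. u b *\<^sub>R emb E b)" for i
  proof -
    have "x $ i \<in> span (emb E ` B)" using sp by simp
    then obtain u where "x $ i = (\<Sum>a\<in>emb E ` B. u a *\<^sub>R a)"
      using B(2) by (auto simp: span_finite)
    then show ?thesis by (intro exI[of _ "u \<circ> emb E"]) (simp add: sum.reindex[OF inj])
  qed
  then obtain u where u: "\<And>i. x $ i = (\<Sum>b\<in>B. u i b *\<^sub>R emb E b)" by metis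
  have "x = (\<Sum>i\<in>UNIV. \<Sum>b\<in>B. u i b *\<^sub>R axis i (emb E b))"
  proof -
    have "x = (\<Sum>i\<in>UNIV. axis i (x $ i))" by (simp add: vec_eq_iff axis_def)
    then show ?thesis
      by (simp add: u linear_sum[OF linear_axis] linear_scale[OF linear_axis])
  qed
  then show thesis using that[of "\<lambda>p. u (fst p) (snd p)"] by (simp add: sum.cartesian_product split_def)
qed

lemma finite_spanning_forms:
  assumes B: "Q_basis scaleQ B" "finite B"
  obtains D :: "('a^'n^'n) set" where "finite D" "span D = UNIV"
proof -
  have "finite (emb E ` B)" "span (emb E ` B) = UNIV" using emb_basis[OF B(1)] B(2) by auto
  then obtain D :: "('a^'n) set" where "finite D" "span D = UNIV" by (rule finite_span_vec)
  then obtain D' :: "('a^'n^'n) set" where "finite D'" "span D' = UNIV" by (rule finite_span_vec)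
  then show thesis by (rule that)
qed

end

section \<open>Admissible forms of a weighted lattice\<close>

locale weighted_lattice = real_ext scaleQ E + lattice_basis scaleQ B R L
  for scaleQ :: "rat \<Rightarrow> 'k::division_ring \<Rightarrow> 'k"
    and E :: "('k, 'a::real_algebra_1, 'h::finite, 'd::finite) real_extension"
    and B R and L :: "('k^'n) set" +
  fixes \<phi> :: "'k^'n \<Rightarrow> real"
  assumes weight: "is_weight L \<phi>"
begin

lemma Q_basis_B: "Q_basis scaleQ B"
  using indB spanB by (simp add: Q_basis_def)

lemma finite_index: "finite ((UNIV :: 'n set) \<times> B)"
  using finB by simp

text \<open>Rational linearity is not among the axioms of the extension; additivity gives it after
  clearing the denominator.\<close>

lemma emb_scaleQ: "emb E (scaleQ q x) = of_rat q *\<^sub>R emb E x"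
proof -
  obtain a b where q: "quotient_of q = (a, b)" by (cases "quotient_of q")
  have b: "b > 0" and qab: "q = of_int a / of_int b"
    using quotient_of_denom_pos[OF q] quotient_of_div[OF q] by auto
  have "of_int b * scaleQ q x = of_int a * x"
    using b by (simp add: qab flip: scaleQ_of_int)
  then have "real_of_int b *\<^sub>R emb E (scaleQ q x) = real_of_int a *\<^sub>R emb E x"
    by (simp flip: emb_of_int)
  also have "\<dots> = real_of_int b *\<^sub>R (of_rat q *\<^sub>R emb E x)"
    using b by (simp add: qab of_rat_divide)
  finally show ?thesis by (rule scaleR_left_imp_eq[rotated]) (use b in simp)
qed

abbreviation real_basis :: "'n \<times> 'k \<Rightarrow> 'a^'n" where
  "real_basis p \<equiv> axis (fst p) (emb E (snd p))"

abbreviation real_vec :: "('n \<times> 'k \<Rightarrow> real) \<Rightarrow> 'a^'n" where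
  "real_vec c \<equiv> (\<Sum>p\<in>UNIV \<times> B. c p *\<^sub>R real_basis p)"

lemma emb_vec_axis: "emb_vec v = (\<Sum>i\<in>UNIV. axis i (emb E (v $ i)))"
  by (simp add: emb_vec_def vec_eq_iff axis_def)

lemma emb_vec_real_vec: "emb_vec v = real_vec (\<lambda>p. of_rat (co (v $ fst p) (snd p)))"
proof -
  have e: "emb E x = (\<Sum>b\<in>B. of_rat (co x b) *\<^sub>R emb E b)" for x
    using arg_cong[OF co_expand[of x], of "emb E"] by (simp add: emb_sum emb_scaleQ)
  have ax: "axis i (emb E x) = (\<Sum>b\<in>B. of_rat (co x b) *\<^sub>R axis i (emb E b))" for i :: 'n and x
    by (subst e) (simp add: linear_sum[OF linear_axis] linear_scale[OF linear_axis])
  have "emb_vec v = (\<Sum>i\<in>UNIV. \<Sum>b\<in>B. of_rat (co (v $ i) b) *\<^sub>R axis i (emb E b))"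
    unfolding emb_vec_axis by (rule sum.cong[OF refl ax])
  then show ?thesis by (simp add: sum.cartesian_product split_def)
qed

text \<open>Points with integer coordinates in \<open>B\<close>: a free lattice to which the
  approximation argument applies directly, linked to \<open>L\<close> by a common multiple.\<close>

definition int_vec :: "('n \<times> 'k \<Rightarrow> int) \<Rightarrow> 'k^'n" where
  "int_vec z = (\<chi> i. \<Sum>b\<in>B. of_int (z (i, b)) * b)"

lemma co_int_vec: "b \<in> B \<Longrightarrow> co (int_vec z $ i) b = of_int (z (i, b))"
  using co_basis_sum[of b "\<lambda>b. of_int (z (i, b))"] by (simp add: int_vec_def scaleQ_of_int)

lemma emb_int_vec: "emb_vec (int_vec z) = real_vec (\<lambda>p. of_int (z p))"
  unfolding emb_vec_real_vec by (intro sum.cong refl) (auto simp: co_int_vec)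

lemma int_vec_nonzero: "\<exists>p\<in>UNIV \<times> B. z p \<noteq> 0 \<Longrightarrow> int_vec z \<noteq> 0"
  using co_int_vec[of _ z] by (auto simp: co_0)

lemma int_vec_multiple:
  obtains D where "D > 0" "\<And>z. rscale (int_vec z) (of_nat D) \<in> L"
proof -
  have "\<exists>m>0. \<forall>p\<in>UNIV \<times> B. rscale (axis (fst p) (snd p)) (of_nat m) \<in> L"
  proof (rule common_multiple_exists[OF finite_index multiple_in_L])
    fix p :: "'n \<times> 'k" and m n
    assume "rscale (axis (fst p) (snd p)) (of_nat m) \<in> L"
    from scale_L[OF this of_nat_R[of n]]
    show "rscale (axis (fst p) (snd p)) (of_nat (m * n)) \<in> L" by (simp add: rscale_rscale)
  qed
  then obtain D where D: "D > 0" "\<And>p. p \<in> UNIV \<times> B \<Longrightarrow> rscale (axis (fst p) (snd p)) (of_nat D) \<in> L"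
    by blast
  have "rscale (int_vec z) (of_nat D) =
      (\<Sum>p\<in>UNIV \<times> B. rscale (rscale (axis (fst p) (snd p)) (of_nat D)) (of_int (z p)))" for z
  proof -
    have "int_vec z = (\<Sum>i\<in>UNIV. \<Sum>b\<in>B. rscale (axis i b) (of_int (z (i, b))))"
    proof -
      have "(\<Sum>i\<in>UNIV. \<Sum>b\<in>B. axis i b $ k * of_int (z (i, b))) = (\<Sum>b\<in>B. of_int (z (k, b)) * b)" for k
      proof -
        have "(\<Sum>b\<in>B. axis i b $ k * of_int (z (i, b))) = (if i = k then \<Sum>b\<in>B. of_int (z (k, b)) * b else 0)" for i
          by (simp add: axis_def mult_of_int_commute)
        then show ?thesis by simp
      qed
      then show ?thesis by (simp add: int_vec_def vec_eq_iff)
    qed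
    then show ?thesis
      by (simp add: rscale_sum rscale_rscale sum.cartesian_product split_def mult_of_nat_commute)
  qed
  moreover have "of_int k \<in> R" for k
    using of_nat_R minus_R by (cases k) (auto simp del: of_nat_Suc)
  ultimately have "rscale (int_vec z) (of_nat D) \<in> L" for z
    by (simp only:) (intro sum_L scale_L[OF D(2)])
  then show thesis using that D(1) by blast
qed

text \<open>Multiplying by \<open>D\<close> brings integral points into \<open>L\<close> and scales
  the form by \<open>D\<^sup>2\<close>; this gives the lower bound on them that
  \<open>lattice_positive_bound\<close> wants.\<close>

lemma form_bound:
  assumes F: "F \<in> Sym E" and eps: "\<epsilon> > 0" and low: "\<And>l. l \<in> L - {0} \<Longrightarrow> \<epsilon> \<le> form_val E F l"
  shows "\<exists>\<delta>>0. \<forall>c. \<delta> * (\<Sum>p\<in>UNIV \<times> B. \<bar>c p\<bar>)\<^sup>2 \<le> bform F (real_vec c) (real_vec c)"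
proof -
  obtain D where D: "D > 0" "\<And>z. rscale (int_vec z) (of_nat D) \<in> L" by (rule int_vec_multiple) blast
  show ?thesis
  proof (rule lattice_positive_bound[OF finite_index linear_bform_left linear_bform_right bform_sym[OF F]])
    show "\<epsilon> / (real D)\<^sup>2 > 0" using eps D(1) by simp
    fix z :: "'n \<times> 'k \<Rightarrow> int"
    assume "\<exists>p\<in>UNIV \<times> B. z p \<noteq> 0"
    then have "int_vec z \<noteq> 0" by (rule int_vec_nonzero)
    then have "rscale (int_vec z) (of_nat D) \<noteq> 0" using of_nat_nonzero[OF D(1)] by (auto simp: vec_eq_iff)
    then have "\<epsilon> \<le> (real D)\<^sup>2 * form_val E F (int_vec z)"
      using low[of "rscale (int_vec z) (of_nat D)"] D(2) by (simp add: form_val_rscale_nat)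
    then show "\<epsilon> / (real D)\<^sup>2 \<le> bform F (real_vec (\<lambda>p. of_int (z p))) (real_vec (\<lambda>p. of_int (z p)))"
      using D(1) by (simp add: form_val_eq emb_int_vec divide_le_eq mult.commute)
  qed
qed

definition csum :: "'k^'n \<Rightarrow> real" where
  "csum v = (\<Sum>p\<in>UNIV \<times> B. \<bar>of_rat (co (v $ fst p) (snd p))\<bar>)"

lemma finite_csum: "finite {l \<in> L. csum l \<le> a}"
proof (rule finite_subset)
  define a' :: rat where "a' = of_int \<lceil>a\<rceil>"
  \<comment> \<open>\<open>mat 1\<close> merely brings the coordinate into the shape of
    \<open>coordinate_discrete\<close>; every entry of \<open>l\<close> has \<open>nrm\<close> at
    most \<open>csum l\<close>.\<close>
  define Y where "Y = (\<Union>i. {y \<in> (\<lambda>x. (mat 1 *v x) $ i) ` L. nrm y \<le> a'})"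
  show "finite {x :: 'k^'n. \<forall>i. x $ i \<in> Y}"
    unfolding Y_def by (intro finite_vectors finite_UN_I coordinate_discrete) simp
  show "{l \<in> L. csum l \<le> a} \<subseteq> {x. \<forall>i. x $ i \<in> Y}"
  proof (clarify)
    fix l i assume l: "l \<in> L" "csum l \<le> a"
    have "real_of_rat (nrm (l $ i)) = (\<Sum>p\<in>{i} \<times> B. \<bar>of_rat (co (l $ fst p) (snd p))\<bar>)"
      by (simp add: nrm_def of_rat_sum abs_of_rat sum.cartesian_product' flip: sum.cartesian_product)
    also have "\<dots> \<le> csum l"
      unfolding csum_def by (rule sum_mono2[OF finite_index]) auto
    also have "\<dots> \<le> a" by (rule l)
    also have "\<dots> \<le> of_rat a'" by (simp add: a'_def)
    finally have "nrm (l $ i) \<le> a'" by (simp add: of_rat_less_eq)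
    then show "l $ i \<in> Y" using l(1) by (auto simp: Y_def)
  qed
qed

lemma weight_pos: "v \<noteq> 0 \<Longrightarrow> 0 < \<phi> v" and weight_le_1: "v \<noteq> 0 \<Longrightarrow> \<phi> v \<le> 1"
  using weight by (auto simp: is_weight_def)

lemma weight_bound: obtains c0 where "c0 > 0" "\<And>v. v \<noteq> 0 \<Longrightarrow> c0 \<le> \<phi> v"
proof
  let ?c = "Min (insert 1 (\<phi> ` (- {0})))"
  show "?c > 0" using weight_finite[OF weight] weight_pos by (subst Min_gr_iff) auto
  show "?c \<le> \<phi> v" if "v \<noteq> 0" for v using weight_finite[OF weight] that by (intro Min_le) auto
qed

text \<open>Outside the finitely many vectors with \<open>csum\<close> at most the number of
  coordinates, some coordinate exceeds 1 in absolute value, and \<open>coordinate_bound\<close>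
  controls each coordinate by the trace norm.\<close>

lemma sqnorm_bound: obtains \<epsilon> where "\<epsilon> > 0" "\<And>l. l \<in> L - {0} \<Longrightarrow> \<epsilon> \<le> sqnorm (emb_vec l)"
proof -
  have "\<forall>b0\<in>B. \<exists>K>0. \<forall>c. (c b0)\<^sup>2 \<le> K * red_trace E ((\<Sum>b\<in>B. c b *\<^sub>R emb E b) * star E (\<Sum>b\<in>B. c b *\<^sub>R emb E b))"
    using coordinate_bound[OF Q_basis_B finB] by blast
  then obtain K where K: "\<And>b. b \<in> B \<Longrightarrow> K b > 0"
    "\<And>b0 c. b0 \<in> B \<Longrightarrow> (c b0)\<^sup>2 \<le> K b0 * red_trace E ((\<Sum>b\<in>B. c b *\<^sub>R emb E b) * star E (\<Sum>b\<in>B. c b *\<^sub>R emb E b))"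
    by metis
  define \<delta> where "\<delta> = Min (insert 1 ((\<lambda>b. 1 / K b) ` B))"
  have \<delta>: "\<delta> > 0" using finB K(1) unfolding \<delta>_def by (subst Min_gr_iff) auto
  have bound: "\<delta> * (of_rat (co (v $ i) b))\<^sup>2 \<le> sqnorm (emb_vec v)" if b: "b \<in> B" for v i b
  proof -
    have e: "emb E (v $ i) = (\<Sum>b\<in>B. of_rat (co (v $ i) b) *\<^sub>R emb E b)"
      using arg_cong[OF co_expand[of "v $ i"], of "emb E"] by (simp add: emb_sum emb_scaleQ)
    have "(of_rat (co (v $ i) b))\<^sup>2 \<le> K b * red_trace E (emb E (v $ i) * star E (emb E (v $ i)))"
      unfolding e using K(2)[OF b, of "\<lambda>b. of_rat (co (v $ i) b)"] .
    then have "1 / K b * (of_rat (co (v $ i) b))\<^sup>2 \<le> red_trace E (emb E (v $ i) * star E (emb E (v $ i)))"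
      using K(1)[OF b] by (simp add: field_simps)
    moreover have "\<delta> * (of_rat (co (v $ i) b))\<^sup>2 \<le> 1 / K b * (of_rat (co (v $ i) b))\<^sup>2"
      unfolding \<delta>_def using finB b by (intro mult_right_mono Min_le) auto
    moreover have "red_trace E (emb_vec v $ i * star E (emb_vec v $ i)) \<le> sqnorm (emb_vec v)"
      unfolding sqnorm_def by (intro member_le_sum red_trace_norm) auto
    ultimately show ?thesis by (simp add: emb_vec_def)
  qed
  define m where "m = real (card ((UNIV :: 'n set) \<times> B))"
  define Z where "Z = {l \<in> L. csum l \<le> m} - {0}"
  define \<epsilon> where "\<epsilon> = Min (insert \<delta> ((\<lambda>l. sqnorm (emb_vec l)) ` Z))"
  have "finite Z" unfolding Z_def using finite_csum by simp
  have pos: "sqnorm (emb_vec l) > 0" if "l \<noteq> 0" for l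
    using that sqnorm_nonneg[of "emb_vec l"] sqnorm_0D[of "emb_vec l"] emb_vec_inj[of l] by (auto simp: less_le)
  have "\<epsilon> > 0" unfolding \<epsilon>_def using \<open>finite Z\<close> \<delta> pos by (subst Min_gr_iff) (auto simp: Z_def)
  moreover have "\<epsilon> \<le> sqnorm (emb_vec l)" if l: "l \<in> L - {0}" for l
  proof (cases "csum l \<le> m")
    case True
    then show ?thesis unfolding \<epsilon>_def using \<open>finite Z\<close> l by (intro Min_le) (auto simp: Z_def)
  next
    case False
    have "\<exists>p\<in>UNIV \<times> B. 1 < \<bar>real_of_rat (co (l $ fst p) (snd p))\<bar>"
    proof (rule ccontr)
      assume "\<not> ?thesis"
      then have "csum l \<le> (\<Sum>p\<in>(UNIV :: 'n set) \<times> B. 1)" unfolding csum_def by (intro sum_mono) (auto simp: not_less)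
      then show False using False by (simp add: m_def)
    qed
    then obtain p where p: "snd p \<in> B" "1 < \<bar>real_of_rat (co (l $ fst p) (snd p))\<bar>" by auto
    have "1 \<le> (real_of_rat (co (l $ fst p) (snd p)))\<^sup>2" using p(2) by (metis abs_le_square_iff abs_1 less_imp_le one_power2)
    then have "\<delta> \<le> \<delta> * (real_of_rat (co (l $ fst p) (snd p)))\<^sup>2" using \<delta> by simp
    also have "\<dots> \<le> sqnorm (emb_vec l)" using bound[OF p(1)] .
    moreover have "\<epsilon> \<le> \<delta>" unfolding \<epsilon>_def using \<open>finite Z\<close> by (intro Min_le) auto
    ultimately show ?thesis by linarith
  qed
  ultimately show thesis using that by blast
qed

end

section \<open>Positivity, finiteness and domination for admissible forms\<close>

context weighted_lattice
begin

definition admissible :: "('k^'n^'n) set \<Rightarrow> 'a^'n^'n \<Rightarrow> bool" where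
  "admissible G F \<longleftrightarrow> F \<in> invariant_forms E G \<and> (\<forall>l\<in>L - {0}. 1 \<le> \<phi> l * form_val E F l)"

lemma admissible_Sym: "admissible G F \<Longrightarrow> F \<in> Sym E"
  by (simp add: admissible_def invariant_forms_def)

lemma admissible_form_val:
  assumes "admissible G F" "l \<in> L - {0}"
  shows "1 \<le> form_val E F l"
proof -
  have 1: "1 \<le> \<phi> l * form_val E F l" and \<phi>: "0 < \<phi> l" "\<phi> l \<le> 1"
    using assms weight_pos weight_le_1 by (auto simp: admissible_def)
  then have "0 < form_val E F l" by (metis less_le_trans zero_less_one zero_less_mult_pos)
  then have "\<phi> l * form_val E F l \<le> 1 * form_val E F l" using \<phi> by (intro mult_right_mono) auto
  then show ?thesis using 1 by simp
qed

lemma admissible_bound: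
  assumes "admissible G F"
  obtains \<delta> where "\<delta> > 0" "\<And>c. \<delta> * (\<Sum>p\<in>UNIV \<times> B. \<bar>c p\<bar>)\<^sup>2 \<le> bform F (real_vec c) (real_vec c)"
  using form_bound[OF admissible_Sym[OF assms] zero_less_one admissible_form_val[OF assms]] by blast

lemma admissible_pos_cone:
  assumes "admissible G F"
  shows "F \<in> pos_cone E"
proof (rule pos_coneI[OF admissible_Sym[OF assms]])
  fix x :: "'a^'n" assume x: "x \<noteq> 0"
  obtain \<delta> where \<delta>: "\<delta> > 0" "\<And>c. \<delta> * (\<Sum>p\<in>UNIV \<times> B. \<bar>c p\<bar>)\<^sup>2 \<le> bform F (real_vec c) (real_vec c)"
    by (rule admissible_bound[OF assms]) blast
  obtain c where c: "x = real_vec c" using real_coordinates[OF Q_basis_B finB] by blast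
  have "(\<Sum>p\<in>UNIV \<times> B. \<bar>c p\<bar>) \<noteq> 0"
  proof
    assume "(\<Sum>p\<in>UNIV \<times> B. \<bar>c p\<bar>) = 0"
    then have "\<forall>p\<in>UNIV \<times> B. \<bar>c p\<bar> = 0" using finB by (subst (asm) sum_nonneg_eq_0_iff) auto
    then have "x = 0" unfolding c by (intro sum.neutral) auto
    then show False using x by simp
  qed
  then have "0 < \<delta> * (\<Sum>p\<in>UNIV \<times> B. \<bar>c p\<bar>)\<^sup>2" using \<delta>(1) by simp
  also have "\<dots> \<le> bform F x x" unfolding c by (rule \<delta>(2))
  finally show "0 < bform F x x" .
qed

lemma admissible_finite:
  assumes "admissible G F"
  shows "finite {l \<in> L - {0}. \<phi> l * form_val E F l \<le> a}"
proof -
  obtain \<delta> where \<delta>: "\<delta> > 0" "\<And>c. \<delta> * (\<Sum>p\<in>UNIV \<times> B. \<bar>c p\<bar>)\<^sup>2 \<le> bform F (real_vec c) (real_vec c)"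
    by (rule admissible_bound[OF assms]) blast
  obtain c0 where c0: "c0 > 0" "\<And>v. v \<noteq> 0 \<Longrightarrow> c0 \<le> \<phi> v" by (rule weight_bound) blast
  define b where "b = a / (c0 * \<delta>)"
  have "csum l \<le> max 1 b" if l: "l \<in> L - {0}" "\<phi> l * form_val E F l \<le> a" for l
  proof -
    have "0 \<le> form_val E F l" using admissible_form_val[OF assms l(1)] by simp
    then have "c0 * form_val E F l \<le> a" using c0(2)[of l] l by (auto intro: order_trans[OF mult_right_mono])
    moreover have "c0 * (\<delta> * (csum l)\<^sup>2) \<le> c0 * form_val E F l"
      unfolding form_val_eq csum_def emb_vec_real_vec using c0(1) by (intro mult_left_mono \<delta>(2)) simp
    ultimately have "c0 * (\<delta> * (csum l)\<^sup>2) \<le> a" by linarith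
    then have "(csum l)\<^sup>2 \<le> b" using c0(1) \<delta>(1) by (simp add: b_def pos_le_divide_eq mult_ac)
    show ?thesis
    proof (cases "csum l \<le> 1")
      case False
      \<comment> \<open>Above 1 a number is at most its square; this avoids a square root and
        explains the bound \<open>max 1 b\<close>.\<close>
      then have "csum l \<le> (csum l)\<^sup>2" by (simp add: power2_eq_square)
      then show ?thesis using \<open>(csum l)\<^sup>2 \<le> b\<close> by simp
    qed simp
  qed
  then have "{l \<in> L - {0}. \<phi> l * form_val E F l \<le> a} \<subseteq> {l \<in> L. csum l \<le> max 1 b}" by auto
  then show ?thesis using finite_csum by (rule finite_subset)
qed

text \<open>Both forms are compared with the square of \<open>csum\<close>, \<open>H\<close> from
  above by \<open>K\<close> and \<open>F\<close> from below by \<open>\<delta>\<close>; the weight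
  is a common factor.\<close>

lemma admissible_dominates:
  assumes "admissible G F"
  shows "\<exists>c>0. \<forall>l\<in>L - {0}. \<bar>\<phi> l * form_val E H l\<bar> \<le> c * (\<phi> l * form_val E F l)"
proof -
  obtain \<delta> where \<delta>: "\<delta> > 0" "\<And>c. \<delta> * (\<Sum>p\<in>UNIV \<times> B. \<bar>c p\<bar>)\<^sup>2 \<le> bform F (real_vec c) (real_vec c)"
    by (rule admissible_bound[OF assms]) blast
  obtain K where K: "K > 0" "\<And>c d. \<bar>bform H (real_vec c) (real_vec d)\<bar>
      \<le> K * (\<Sum>p\<in>UNIV \<times> B. \<bar>c p\<bar>) * (\<Sum>p\<in>UNIV \<times> B. \<bar>d p\<bar>)"
    by (rule bilinear_coord_bound[of "UNIV \<times> B" "bform H" real_basis, OF finite_index linear_bform_left linear_bform_right]) blast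
  have "\<bar>\<phi> l * form_val E H l\<bar> \<le> K / \<delta> * (\<phi> l * form_val E F l)" if "l \<in> L - {0}" for l
  proof -
    have "\<bar>form_val E H l\<bar> \<le> K * (csum l)\<^sup>2"
      unfolding form_val_eq csum_def emb_vec_real_vec power2_eq_square mult.assoc[symmetric] by (rule K(2))
    also have "\<dots> = K / \<delta> * (\<delta> * (csum l)\<^sup>2)" using \<delta>(1) by simp
    also have "\<dots> \<le> K / \<delta> * form_val E F l"
      unfolding form_val_eq csum_def emb_vec_real_vec using \<delta>(1) K(1) by (intro mult_left_mono \<delta>(2)) simp
    finally have "\<phi> l * \<bar>form_val E H l\<bar> \<le> \<phi> l * (K / \<delta> * form_val E F l)"
      using weight_pos[of l] that by (intro mult_left_mono) auto
    then show ?thesis using weight_pos[of l] that by (simp add: abs_mult mult_ac)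
  qed
  then show ?thesis using K(1) \<delta>(1) by (intro exI[of _ "K / \<delta>"]) auto
qed

text \<open>Homogeneity carries the vanishing from \<open>L\<close> to the integral points. At two
  basis vectors and their sum it gives, by polarisation, the vanishing of the bilinear form.\<close>

lemma form_zeroI:
  assumes H: "H \<in> Sym E" and zero: "\<And>l. l \<in> L - {0} \<Longrightarrow> form_val E H l = 0"
  shows "H = 0"
proof (rule bform_zeroD)
  obtain D where D: "D > 0" "\<And>z. rscale (int_vec z) (of_nat D) \<in> L" by (rule int_vec_multiple) blast
  have zeroL: "form_val E H l = 0" if "l \<in> L" for l using zero[of l] that by (cases "l = 0") auto
  have int0: "bform H (real_vec (\<lambda>p. of_int (z p))) (real_vec (\<lambda>p. of_int (z p))) = 0" for z
  proof -
    have "form_val E H (int_vec z) = 0"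
      using zeroL[OF D(2)[of z]] D(1) by (simp add: form_val_rscale_nat)
    then show ?thesis by (simp only: form_val_eq emb_int_vec)
  qed
  have one: "real_vec (\<lambda>q. of_int (if q = p then 1 else 0)) = real_basis p" if "p \<in> UNIV \<times> B" for p
  proof -
    have "real_of_int (if q = p then 1 else 0) *\<^sub>R real_basis q = (if q = p then real_basis p else 0)" for q
      by simp
    then show ?thesis using that finite_index by (simp only: sum.delta if_True)
  qed
  have diag: "bform H (real_basis p) (real_basis p) = 0" if "p \<in> UNIV \<times> B" for p
    using int0[of "\<lambda>q. if q = p then 1 else 0"] unfolding one[OF that] .
  have "bform H (real_basis p) (real_basis r) = 0" if p: "p \<in> UNIV \<times> B" and r: "r \<in> UNIV \<times> B" for p r
  proof -
    have "real_vec (\<lambda>q. of_int ((if q = p then 1 else 0) + (if q = r then 1 else 0))) = real_basis p + real_basis r"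
      unfolding of_int_add scaleR_add_left sum.distrib one[OF p] one[OF r] ..
    then have "bform H (real_basis p + real_basis r) (real_basis p + real_basis r) = 0"
      using int0[of "\<lambda>q. (if q = p then 1 else 0) + (if q = r then 1 else 0)"] by (simp only:)
    then show ?thesis
      using diag[OF p] diag[OF r] bform_sym[OF H, of "real_basis r" "real_basis p"]
      by (simp add: linear_add[OF linear_bform_left] linear_add[OF linear_bform_right])
  qed
  then have 0: "bform H (real_vec c) (real_vec d) = 0" for c d
    unfolding bilinear_expand[of "bform H", OF linear_bform_left linear_bform_right]
    by (intro sum.neutral ballI) simp
  fix x y :: "'a^'n"
  obtain c where "x = real_vec c" by (rule real_coordinates[OF Q_basis_B finB])
  moreover obtain d where "y = real_vec d" by (rule real_coordinates[OF Q_basis_B finB])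
  ultimately show "bform H x y = 0" by (simp only: 0)
qed

text \<open>\<open>L\<close> contains a \<open>K\<close>-basis, and \<open>g\<close> hits every
  element of \<open>L\<close>. Surjectivity later permits cancelling \<open>g\<close> on the
  right.\<close>

lemma GL_surj:
  assumes "g \<in> carrier (GL L)"
  shows "\<exists>w. g *v w = v"
proof -
  have gL: "(\<lambda>v. g *v v) ` L = L" using assms by (simp add: GL_def)
  obtain S where S: "S \<subseteq> L" "right_basis S" by (rule lattice_right_basis)
  obtain c where v: "v = (\<Sum>b\<in>S. rscale b (c b))" using S(2) unfolding right_basis_def by blast
  have "\<forall>b\<in>S. \<exists>w. g *v w = b" using S(1) gL by (metis image_iff subsetD)
  then obtain w where w: "\<forall>b\<in>S. g *v w b = b" by metis
  have "g *v (\<Sum>b\<in>S. rscale (w b) (c b)) = v"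
    unfolding v mult_vec_sum mult_rscale using w by (intro sum.cong) auto
  then show ?thesis by blast
qed

lemma right_mult_bij:
  assumes A: "A \<subseteq> carrier (GL L)" "finite A" "\<And>g h. g \<in> A \<Longrightarrow> h \<in> A \<Longrightarrow> g ** h \<in> A" and g: "g \<in> A"
  shows "bij_betw (\<lambda>h. h ** g) A A"
proof -
  have "inj_on (\<lambda>h. h ** g) A"
  proof (rule inj_onI)
    fix h h' assume "h ** g = h' ** g"
    then have "h *v (g *v w) = h' *v (g *v w)" for w by (simp add: matrix_vector_mul_assoc)
    then have "h *v v = h' *v v" for v using GL_surj[of g v] A(1) g by blast
    then show "h = h'" by (simp add: matrix_eq)
  qed
  moreover have "(\<lambda>h. h ** g) ` A \<subseteq> A" using A(3) g by auto
  ultimately show ?thesis using endo_inj_surj[OF A(2)] by (simp add: bij_betw_def)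
qed

text \<open>\<open>GL L\<close> is only known to be a monoid here; inverses come from finiteness.\<close>

lemma finite_submonoid_subgroup:
  assumes A: "A \<subseteq> carrier (GL L)" "finite A" "\<And>g h. g \<in> A \<Longrightarrow> h \<in> A \<Longrightarrow> g ** h \<in> A" and one: "mat 1 \<in> A"
  shows "subgroup A (GL L)"
proof
  show "A \<subseteq> carrier (GL L)" by (rule A)
  show "x \<otimes>\<^bsub>GL L\<^esub> y \<in> A" if "x \<in> A" "y \<in> A" for x y using A(3) that by (simp add: GL_def)
  show "\<one>\<^bsub>GL L\<^esub> \<in> A" using one by (simp add: GL_def)
  have left: "\<exists>h\<in>A. h ** g = mat 1" if "g \<in> A" for g
    using right_mult_bij[OF A that] one unfolding bij_betw_def by (metis imageE)
  fix g assume g: "g \<in> A"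
  obtain h where h: "h \<in> A" "h ** g = mat 1" using left[OF g] by blast
  obtain h' where h': "h' \<in> A" "h' ** h = mat 1" using left[OF h(1)] by blast
  have "h' = g" by (metis h(2) h'(2) matrix_mul_assoc matrix_mul_lid matrix_mul_rid)
  then have gh: "g ** h = mat 1" using h' by simp
  have "inv\<^bsub>GL L\<^esub> g = h"
    unfolding m_inv_def
  proof (rule the_equality)
    show "h \<in> carrier (GL L) \<and> g \<otimes>\<^bsub>GL L\<^esub> h = \<one>\<^bsub>GL L\<^esub> \<and> h \<otimes>\<^bsub>GL L\<^esub> g = \<one>\<^bsub>GL L\<^esub>"
      using A(1) h gh by (auto simp: GL_def)
    fix y assume "y \<in> carrier (GL L) \<and> g \<otimes>\<^bsub>GL L\<^esub> y = \<one>\<^bsub>GL L\<^esub> \<and> y \<otimes>\<^bsub>GL L\<^esub> g = \<one>\<^bsub>GL L\<^esub>"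
    then have "g ** y = mat 1" by (simp add: GL_def)
    then show "y = h" by (metis h(2) matrix_mul_assoc matrix_mul_lid matrix_mul_rid)
  qed
  then show "inv\<^bsub>GL L\<^esub> g \<in> A" using h by simp
qed

section \<open>Perfect invariant forms and their minimal classes\<close>

lemma perfect_form_exists:
  assumes G: "subgroup G (GL L)" "finite G"
  obtains F where "admissible G F"
    "\<And>H. H \<in> invariant_forms E G \<Longrightarrow> (\<And>l. l \<in> L - {0} \<Longrightarrow> \<phi> l * form_val E F l = 1 \<Longrightarrow> form_val E H l = 0) \<Longrightarrow> H = 0"
proof -
  have sub: "G \<subseteq> carrier (GL L)" by (rule subgroup.subset[OF G(1)])
  have mult: "g ** h \<in> G" if "g \<in> G" "h \<in> G" for g h
    using subgroup.m_closed[OF G(1) that] by (simp add: GL_def)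
  have one: "mat 1 \<in> G" using subgroup.one_closed[OF G(1)] by (simp add: GL_def)
  obtain c0 where c0: "c0 > 0" "\<And>v. v \<noteq> 0 \<Longrightarrow> c0 \<le> \<phi> v" by (rule weight_bound) blast
  obtain \<epsilon> where \<epsilon>: "\<epsilon> > 0" "\<And>l. l \<in> L - {0} \<Longrightarrow> \<epsilon> \<le> sqnorm (emb_vec l)" by (rule sqnorm_bound) blast
  \<comment> \<open>The identity alone contributes at least \<open>\<epsilon>\<close> to the
    average, and the weight is at least \<open>c0\<close>, so this factor lifts all weighted values
    to 1 or more.\<close>
  define F0 where "F0 = (1 / (c0 * \<epsilon>)) *\<^sub>R averaged_form G (mat 1)"
  have inv0: "averaged_form G (mat 1) \<in> invariant_forms E G"
    by (intro averaged_form_invariant right_mult_bij sub G mult)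
  have F0: "admissible G F0"
    unfolding admissible_def
  proof (intro conjI ballI)
    show "F0 \<in> invariant_forms E G"
      unfolding F0_def using subspace_invariant_forms inv0 by (rule Real_Vector_Spaces.subspace_scale)
    fix l assume l: "l \<in> L - {0}"
    have "\<epsilon> \<le> sqnorm (emb_vec (mat 1 *v (mat 1 *v l)))" using \<epsilon>(2)[OF l] by simp
    also have "\<dots> \<le> form_val E (averaged_form G (mat 1)) l"
      unfolding averaged_form_val using one G(2)
      by (intro member_le_sum[where f = "\<lambda>g. sqnorm (emb_vec (mat 1 *v (g *v l)))"] sqnorm_nonneg) auto
    finally have le: "\<epsilon> \<le> form_val E (averaged_form G (mat 1)) l" .
    have "c0 * \<epsilon> \<le> \<phi> l * form_val E (averaged_form G (mat 1)) l"
      using c0 \<epsilon>(1) le l by (intro mult_mono) (auto intro: order_trans[OF less_imp_le])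
    then have "1 \<le> \<phi> l * form_val E (averaged_form G (mat 1)) l / (c0 * \<epsilon>)"
      using c0(1) \<epsilon>(1) by simp
    then show "1 \<le> \<phi> l * form_val E F0 l"
      by (simp add: F0_def linear_scale[OF linear_form_val])
  qed
  obtain D :: "('a^'n^'n) set" where D: "finite D" "Real_Vector_Spaces.span D = UNIV"
    by (rule finite_spanning_forms[OF Q_basis_B finB])
  have lin: "linear (\<lambda>F. \<phi> l * form_val E F l)" for l
    by (rule linearI) (simp_all add: linear_add[OF linear_form_val] linear_scale[OF linear_form_val] distrib_left)
  obtain F where F: "F \<in> invariant_forms E G" "\<And>l. l \<in> L - {0} \<Longrightarrow> 1 \<le> \<phi> l * form_val E F l"
    "\<And>H. H \<in> invariant_forms E G \<Longrightarrow>
      (\<And>l. l \<in> L - {0} \<Longrightarrow> \<phi> l * form_val E F l = 1 \<Longrightarrow> \<phi> l * form_val E H l = 0) \<Longrightarrow> H = 0"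
  proof (rule perfect_point_exists[of "L - {0}" "\<lambda>l F. \<phi> l * form_val E F l" "invariant_forms E G" D F0,
        OF lin subspace_invariant_forms D])
    show "F0 \<in> invariant_forms E G" "\<And>l. l \<in> L - {0} \<Longrightarrow> 1 \<le> \<phi> l * form_val E F0 l"
      using F0 by (auto simp: admissible_def)
    show "finite {l \<in> L - {0}. \<phi> l * form_val E F l \<le> 2}"
      if "F \<in> invariant_forms E G" "\<And>l. l \<in> L - {0} \<Longrightarrow> 1 \<le> \<phi> l * form_val E F l" for F
      using that by (intro admissible_finite) (simp add: admissible_def)
    show "\<exists>c>0. \<forall>l\<in>L - {0}. \<bar>\<phi> l * form_val E H l\<bar> \<le> c * (\<phi> l * form_val E F l)"
      if "F \<in> invariant_forms E G" "\<And>l. l \<in> L - {0} \<Longrightarrow> 1 \<le> \<phi> l * form_val E F l" for F H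
      using that by (intro admissible_dominates) (simp add: admissible_def)
    show "H = 0" if "H \<in> invariant_forms E G" "\<And>l. l \<in> L - {0} \<Longrightarrow> \<phi> l * form_val E H l = 0" for H
    proof (rule form_zeroI)
      show "H \<in> Sym E" using that(1) by (simp add: invariant_forms_def)
      show "form_val E H l = 0" if l: "l \<in> L - {0}" for l
        using \<open>\<And>l. l \<in> L - {0} \<Longrightarrow> \<phi> l * form_val E H l = 0\<close>[OF l] weight_pos[of l] l by auto
    qed
  qed blast
  show thesis
  proof (rule that[of F])
    show "admissible G F" using F by (simp add: admissible_def)
    show "H = 0" if "H \<in> invariant_forms E G"
      "\<And>l. l \<in> L - {0} \<Longrightarrow> \<phi> l * form_val E F l = 1 \<Longrightarrow> form_val E H l = 0" for H
      using F(3)[OF that(1)] that(2) by simp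
  qed
qed

lemma maximal_finite_subgroup_perfect_class:
  assumes G: "maximal_finite_subgroup G (GL L)"
  obtains F where "F \<in> pos_cone E" "F \<in> invariant_forms E G" "F \<noteq> 0"
    "\<exists>S\<subseteq>min_vecs E L \<phi> F. right_basis S"
    "G = {g \<in> carrier (GL L). (\<lambda>v. g *v v) ` min_vecs E L \<phi> F = min_vecs E L \<phi> F}"
    "\<And>F'. F' \<in> min_class E L \<phi> F \<Longrightarrow> F' \<in> invariant_forms E G \<Longrightarrow> \<exists>c. F' = c *\<^sub>R F"
proof -
  have sg: "subgroup G (GL L)" "finite G"
    and maxG: "\<And>H. subgroup H (GL L) \<Longrightarrow> finite H \<Longrightarrow> G \<subseteq> H \<Longrightarrow> H = G"
    using G by (auto simp: maximal_finite_subgroup_def)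
  have sub: "G \<subseteq> carrier (GL L)" by (rule subgroup.subset[OF sg(1)])
  have mult: "g ** h \<in> G" if "g \<in> G" "h \<in> G" for g h
    using subgroup.m_closed[OF sg(1) that] by (simp add: GL_def)
  have one: "mat 1 \<in> G" using subgroup.one_closed[OF sg(1)] by (simp add: GL_def)
  obtain F where adm: "admissible G F" and perfect: "\<And>H. H \<in> invariant_forms E G \<Longrightarrow>
      (\<And>l. l \<in> L - {0} \<Longrightarrow> \<phi> l * form_val E F l = 1 \<Longrightarrow> form_val E H l = 0) \<Longrightarrow> H = 0"
    by (rule perfect_form_exists[OF sg]) blast
  have Finv: "F \<in> invariant_forms E G" and F1: "\<And>l. l \<in> L - {0} \<Longrightarrow> 1 \<le> \<phi> l * form_val E F l"
    using adm by (auto simp: admissible_def)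
  define S where "S = {l \<in> L - {0}. \<phi> l * form_val E F l = 1}"
  have perf: "H = 0" if "H \<in> invariant_forms E G" "\<And>l. l \<in> S \<Longrightarrow> form_val E H l = 0" for H
    using perfect[OF that(1)] that(2) by (auto simp: S_def)
  \<comment> \<open>Without a nonzero lattice vector all inequalities would be vacuous and
    \<open>F = 0\<close> would be possible.\<close>
  obtain l0 where l0: "l0 \<in> L - {0}"
  proof -
    obtain m where "m > 0" "rscale (axis undefined 1) (of_nat m) \<in> L" using multiple_in_L by blast
    moreover have "rscale (axis undefined 1) (of_nat m) $ undefined \<noteq> (0 :: 'k)"
      using of_nat_nonzero[OF \<open>m > 0\<close>] by (simp add: axis_def)
    ultimately show thesis using that[of "rscale (axis undefined 1) (of_nat m)"] by (metis DiffI singletonD zero_index)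
  qed
  have "F \<noteq> 0"
  proof
    assume "F = 0"
    then show False using F1[OF l0] linear_0[OF linear_form_val, of l0] by simp
  qed
  \<comment> \<open>With no tight inequality, \<open>F\<close> itself would satisfy the premise of
    \<open>perf\<close> vacuously and be 0. So the value 1 is attained and is the minimum.\<close>
  then have "S \<noteq> {}" using perf[OF Finv] by auto
  have wmin: "weighted_min E L \<phi> F = 1"
    unfolding weighted_min_def
  proof (rule cInf_eq_minimum)
    show "1 \<in> (\<lambda>l. \<phi> l * form_val E F l) ` (L - {0})" using \<open>S \<noteq> {}\<close> by (force simp: S_def)
    show "1 \<le> x" if "x \<in> (\<lambda>l. \<phi> l * form_val E F l) ` (L - {0})" for x using that F1 by auto
  qed
  then have S: "min_vecs E L \<phi> F = S" by (auto simp: min_vecs_def S_def)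
  have finS: "finite S"
    using admissible_finite[OF adm, of 1] by (rule finite_subset[rotated]) (auto simp: S_def)
  have GS: "(\<lambda>v. g *v v) ` S = S" if g: "g \<in> G" for g
  proof
    have gL: "(\<lambda>v. g *v v) ` L = L" using sub g by (auto simp: GL_def)
    have wg: "\<phi> (g *v x) = \<phi> x" if "x \<noteq> 0" for x
      using weight sub g that by (auto simp: is_weight_def)
    have fg: "form_val E F (g *v x) = form_val E F x" for x by (rule invariant_form_val[OF Finv g])
    show "(\<lambda>v. g *v v) ` S \<subseteq> S"
    proof
      fix y assume "y \<in> (\<lambda>v. g *v v) ` S"
      then obtain l where l: "l \<in> S" "y = g *v l" by blast
      then have lL: "l \<in> L - {0}" by (simp add: S_def)
      have "g *v l \<noteq> 0"
        using fg[of l] admissible_form_val[OF adm lL] by (metis form_val_0 not_one_le_zero)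
      moreover have "g *v l \<in> L" using gL lL by blast
      ultimately show "y \<in> S" using l lL by (simp add: S_def wg fg)
    qed
    show "S \<subseteq> (\<lambda>v. g *v v) ` S"
    proof
      fix y assume y: "y \<in> S"
      then obtain l where l: "l \<in> L" "y = g *v l" using gL by (auto simp: S_def)
      have "l \<noteq> 0" using y l by (auto simp: S_def)
      then have "l \<in> S" using y l by (simp add: S_def wg fg)
      then show "y \<in> (\<lambda>v. g *v v) ` S" using l by blast
    qed
  qed
  have basis: "\<exists>B\<subseteq>S. right_basis B"
  proof (rule right_basis_or_functional[of S])
    show ?thesis if "B \<subseteq> S" "right_basis B" for B using that by blast
    fix A :: "'k^'n^'n" assume A: "A \<noteq> 0" "\<And>s. s \<in> S \<Longrightarrow> A *v s = 0"
    have inv: "averaged_form G A \<in> invariant_forms E G"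
      by (intro averaged_form_invariant right_mult_bij sub sg mult)
    have "averaged_form G A = 0"
    proof (rule perf[OF inv])
      fix l assume "l \<in> S"
      \<comment> \<open>\<open>G\<close> permutes \<open>S\<close>, so every summand of the average
        vanishes on \<open>S\<close>, not only the one at the identity.\<close>
      then have "A *v (g *v l) = 0" if "g \<in> G" for g using GS[OF that] A(2) by blast
      then show "form_val E (averaged_form G A) l = 0"
        by (simp add: averaged_form_val sqnorm_def linear_0[OF linear_red_trace])
    qed
    then have "(\<Sum>g\<in>G. sqnorm (emb_vec (A *v (g *v v)))) = 0" for v
      using averaged_form_val[of G A v] linear_0[OF linear_form_val, of v] by simp
    then have "\<forall>g\<in>G. sqnorm (emb_vec (A *v (g *v v))) = 0" for v
      using sg(2) by (simp add: sum_nonneg_eq_0_iff sqnorm_nonneg)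
    then have "sqnorm (emb_vec (A *v v)) = 0" for v using one by (metis matrix_vector_mul_lid)
    then have "A *v v = 0" for v using sqnorm_0D emb_vec_inj by blast
    then have "A = 0" by (simp add: matrix_eq)
    then show ?thesis using A(1) by simp
  qed
  then obtain BS where BS: "BS \<subseteq> S" "right_basis BS" by blast
  define Aut where "Aut = {g \<in> carrier (GL L). (\<lambda>v. g *v v) ` S = S}"
  have "finite Aut"
  proof (rule inj_on_finite)
    \<comment> \<open>\<open>S\<close> contains a \<open>K\<close>-basis, so an automorphism is
      determined by its action on the finite set \<open>S\<close>.\<close>
    show "inj_on (\<lambda>g. \<lambda>s\<in>S. g *v s) Aut"
    proof (rule inj_onI)
      fix g h :: "'k^'n^'n"
      assume eq: "(\<lambda>s\<in>S. g *v s) = (\<lambda>s\<in>S. h *v s)"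
      have "g *v s = h *v s" if "s \<in> BS" for s using fun_cong[OF eq, of s] BS(1) that by auto
      moreover have "g *v v = h *v v" if "\<And>s. s \<in> BS \<Longrightarrow> g *v s = h *v s" for v
      proof -
        obtain c where v: "v = (\<Sum>b\<in>BS. rscale b (c b))" using BS(2) unfolding right_basis_def by blast
        show ?thesis unfolding v mult_vec_sum mult_rscale using that by (intro sum.cong) auto
      qed
      ultimately have "g *v v = h *v v" for v by blast
      then show "g = h" by (simp add: matrix_eq)
    qed
    show "(\<lambda>g. \<lambda>s\<in>S. g *v s) ` Aut \<subseteq> S \<rightarrow>\<^sub>E S" by (auto simp: Aut_def)
    show "finite (S \<rightarrow>\<^sub>E S)" using finS by (intro finite_PiE) auto
  qed
  moreover have "g ** h \<in> Aut" if "g \<in> Aut" "h \<in> Aut" for g h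
  proof -
    have "(\<lambda>v. (g ** h) *v v) ` X = (\<lambda>v. g *v v) ` (\<lambda>v. h *v v) ` X" for X
      by (simp add: image_image matrix_vector_mul_assoc)
    then show ?thesis using that by (simp add: Aut_def GL_def)
  qed
  moreover have "mat 1 \<in> Aut" by (simp add: Aut_def GL_def)
  moreover have "Aut \<subseteq> carrier (GL L)" by (auto simp: Aut_def)
  ultimately have "subgroup Aut (GL L)" by (intro finite_submonoid_subgroup)
  moreover have "G \<subseteq> Aut" using sub GS by (auto simp: Aut_def)
  ultimately have "Aut = G" using maxG \<open>finite Aut\<close> by blast
  have unique: "\<exists>c. F' = c *\<^sub>R F" if F': "F' \<in> min_class E L \<phi> F" "F' \<in> invariant_forms E G" for F'
  proof -
    \<comment> \<open>Both forms have constant weighted value on \<open>S\<close>, namely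
      \<open>c\<close> and 1, so \<open>F'\<close> minus \<open>c\<close> times \<open>F\<close>
      vanishes there and \<open>perf\<close> applies.\<close>
    define c where "c = weighted_min E L \<phi> F'"
    have "min_vecs E L \<phi> F' = S" using F'(1) S by (simp add: min_class_def)
    then have c: "\<phi> l * form_val E F' l = c" if "l \<in> S" for l
      using that by (auto simp: min_vecs_def c_def)
    have "F' - c *\<^sub>R F = 0"
    proof (rule perf)
      show "F' - c *\<^sub>R F \<in> invariant_forms E G"
        by (intro Real_Vector_Spaces.subspace_diff Real_Vector_Spaces.subspace_scale subspace_invariant_forms F' Finv)
      fix l assume l: "l \<in> S"
      then have "\<phi> l > 0" "\<phi> l * form_val E F l = 1" using weight_pos by (auto simp: S_def)
      then have "\<phi> l * form_val E (F' - c *\<^sub>R F) l = 0"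
        using c[OF l] by (simp add: linear_diff[OF linear_form_val] linear_scale[OF linear_form_val] right_diff_distrib)
      then show "form_val E (F' - c *\<^sub>R F) l = 0" using \<open>\<phi> l > 0\<close> by simp
    qed
    then show ?thesis by (intro exI[of _ c]) simp
  qed
  show thesis
    using that[of F] admissible_pos_cone[OF adm] Finv \<open>F \<noteq> 0\<close> basis \<open>Aut = G\<close> unique
    unfolding S Aut_def by blast
qed

end

theorem theorem6p5:
  fixes scaleQ :: "rat \<Rightarrow> 'k::division_ring \<Rightarrow> 'k"
    and E :: "('k, 'a::real_algebra_1, 'h::finite, 'd::finite) real_extension"
    and O_K :: "'k set"
    and L :: "('k^'n) set"
    and \<phi> :: "'k^'n \<Rightarrow> real"
    and G :: "('k^'n^'n) set"
  assumes "rat_division_algebra scaleQ"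
    and "is_real_extension scaleQ E"
    and "maximal_order scaleQ O_K"
    and "right_lattice O_K L"
    and "is_weight L \<phi>"
    and "maximal_finite_subgroup G (GL L)"
  shows "\<exists>C. is_minimal_class E L \<phi> C \<and> well_rounded E L \<phi> C \<and> G = Aut_class E L \<phi> C \<and>
    span (C \<inter> invariant_forms E G) \<subseteq> invariant_forms E G \<and>
    dim (span (C \<inter> invariant_forms E G)) = 1"
proof -
  interpret K: rat_division_algebra scaleQ by fact
  obtain B0 where B0: "finite B0" "K.span B0 = UNIV" using K.finite_dimensional by blast
  obtain B where B: "B \<subseteq> B0" "K.independent B" "B0 \<subseteq> K.span B"
    using K.maximal_independent_subset[of B0] by blast
  have spB: "K.span B = UNIV" using K.span_minimal[OF B(3) K.subspace_span] B0(2) by blast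
  have finB: "finite B" using B(1) B0(1) finite_subset by blast
  interpret W: weighted_lattice scaleQ E B O_K L \<phi>
    by unfold_locales (use assms B finB spB in \<open>auto simp: maximal_order_def\<close>)
  obtain F where F: "F \<in> pos_cone E" "F \<in> invariant_forms E G" "F \<noteq> 0"
    "\<exists>S\<subseteq>min_vecs E L \<phi> F. right_basis S"
    "G = {g \<in> carrier (GL L). (\<lambda>v. g *v v) ` min_vecs E L \<phi> F = min_vecs E L \<phi> F}"
    "\<And>F'. F' \<in> min_class E L \<phi> F \<Longrightarrow> F' \<in> invariant_forms E G \<Longrightarrow> \<exists>c. F' = c *\<^sub>R F"
    by (rule W.maximal_finite_subgroup_perfect_class[OF assms(6)]) blast
  define C where "C = min_class E L \<phi> F"
  have FC: "F \<in> C" using F(1) by (simp add: C_def min_class_def)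
  \<comment> \<open>All members of the class share their minimal vectors and \<open>F\<close> is one
    of them, so the intersection over \<open>C\<close> collapses.\<close>
  have vecs: "class_min_vecs E L \<phi> C = min_vecs E L \<phi> F"
    using FC by (auto simp: class_min_vecs_def C_def min_class_def)
  let ?W = "C \<inter> invariant_forms E G"
  \<comment> \<open>Lying between \<open>{F}\<close> and its span, \<open>?W\<close> spans exactly
    the line of \<open>F\<close>.\<close>
  have "?W \<subseteq> span {F}" using F(6) by (auto simp: C_def span_singleton)
  moreover have "{F} \<subseteq> ?W" using FC F(2) by simp
  ultimately have "span ?W = span {F}" by (metis span_mono span_minimal subspace_span subset_antisym)
  then have "dim (span ?W) = 1" using F(3) by (simp add: dim_eq_card_independent)
  moreover have "span ?W \<subseteq> invariant_forms E G"
    by (rule span_minimal) (auto intro: W.subspace_invariant_forms)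
  moreover have "is_minimal_class E L \<phi> C" using F(1) by (auto simp: is_minimal_class_def C_def)
  moreover have "well_rounded E L \<phi> C" using F(4) by (simp add: well_rounded_def vecs)
  moreover have "G = Aut_class E L \<phi> C" using F(5) by (simp add: Aut_class_def vecs)
  ultimately show ?thesis by blast
qed

end
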